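(* Let $V^{\mathrm{ext}}_j$ ($j=1,2$) be two exterior potentials and let $f_j$ be the corresponding solution of the Vlasov--Poisson system with exterior potential $V^{\mathrm{ext}}_j$, with density $\rho_j(t,x)=\int_{\mathbb R^d}f_j(t,x,v)\,dv$ and with the same fixed initial datum $f^0$. Assume $V^{\mathrm{ext}}_j\in C^\infty([0,T]\times\mathbb T^d)$ and $f_j\in C^\infty([0,T]\times\mathbb T^d\times\mathbb R^d)$. Moreover, assume the uniform moment bounds $$\forall k\in\mathbb N,\qquad |v|^{k+1}\,|\nabla_x^kf_j(t,x,v)|\leq C_k(v),$$ where each $C_k\in L^1(\mathbb R^d_v)$ and the bounds hold uniformly in $(t,x)$. If $\rho_1(t,x)=\rho_2(t,x)=:\rho(t,x)$ for all $(t,x)\in[0,T)\times\mathbb T^d$ and the nodal set $\{x\in\mathbb T^d:\rho(0,x)=0\}$ has zero volume, then for every $k\in\mathbb N$ there exists a constant $c_k\in\mathbb R$ such that $$\partial_t^k\bigl(V^{\mathrm{ext}}_1-V^{\mathrm{ext}}_2\bigr)(0,x)=c_k\qquad\text{for all }x\in\mathbb T^d.$$ If, in addition, $t\mapsto(V^{\mathrm{ext}}_1-V^{\mathrm{ext}}_2)(t,x)$ is real-analytic for each fixed $x$, then $$V^{\mathrm{ext}}_1(t,x)-V^{\mathrm{ext}}_2(t,x)=C(t)=\sum_{k\geq0}\frac{c_k}{k!}\,t^k.$$ Simply put, the map $$\nabla_xV^{\mathrm{ext}}\in\nabla\mathcal A_T\longmapsto\bigl(\rho[\nabla_xV^{\mathrm{ext}}],\,f|_{t=0}\bigr)\in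 C^\infty([0,T]\times\mathbb T^d)$$ is injective.
   Context: Here $d\in\mathbb N^*$, $T>0$ and $\mathbb T^d=(\mathbb R/2\pi\mathbb Z)^d$. The Vlasov--Poisson system with exterior potential $V^{\mathrm{ext}}=V^{\mathrm{ext}}(t,x)$ and initial datum $f^0=f^0(x,v)$, for the unknown $f=f(t,x,v)$, $(t,x,v)\in[0,T]\times\mathbb T^d\times\mathbb R^d$, is $$\partial_tf+v\cdot\nabla_xf+\nabla_xV\cdot\nabla_vf+\nabla_xV^{\mathrm{ext}}\cdot\nabla_vf=0,\qquad -\Delta_xV=\int_{\mathbb R^d}f\,dv-1,\qquad f|_{t=0}=f^0.$$ The initial datum $f^0$ is fixed and can be taken nonnegative with $\int_{\mathbb T^d}\int_{\mathbb R^d}f^0(x,v)\,dx\,dv=1$. Since $f$ is determined by $\nabla_xV^{\mathrm{ext}}$, the spatial density $\int_{\mathbb R^d}f\,dv$ of the solution is denoted $\rho[\nabla_xV^{\mathrm{ext}}]$. The class of time-analytic exterior fields is $$\nabla\mathcal A_T=\bigl\{\nabla_xV^{\mathrm{ext}}:\ V^{\mathrm{ext}}\in C^\infty([0,T]\times\mathbb T^d),\ \forall x\in\mathbb T^d,\ t\mapsto V^{\mathrm{ext}}(t,x)\text{ is real-analytic}\bigr\}.$$ In the displayed map, the target space $C^\infty([0,T]\times\mathbb T^d)$ refers to the density component $\rho[\nabla_xV^{\mathrm{ext}}]$.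
   Formalization: The series identity for C(t) is asserted with positive radius of convergence and at every t in [0,T] where the series converges, since for a real-analytic difference such as 1/(1+t^2) it may diverge; the total mass 1 of f^0 is taken with respect to dx/(2π)^d. *)

theory Defs
  imports "HOL-Analysis.Analysis"
begin

text \<open>Functions on the torus (R / 2 pi Z)^d are rendered as functions on R^d that are
  2 pi-periodic in every coordinate; d = CARD('n).\<close>

definition torus_periodic :: "(real ^ 'n \<Rightarrow> 'b) \<Rightarrow> bool" where
  "torus_periodic g \<longleftrightarrow> (\<forall>x i. g (x + axis i (2 * pi)) = g x)"

text \<open>A closed fundamental domain; its faces, which are identified in the torus, are null sets.\<close>

definition torus_cell :: "(real ^ 'n) set" where
  "torus_cell = cbox 0 (\<chi> i. 2 * pi)"

text \<open>Derivatives are taken within \<open>S\<close>, hence one-sided at the ends of a time interval. On the sets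
  used below (convex with nonempty interior) they are unique, and \<open>Ck_on k S\<close> says that all
  derivatives up to order \<open>k\<close> exist and are continuous on \<open>S\<close>, boundary included.\<close>

primrec Ck_on ::
    "nat \<Rightarrow> 'a::real_normed_vector set \<Rightarrow> ('a \<Rightarrow> 'b::real_normed_vector) \<Rightarrow> bool" where
  "Ck_on 0 S g = continuous_on S g"
| "Ck_on (Suc k) S g =
     (\<exists>g'. (\<forall>x\<in>S. (g has_derivative g' x) (at x within S)) \<and> (\<forall>h. Ck_on k S (\<lambda>x. g' x h)))"

definition Cinf_on :: "'a::real_normed_vector set \<Rightarrow> ('a \<Rightarrow> 'b::real_normed_vector) \<Rightarrow> bool" where
  "Cinf_on S g \<longleftrightarrow> (\<forall>k. Ck_on k S g)"

definition Cinf_torus :: "real \<Rightarrow> (real \<Rightarrow> real ^ 'n \<Rightarrow> real) \<Rightarrow> bool" where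
  "Cinf_torus T V \<longleftrightarrow>
     (\<forall>t\<in>{0..T}. torus_periodic (V t)) \<and> Cinf_on ({0..T} \<times> UNIV) (\<lambda>(t, x). V t x)"

definition Cinf_phase :: "real \<Rightarrow> (real \<Rightarrow> real ^ 'n \<Rightarrow> real ^ 'n \<Rightarrow> real) \<Rightarrow> bool" where
  "Cinf_phase T f \<longleftrightarrow>
     (\<forall>t\<in>{0..T}. \<forall>v. torus_periodic (\<lambda>x. f t x v)) \<and>
     Cinf_on ({0..T} \<times> UNIV \<times> UNIV) (\<lambda>(t, x, v). f t x v)"

definition partial_deriv :: "'n \<Rightarrow> (real ^ 'n \<Rightarrow> real) \<Rightarrow> real ^ 'n \<Rightarrow> real" where
  "partial_deriv i g x = deriv (\<lambda>s. g (x + axis i s)) 0"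

definition grad :: "(real ^ 'n \<Rightarrow> real) \<Rightarrow> real ^ 'n \<Rightarrow> real ^ 'n" where
  "grad g x = (\<chi> i. partial_deriv i g x)"

definition laplace :: "(real ^ 'n \<Rightarrow> real) \<Rightarrow> real ^ 'n \<Rightarrow> real" where
  "laplace g x = (\<Sum>i\<in>UNIV. partial_deriv i (partial_deriv i g) x)"

text \<open>Euclidean norm of the tensor of all \<open>k\<close>-th order partial derivatives; the lists enumerate the
  index tuples (i_1, ..., i_k).\<close>

definition deriv_tensor_norm :: "nat \<Rightarrow> (real ^ 'n \<Rightarrow> real) \<Rightarrow> real ^ 'n \<Rightarrow> real" where
  "deriv_tensor_norm k g x =
     sqrt (\<Sum>is | length (is :: 'n list) = k. (foldr partial_deriv is g x)\<^sup>2)"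

definition time_deriv :: "real \<Rightarrow> (real \<Rightarrow> real) \<Rightarrow> real \<Rightarrow> real" where
  "time_deriv T g t = vector_derivative g (at t within {0..T})"

text \<open>Around every point of \<open>S\<close>, \<open>g\<close> is given on \<open>S\<close> by a convergent power series. For a compact
  interval this means that \<open>g\<close> extends real-analytically to an open neighbourhood.\<close>

definition real_analytic_on :: "(real \<Rightarrow> real) \<Rightarrow> real set \<Rightarrow> bool" where
  "real_analytic_on g S \<longleftrightarrow>
     (\<forall>t0\<in>S. \<exists>r>0. \<exists>a :: nat \<Rightarrow> real.
        \<forall>t\<in>S. \<bar>t - t0\<bar> < r \<longrightarrow> (\<lambda>n. a n * (t - t0) ^ n) sums g t)"

definition spatial_density :: "(real ^ 'n \<Rightarrow> real ^ 'n \<Rightarrow> real) \<Rightarrow> real ^ 'n \<Rightarrow> real" where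
  "spatial_density g x = (\<integral>v. g x v \<partial>lborel)"

text \<open>The total mass is taken with respect to the normalised measure dx / (2 pi)^d: the Poisson
  equation is solvable on the torus only if the density has mean value 1.\<close>

definition initial_datum :: "(real ^ 'n \<Rightarrow> real ^ 'n \<Rightarrow> real) \<Rightarrow> bool" where
  "initial_datum f0 \<longleftrightarrow>
     (\<forall>x v. 0 \<le> f0 x v) \<and>
     (LINT x:torus_cell|lborel. spatial_density f0 x) / (2 * pi) ^ CARD('n) = 1"

text \<open>\<open>E\<close> is the exterior field, i.e. the gradient of the exterior potential. The self-consistent
  potential \<open>V\<close> is part of the unknown.\<close>

definition VP_solution ::
    "real \<Rightarrow> (real \<Rightarrow> real ^ 'n \<Rightarrow> real ^ 'n) \<Rightarrow> (real ^ 'n \<Rightarrow> real ^ 'n \<Rightarrow> real) \<Rightarrow>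
     (real \<Rightarrow> real ^ 'n \<Rightarrow> real ^ 'n \<Rightarrow> real) \<Rightarrow> bool" where
  "VP_solution T E f0 f \<longleftrightarrow>
     (\<exists>V :: real \<Rightarrow> real ^ 'n \<Rightarrow> real.
        (\<forall>t\<in>{0..T}. torus_periodic (V t) \<and> Ck_on 2 UNIV (V t)) \<and>
        (\<forall>t\<in>{0..T}. \<forall>x v.
           time_deriv T (\<lambda>s. f s x v) t + v \<bullet> grad (\<lambda>y. f t y v) x
             + grad (V t) x \<bullet> grad (f t x) v + E t x \<bullet> grad (f t x) v = 0) \<and>
        (\<forall>t\<in>{0..T}. \<forall>x. - laplace (V t) x = spatial_density (f t) x - 1)) \<and>
     f 0 = f0"

definition moment_bounds :: "real \<Rightarrow> (real \<Rightarrow> real ^ 'n \<Rightarrow> real ^ 'n \<Rightarrow> real) \<Rightarrow> bool" where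
  "moment_bounds T f \<longleftrightarrow>
     (\<forall>k. \<exists>C :: real ^ 'n \<Rightarrow> real. integrable lebesgue C \<and>
        (\<forall>t\<in>{0..T}. \<forall>x v.
           norm v ^ (k + 1) * deriv_tensor_norm k (\<lambda>y. f t y v) x \<le> C v))"

definition regular_VP_solution ::
    "real \<Rightarrow> (real \<Rightarrow> real ^ 'n \<Rightarrow> real ^ 'n) \<Rightarrow> (real ^ 'n \<Rightarrow> real ^ 'n \<Rightarrow> real) \<Rightarrow>
     (real \<Rightarrow> real ^ 'n \<Rightarrow> real ^ 'n \<Rightarrow> real) \<Rightarrow> bool" where
  "regular_VP_solution T E f0 f \<longleftrightarrow>
     VP_solution T E f0 f \<and> Cinf_phase T f \<and> moment_bounds T f"

text \<open>Fields are restricted to \<open>[0, T]\<close>, so that equality of elements of this set is equality on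
  \<open>[0, T]\<close> times the torus.\<close>

definition analytic_fields :: "real \<Rightarrow> (real \<Rightarrow> real ^ 'n \<Rightarrow> real ^ 'n) set" where
  "analytic_fields T =
     {restrict (\<lambda>t. grad (V t)) {0..T} | V.
        Cinf_torus T V \<and> (\<forall>x. real_analytic_on (\<lambda>t. V t x) {0..T})}"

end

theory Submission
  imports Defs "HOL-Complex_Analysis.Complex_Analysis"
begin

text \<open>
  The argument follows characteristics. Let \<open>F\<^sub>j\<close> be the total force felt by \<open>f\<^sub>j\<close>, self-consistent plus
  exterior. Equal densities have equal self-consistent forces, so \<open>F\<^sub>1 - F\<^sub>2\<close> is the gradient of the
  difference \<open>U\<close> of the exterior potentials. Suppose that at time 0 the time derivatives of
  \<open>grad U\<close> of order below \<open>k\<close> vanish, and let \<open>w\<close> be the \<open>k\<close>-th time derivative of \<open>U\<close> at time 0.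
  Then \<open>F\<^sub>1 - F\<^sub>2 = t^k / k! grad w + O(t^(k+1))\<close>, and integrating twice in time, two characteristics
  issued from the same \<open>(x, v)\<close> separate like
  \<open>X\<^sub>1(t) - X\<^sub>2(t) = c t^(k+2) grad w(x) + O(t^(k+3) (1 + |v|))\<close> with \<open>c > 0\<close>.
  Since \<open>f\<^sub>j\<close> is the initial datum transported by a measure-preserving flow, testing the equality of the
  densities against \<open>w\<close> itself gives
  \<open>0 = \<integral>\<integral> f\<^sup>0 (w(X\<^sub>1) - w(X\<^sub>2)) = c t^(k+2) \<integral> \<rho>(0) |grad w|\<^sup>2 + O(t^(k+3))\<close>.
  Letting \<open>t\<close> tend to 0, \<open>\<rho>(0) |grad w|\<^sup>2\<close> vanishes; as the nodal set is negligible, \<open>grad w = 0\<close>, and the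
  induction on \<open>k\<close> proceeds (\<open>grad_eq_0_if_equal_densities\<close>,
  \<open>time_derivatives_of_potential_difference_constant\<close>).

  Two ingredients make this rigorous. The first is that \<open>F\<^sub>j\<close> is bounded and Lipschitz in \<open>x\<close>, uniformly in
  time, although the self-consistent potential is only given as a \<open>C\<^sup>2\<close> function for each separate time.
  The moment bounds of orders 0, 1 and 2 make the density bounded in \<open>C\<^sup>2\<close> in the sense of finite
  differences, and a Bernstein-type maximum principle bounds \<open>grad V\<close> by the Lipschitz constant of the
  Laplacian of \<open>V\<close> (\<open>torus_grad_bound\<close>); applied to \<open>V\<close>, to the difference of a translate of \<open>V\<close> and \<open>V\<close>, and
  to the difference of two potentials, it yields the bound, the Lipschitz bound and uniqueness. The second is
  that characteristics are replaced by the symplectic Euler scheme. Each step is a composition of shears,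
  hence preserves the measure exactly, and a \<open>C\<^sup>1\<close> solution of the transport equation is constant along
  the scheme up to an error that vanishes with the step size (\<open>discrete_flow_approximation\<close>). This suits a
  force that is described separately at each time.

  For potentials that are analytic in time, the Taylor coefficients at 0 determine the difference on the
  whole interval by analytic continuation; at an end point of the disc of convergence Abel's limit
  theorem takes over (\<open>real_analytic_Taylor_series\<close>).
\<close>

section \<open>Directional derivatives of smooth functions\<close>

definition line_deriv :: "'a::real_normed_vector \<Rightarrow> ('a \<Rightarrow> real) \<Rightarrow> 'a \<Rightarrow> real" where
  "line_deriv h f p = deriv (\<lambda>s. f (p + s *\<^sub>R h)) 0"

lemma Ck_on_cong:
  assumes "\<And>x. x \<in> S \<Longrightarrow> f x = g x" "Ck_on k S f"
  shows "Ck_on k S g"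
  using assms
proof (induction k arbitrary: f g)
  case 0
  then show ?case by (metis Ck_on.simps(1) continuous_on_cong)
next
  case (Suc k)
  then obtain g' where g': "\<forall>x\<in>S. (f has_derivative g' x) (at x within S)"
    "\<forall>h. Ck_on k S (\<lambda>x. g' x h)" by auto
  have "\<forall>x\<in>S. (g has_derivative g' x) (at x within S)"
    using g'(1) Suc.prems(1) by (metis has_derivative_transform)
  then show ?case using g'(2) by auto
qed

lemma Ck_on_SucD: "Ck_on (Suc k) S f \<Longrightarrow> Ck_on k S f"
proof (induction k arbitrary: f)
  case 0
  then show ?case
    by (auto simp: continuous_on_eq_continuous_within dest!: has_derivative_continuous)
next
  case (Suc k)
  then obtain g' where "\<forall>x\<in>S. (f has_derivative g' x) (at x within S)"
    "\<forall>h. Ck_on (Suc k) S (\<lambda>x. g' x h)" by (auto simp del: Ck_on.simps(1))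
  then show ?case using Suc.IH by (auto simp del: Ck_on.simps(1))
qed

lemma Ck_on_imp_continuous_on: "Ck_on k S f \<Longrightarrow> continuous_on S f"
  by (induction k) (auto simp del: Ck_on.simps(2) dest: Ck_on_SucD)

lemma Ck_on_diff:
  assumes "Ck_on k S f" "Ck_on k S g"
  shows "Ck_on k S (\<lambda>x. f x - g x)"
  using assms
proof (induction k arbitrary: f g)
  case 0
  then show ?case by (simp add: continuous_on_diff)
next
  case (Suc k)
  then obtain f' g' where "\<forall>x\<in>S. (f has_derivative f' x) (at x within S)"
    "\<forall>h. Ck_on k S (\<lambda>x. f' x h)" "\<forall>x\<in>S. (g has_derivative g' x) (at x within S)"
    "\<forall>h. Ck_on k S (\<lambda>x. g' x h)" by auto
  then show ?case
    using Suc.IH by (auto intro!: exI[of _ "\<lambda>x h. f' x h - g' x h"] has_derivative_diff)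
qed

lemma Ck_on_compose_affine:
  fixes g :: "'a::real_normed_vector \<Rightarrow> 'c::real_normed_vector" and L :: "'b::real_normed_vector \<Rightarrow> 'a"
  assumes L: "bounded_linear L" and S: "\<And>x. a + L x \<in> S" and g: "Ck_on k S g"
  shows "Ck_on k UNIV (\<lambda>x. g (a + L x))"
  using g
proof (induction k arbitrary: g)
  case 0
  have "continuous_on UNIV (\<lambda>x. a + L x)"
    by (intro continuous_intros linear_continuous_on L)
  then have "continuous_on UNIV (\<lambda>x. g (a + L x))"
    by (rule continuous_on_compose2[rotated]) (use 0 S in auto)
  then show ?case by simp
next
  case (Suc k)
  then obtain g' where g': "\<And>x. x \<in> S \<Longrightarrow> (g has_derivative g' x) (at x within S)"
    "\<And>h. Ck_on k S (\<lambda>x. g' x h)" by auto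
  have "((\<lambda>x. g (a + L x)) has_derivative (\<lambda>h. g' (a + L x) (L h))) (at x)" for x
  proof -
    have "((\<lambda>x. a + L x) has_derivative L) (at x within UNIV)"
      using bounded_linear.has_derivative[OF L has_derivative_ident] by (auto intro!: derivative_eq_intros)
    then have "(g \<circ> (\<lambda>x. a + L x) has_derivative g' (a + L x) \<circ> L) (at x within UNIV)"
      by (rule diff_chain_within) (use g' S in \<open>auto intro: has_derivative_subset\<close>)
    then show ?thesis by (simp add: comp_def)
  qed
  moreover have "Ck_on k UNIV (\<lambda>x. g' (a + L x) (L h))" for h
    using Suc.IH[OF g'(2)] .
  ultimately show ?case by (auto intro!: exI[of _ "\<lambda>x h. g' (a + L x) (L h)"])
qed

text \<open>Whatever representative of the derivative within \<open>S\<close> is chosen, its value on a direction \<open>h\<close> along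
  which \<open>S\<close> contains full lines is the classical directional derivative. This turns the existential
  in the definition of \<open>Ck_on\<close> into statements about concrete functions.\<close>

lemma has_line_deriv_unique:
  assumes f: "(f has_derivative D) (at p within S)" and S: "\<And>s. p + s *\<^sub>R h \<in> S"
  shows "((\<lambda>s. f (p + s *\<^sub>R h)) has_field_derivative line_deriv h f p) (at 0)"
    and "D h = line_deriv h f p"
proof -
  have lin: "linear D" using f by (simp add: has_derivative_linear)
  have "((\<lambda>s. p + s *\<^sub>R h) has_derivative (\<lambda>s. s *\<^sub>R h)) (at 0 within UNIV)"
    by (auto intro!: derivative_eq_intros)
  then have "(f \<circ> (\<lambda>s. p + s *\<^sub>R h) has_derivative D \<circ> (\<lambda>s. s *\<^sub>R h)) (at 0 within UNIV)"
    by (rule diff_chain_within) (use f S in \<open>auto intro: has_derivative_subset\<close>)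
  then have *: "((\<lambda>s. f (p + s *\<^sub>R h)) has_field_derivative D h) (at 0)"
    unfolding has_field_derivative_def o_def
    by (rule has_derivative_eq_rhs) (auto simp: linear_cmul[OF lin] fun_eq_iff)
  then show "D h = line_deriv h f p"
    unfolding line_deriv_def by (simp add: DERIV_imp_deriv)
  with * show "((\<lambda>s. f (p + s *\<^sub>R h)) has_field_derivative line_deriv h f p) (at 0)" by simp
qed

lemma Ck_has_line_deriv:
  assumes "Ck_on (Suc k) S f" "\<And>s. p + s *\<^sub>R h \<in> S"
  shows "((\<lambda>s. f (p + s *\<^sub>R h)) has_field_derivative line_deriv h f (p + s *\<^sub>R h)) (at s)"
proof -
  have "p + s *\<^sub>R h \<in> S" by (rule assms(2))
  then obtain D where "(f has_derivative D) (at (p + s *\<^sub>R h) within S)"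
    using assms(1) by auto
  moreover have "(p + s *\<^sub>R h) + r *\<^sub>R h \<in> S" for r
    using assms(2)[of "s + r"] by (simp add: algebra_simps)
  ultimately have "((\<lambda>r. f ((p + s *\<^sub>R h) + r *\<^sub>R h)) has_field_derivative
      line_deriv h f (p + s *\<^sub>R h)) (at 0)"
    by (rule has_line_deriv_unique(1))
  then show ?thesis
    using DERIV_shift[of "\<lambda>s. f (p + s *\<^sub>R h)" "line_deriv h f (p + s *\<^sub>R h)" 0 s]
    by (simp add: algebra_simps)
qed

lemma Ck_line_deriv:
  assumes "Ck_on (Suc k) S f" "\<And>p s. p \<in> S \<Longrightarrow> p + s *\<^sub>R h \<in> S"
  shows "Ck_on k S (line_deriv h f)"
proof -
  obtain f' where f': "\<forall>x\<in>S. (f has_derivative f' x) (at x within S)"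
    "\<forall>h. Ck_on k S (\<lambda>x. f' x h)" using assms(1) by auto
  show ?thesis
    by (rule Ck_on_cong[OF _ f'(2)[rule_format, of h]])
      (use f'(1) assms(2) has_line_deriv_unique(2) in blast)
qed

lemma Cinf_line_deriv:
  assumes "Cinf_on S f" "\<And>p s. p \<in> S \<Longrightarrow> p + s *\<^sub>R h \<in> S"
  shows "Cinf_on S (line_deriv h f)"
  using assms Ck_line_deriv unfolding Cinf_on_def by blast

text \<open>In the time direction only one-sided derivatives exist at the ends of the interval; they are still
  unique there because \<open>T > 0\<close>.\<close>

lemma has_time_deriv_unique:
  fixes F :: "real \<times> 'b::real_normed_vector \<Rightarrow> real"
  assumes T: "T > 0" and t: "t \<in> {0..T}"
    and F: "(F has_derivative D) (at (t, y) within {0..T} \<times> UNIV)"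
  shows "((\<lambda>s. F (s, y)) has_field_derivative time_deriv T (\<lambda>s. F (s, y)) t) (at t within {0..T})"
    and "D (1, 0) = time_deriv T (\<lambda>s. F (s, y)) t"
proof -
  have lin: "linear D" using F by (simp add: has_derivative_linear)
  have "((\<lambda>s. (s, y)) has_derivative (\<lambda>s. (s, 0))) (at t within {0..T})"
    by (auto intro!: derivative_eq_intros)
  then have "(F \<circ> (\<lambda>s. (s, y)) has_derivative D \<circ> (\<lambda>s. (s, 0))) (at t within {0..T})"
    by (rule diff_chain_within) (use F in \<open>auto intro: has_derivative_subset\<close>)
  moreover have Ds: "D (s, 0) = D (1, 0) * s" for s
    using linear_cmul[OF lin, of s "(1, 0)"] by simp
  have DD: "D \<circ> (\<lambda>s. (s, 0)) = (*) (D (1, 0))"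
    by (intro ext) (simp only: o_def, rule Ds)
  ultimately have *: "((\<lambda>s. F (s, y)) has_field_derivative D (1, 0)) (at t within {0..T})"
    unfolding has_field_derivative_def by (simp only: DD o_def[of F])
  then have "((\<lambda>s. F (s, y)) has_vector_derivative D (1, 0)) (at t within {0..T})"
    by (simp add: has_real_derivative_iff_has_vector_derivative)
  then show "D (1, 0) = time_deriv T (\<lambda>s. F (s, y)) t"
    unfolding time_deriv_def
    using T t by (intro vector_derivative_within_closed_interval[symmetric])
  with * show "((\<lambda>s. F (s, y)) has_field_derivative time_deriv T (\<lambda>s. F (s, y)) t)
      (at t within {0..T})" by simp
qed

lemma Ck_has_time_deriv:
  fixes F :: "real \<times> 'b::real_normed_vector \<Rightarrow> real"
  assumes "T > 0" "t \<in> {0..T}" "Ck_on (Suc k) ({0..T} \<times> UNIV) F"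
  shows "((\<lambda>s. F (s, y)) has_field_derivative time_deriv T (\<lambda>s. F (s, y)) t) (at t within {0..T})"
  using assms has_time_deriv_unique(1)[OF assms(1,2)] by fastforce

lemma Ck_time_deriv:
  fixes F :: "real \<times> 'b::real_normed_vector \<Rightarrow> real"
  assumes T: "T > 0" and F: "Ck_on (Suc k) ({0..T} \<times> UNIV) F"
  shows "Ck_on k ({0..T} \<times> UNIV) (\<lambda>(t, y). time_deriv T (\<lambda>s. F (s, y)) t)"
proof -
  obtain F' where F': "\<forall>x\<in>{0..T} \<times> UNIV. (F has_derivative F' x) (at x within {0..T} \<times> UNIV)"
    "\<forall>h. Ck_on k ({0..T} \<times> UNIV) (\<lambda>x. F' x h)" using F by auto
  have eq: "F' x (1, 0) = (case x of (t, y) \<Rightarrow> time_deriv T (\<lambda>s. F (s, y)) t)"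
    if "x \<in> {0..T} \<times> UNIV" for x
    using that F'(1) has_time_deriv_unique(2)[OF T, of "fst x" F "F' x" "snd x"] by (cases x) auto
  show ?thesis
    by (rule Ck_on_cong[OF eq F'(2)[rule_format, of "(1, 0)"]])
qed

lemma axis_scaleR: "axis i s = s *\<^sub>R axis i (1::real)"
  by (simp add: vec_eq_iff axis_def)

lemma axis_zero [simp]: "axis i (0::real) = 0"
  by (simp add: vec_eq_iff axis_def)

lemma norm_axis: "norm (axis i (s::real)) = \<bar>s\<bar>"
  by (subst axis_scaleR) (simp add: norm_axis_1)

lemma partial_deriv_eq_line_deriv: "partial_deriv i g x = line_deriv (axis i 1) g x"
  unfolding partial_deriv_def line_deriv_def by (simp add: axis_scaleR[symmetric])

lemma Ck_partial_deriv: "Ck_on (Suc k) UNIV g \<Longrightarrow> Ck_on k UNIV (partial_deriv i g)"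
  using Ck_line_deriv[of k UNIV g "axis i 1"] by (simp add: partial_deriv_eq_line_deriv[abs_def] eta_contract_eq)

lemma has_derivative_eq_grad:
  fixes g :: "real ^ 'n \<Rightarrow> real"
  assumes D: "(g has_derivative D) (at x)"
  shows "D h = grad g x \<bullet> h"
proof -
  have lin: "linear D" using D by (simp add: has_derivative_linear)
  have "D h = D (\<Sum>i\<in>UNIV. (h $ i) *\<^sub>R axis i 1)"
    by (simp add: basis_expansion scalar_mult_eq_scaleR[symmetric])
  also have "\<dots> = (\<Sum>i\<in>UNIV. (h $ i) * D (axis i 1))"
    by (simp add: linear_sum[OF lin] linear_cmul[OF lin])
  also have "\<dots> = grad g x \<bullet> h"
    using has_line_deriv_unique(2)[OF D]
    by (simp add: inner_vec_def grad_def partial_deriv_eq_line_deriv mult.commute)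
  finally show ?thesis .
qed

lemma Ck_has_grad:
  fixes g :: "real ^ 'n \<Rightarrow> real"
  assumes "Ck_on (Suc k) UNIV g"
  shows "(g has_derivative (\<lambda>h. grad g x \<bullet> h)) (at x)"
proof -
  obtain D where D: "(g has_derivative D) (at x)" using assms by auto
  then have "D = (\<lambda>h. grad g x \<bullet> h)" using has_derivative_eq_grad by blast
  with D show ?thesis by simp
qed

lemma Ck_has_partial_deriv:
  fixes g :: "real ^ 'n \<Rightarrow> real"
  assumes "Ck_on (Suc k) UNIV g"
  shows "((\<lambda>s. g (x + axis i s)) has_field_derivative partial_deriv i g (x + axis i s)) (at s)"
  using Ck_has_line_deriv[of k UNIV g x "axis i 1" s] assms
  by (simp add: axis_scaleR[symmetric] partial_deriv_eq_line_deriv)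

lemma continuous_on_grad:
  fixes g :: "real ^ 'n \<Rightarrow> real"
  assumes "Ck_on (Suc k) UNIV g"
  shows "continuous_on UNIV (grad g)"
  unfolding grad_def
  by (intro continuous_on_vec_lambda Ck_on_imp_continuous_on[OF Ck_partial_deriv[OF assms]])

lemma grad_diff:
  fixes f g :: "real ^ 'n \<Rightarrow> real"
  assumes "Ck_on (Suc k) UNIV f" "Ck_on (Suc k) UNIV g"
  shows "grad (\<lambda>x. f x - g x) x = grad f x - grad g x"
proof -
  have "((\<lambda>s. f (x + axis i s) - g (x + axis i s)) has_field_derivative
      partial_deriv i f x - partial_deriv i g x) (at 0)" for i
    using DERIV_diff[OF Ck_has_partial_deriv[OF assms(1), of x i 0]
      Ck_has_partial_deriv[OF assms(2), of x i 0]]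
    by simp
  then show ?thesis
    by (simp add: grad_def vec_eq_iff partial_deriv_def[of _ "\<lambda>x. f x - g x"] DERIV_imp_deriv)
qed

lemma partial_deriv_shift: "partial_deriv i (\<lambda>x. g (x + a)) x = partial_deriv i g (x + a)"
  by (simp add: partial_deriv_def algebra_simps)

lemma grad_shift: "grad (\<lambda>x. g (x + a)) x = grad g (x + a)"
  by (simp add: grad_def partial_deriv_shift)

lemma laplace_shift: "laplace (\<lambda>x. g (x + a)) x = laplace g (x + a)"
proof -
  have *: "partial_deriv i (\<lambda>x. g (x + a)) = (\<lambda>x. partial_deriv i g (x + a))" for i
    by (rule ext) (rule partial_deriv_shift)
  show ?thesis unfolding laplace_def * by (simp only: partial_deriv_shift)
qed

lemma Ck_on_shift:
  assumes "Ck_on k UNIV g"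
  shows "Ck_on k UNIV (\<lambda>x. g (x + a))"
  using Ck_on_compose_affine[OF bounded_linear_ident _ assms, of a] by (simp add: add.commute)

section \<open>Periodic functions\<close>

definition lattice_vec :: "(int ^ 'n) \<Rightarrow> real ^ 'n" where
  "lattice_vec k = (\<chi> i. 2 * pi * of_int (k $ i))"

lemma torus_periodicD: "torus_periodic g \<Longrightarrow> g (x + axis i (2 * pi)) = g x"
  by (simp add: torus_periodic_def)

lemma torus_periodic_axis_int:
  assumes "torus_periodic g"
  shows "g (x + axis i (2 * pi * of_int m)) = g x"
proof (induction m arbitrary: x rule: int_induct[where k = 0])
  case base
  then show ?case by simp
next
  case (step1 m)
  have eq: "x + axis i (2 * pi * of_int (m + 1)) = (x + axis i (2 * pi * of_int m)) + axis i (2 * pi)"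
    by (auto simp: vec_eq_iff axis_def algebra_simps)
  show ?case unfolding eq by (simp only: step1 torus_periodicD[OF assms])
next
  case (step2 m)
  have "(x + axis i (2 * pi * of_int (m - 1))) + axis i (2 * pi) = x + axis i (2 * pi * of_int m)"
    by (auto simp: vec_eq_iff axis_def algebra_simps)
  then show ?case
    using step2(2)[of x] torus_periodicD[OF assms, of "x + axis i (2 * pi * of_int (m - 1))" i] by metis
qed

lemma torus_periodic_lattice:
  assumes "torus_periodic g"
  shows "g (x + lattice_vec k) = g x"
proof -
  have "g (x + (\<Sum>i\<in>A. axis i (2 * pi * of_int (k $ i)))) = g x" if "finite A" for A
    using that
  proof (induction A arbitrary: x)
    case empty
    then show ?case by simp
  next
    case (insert j A)
    have "x + (\<Sum>i\<in>insert j A. axis i (2 * pi * of_int (k $ i))) =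
      (x + axis j (2 * pi * of_int (k $ j))) + (\<Sum>i\<in>A. axis i (2 * pi * of_int (k $ i)))"
      using insert by (simp add: algebra_simps)
    then show ?case by (simp only: insert.IH torus_periodic_axis_int[OF assms])
  qed
  moreover have "(\<Sum>i\<in>UNIV. axis i (2 * pi * of_int (k $ i))) = lattice_vec k"
    by (simp add: vec_eq_iff lattice_vec_def axis_def if_distrib cong: if_cong)
  ultimately show ?thesis by (metis finite)
qed

lemma ex_lattice_cell:
  obtains k where "x + lattice_vec k \<in> torus_cell"
proof
  let ?k = "\<chi> i. - \<lfloor>x $ i / (2 * pi)\<rfloor>"
  have "0 \<le> x $ i + 2 * pi * of_int (- \<lfloor>x $ i / (2 * pi)\<rfloor>)"
    "x $ i + 2 * pi * of_int (- \<lfloor>x $ i / (2 * pi)\<rfloor>) \<le> 2 * pi" for i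
  proof -
    have "of_int \<lfloor>x $ i / (2 * pi)\<rfloor> * (2 * pi) \<le> x $ i"
      "x $ i \<le> (of_int \<lfloor>x $ i / (2 * pi)\<rfloor> + 1) * (2 * pi)"
      by (subst pos_le_divide_eq[symmetric] pos_divide_le_eq[symmetric]; simp; linarith)+
    then show "0 \<le> x $ i + 2 * pi * of_int (- \<lfloor>x $ i / (2 * pi)\<rfloor>)"
      "x $ i + 2 * pi * of_int (- \<lfloor>x $ i / (2 * pi)\<rfloor>) \<le> 2 * pi"
      by (simp_all add: algebra_simps)
  qed
  then show "x + lattice_vec ?k \<in> torus_cell"
    by (simp add: torus_cell_def mem_box_cart lattice_vec_def)
qed

lemma torus_periodic_ex_cell:
  assumes "torus_periodic g"
  obtains y where "y \<in> torus_cell" "g y = g x"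
  using ex_lattice_cell torus_periodic_lattice[OF assms] by metis

lemma compact_torus_cell: "compact torus_cell"
  by (simp add: torus_cell_def)

lemma torus_cell_nonempty: "0 \<in> torus_cell"
  by (simp add: torus_cell_def mem_box_cart)

text \<open>An upper bound for the diameter of the fundamental cell, through the l1 norm.\<close>

definition torus_diam :: "'n itself \<Rightarrow> real" where
  "torus_diam _ = 2 * pi * CARD('n)"

lemma torus_diam_pos: "torus_diam TYPE('n::finite) > 0"
  by (simp add: torus_diam_def)

lemma norm_torus_cell:
  fixes x :: "real ^ 'n"
  assumes "x \<in> torus_cell"
  shows "norm x \<le> torus_diam TYPE('n)"
proof -
  have "norm x \<le> (\<Sum>i\<in>UNIV. \<bar>x $ i\<bar>)" by (rule norm_le_l1_cart)
  also have "\<dots> \<le> (\<Sum>i\<in>(UNIV :: 'n set). 2 * pi)"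
    using assms by (intro sum_mono) (auto simp: torus_cell_def mem_box_cart)
  finally show ?thesis by (simp add: torus_diam_def mult.commute)
qed

lemma torus_periodic_bounded:
  fixes g :: "real ^ 'n \<Rightarrow> 'b::real_normed_vector"
  assumes "torus_periodic g" "continuous_on UNIV g"
  obtains B where "B \<ge> 0" "\<And>x. norm (g x) \<le> B"
proof -
  have "compact (g ` torus_cell)"
    by (rule compact_continuous_image[OF continuous_on_subset[OF assms(2)] compact_torus_cell]) auto
  then obtain B where "B > 0" "\<And>y. y \<in> g ` torus_cell \<Longrightarrow> norm y \<le> B"
    by (meson bounded_pos compact_imp_bounded)
  then show thesis using that[of B] torus_periodic_ex_cell[OF assms(1)]
    by (metis image_eqI less_eq_real_def)
qed

lemma torus_periodic_attains_max:
  fixes g :: "real ^ 'n \<Rightarrow> real"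
  assumes "torus_periodic g" "continuous_on UNIV g"
  obtains x0 where "\<And>x. g x \<le> g x0"
proof -
  have "\<exists>x0\<in>torus_cell. \<forall>x\<in>torus_cell. g x \<le> g x0"
    by (rule continuous_attains_sup[OF compact_torus_cell _ continuous_on_subset[OF assms(2)]])
      (use torus_cell_nonempty in auto)
  then show thesis using that torus_periodic_ex_cell[OF assms(1)] by metis
qed

lemma torus_periodic_partial_deriv:
  assumes "torus_periodic g" shows "torus_periodic (partial_deriv i g)"
proof -
  have "(\<lambda>x. g (x + axis j (2 * pi))) = g" for j using assms by (auto simp: torus_periodic_def)
  then show ?thesis unfolding torus_periodic_def by (metis partial_deriv_shift)
qed

lemma torus_periodic_grad: "torus_periodic g \<Longrightarrow> torus_periodic (grad g)"
  using torus_periodic_partial_deriv[of g] by (simp add: torus_periodic_def grad_def)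

lemma torus_periodic_laplace: "torus_periodic g \<Longrightarrow> torus_periodic (laplace g)"
  using torus_periodic_partial_deriv[OF torus_periodic_partial_deriv, of g]
  by (simp add: torus_periodic_def laplace_def)

text \<open>By periodicity two arguments can be brought within one cell of each other.\<close>

lemma torus_periodic_Lipschitz_osc:
  fixes g :: "real ^ 'n \<Rightarrow> real"
  assumes "torus_periodic g" "\<And>x y. \<bar>g x - g y\<bar> \<le> M * norm (x - y)" "M \<ge> 0"
  shows "\<bar>g x - g y\<bar> \<le> M * torus_diam TYPE('n)"
proof -
  obtain k where k: "(x - y) + lattice_vec k \<in> torus_cell" by (rule ex_lattice_cell)
  have "\<bar>g x - g y\<bar> = \<bar>g (x + lattice_vec k) - g y\<bar>"
    by (simp add: torus_periodic_lattice[OF assms(1)])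
  also have "\<dots> \<le> M * norm ((x - y) + lattice_vec k)"
    using assms(2)[of "x + lattice_vec k" y] by (simp add: algebra_simps)
  also have "\<dots> \<le> M * torus_diam TYPE('n)"
    using norm_torus_cell[OF k] assms(3) by (rule mult_left_mono)
  finally show ?thesis .
qed

lemma grad_bound_imp_Lipschitz:
  fixes g :: "real ^ 'n \<Rightarrow> real"
  assumes "Ck_on (Suc k) UNIV g" "\<And>x. norm (grad g x) \<le> B"
  shows "\<bar>g x - g y\<bar> \<le> B * norm (x - y)"
proof -
  have "norm (g x - g y) \<le> B * norm (x - y)"
  proof (rule differentiable_bound[OF convex_UNIV])
    show "(g has_derivative (\<lambda>h. grad g z \<bullet> h)) (at z within UNIV)" for z
      using Ck_has_grad[OF assms(1)] .
    show "onorm (\<lambda>h. grad g z \<bullet> h) \<le> B" for z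
    proof (rule onorm_le)
      show "norm (grad g z \<bullet> h) \<le> B * norm h" for h
        using Cauchy_Schwarz_ineq2[of "grad g z" h] mult_right_mono[OF assms(2)[of z], of "norm h"]
        by simp
    qed
  qed auto
  then show ?thesis by simp
qed

lemma C1_periodic_Lipschitz:
  fixes g :: "real ^ 'n \<Rightarrow> real"
  assumes "Ck_on (Suc k) UNIV g" "torus_periodic g"
  obtains B where "B \<ge> 0" "\<And>x y. \<bar>g x - g y\<bar> \<le> B * norm (x - y)"
proof -
  obtain B where "B \<ge> 0" "\<And>x. norm (grad g x) \<le> B"
    using torus_periodic_bounded[OF torus_periodic_grad[OF assms(2)] continuous_on_grad[OF assms(1)]]
    by metis
  then show thesis using that grad_bound_imp_Lipschitz[OF assms(1)] by metis
qed

section \<open>A gradient estimate for the Poisson equation on the torus\<close>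

text \<open>If the second derivative were positive at the maximum, the first derivative, which is 0 there, would
  be positive just to the right, and the function would increase.\<close>

lemma second_deriv_at_max:
  fixes \<phi> :: "real \<Rightarrow> real"
  assumes d1: "\<And>s. (\<phi> has_field_derivative \<phi>' s) (at s)"
    and d2: "(\<phi>' has_field_derivative c) (at 0)"
    and mx: "\<And>s. \<phi> s \<le> \<phi> 0"
  shows "c \<le> 0"
proof (rule ccontr)
  assume "\<not> c \<le> 0"
  then obtain d where d: "d > 0" "\<And>h. 0 < h \<Longrightarrow> h < d \<Longrightarrow> \<phi>' 0 < \<phi>' (0 + h)"
    using DERIV_pos_inc_right[OF d2] by auto
  have "\<phi>' 0 = 0"
    by (rule DERIV_local_max[OF d1[of 0], of 1]) (use mx in auto)
  with d have pos: "\<phi>' h > 0" if "0 < h" "h < d" for h using that by fastforce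
  obtain z where "0 < z" "z < d/2" "\<phi> (d/2) - \<phi> 0 = (d/2 - 0) * \<phi>' z"
    using MVT2[of 0 "d/2" \<phi> \<phi>'] d d1 by auto
  then show False using pos[of z] mx[of "d/2"] d
    by (smt (verit, ccfv_SIG) half_gt_zero mult_pos_pos field_sum_of_halves)
qed

lemma laplace_nonpos_at_max:
  fixes g :: "real ^ 'n \<Rightarrow> real"
  assumes "Ck_on 2 UNIV g" "\<And>x. g x \<le> g x0"
  shows "laplace g x0 \<le> 0"
  unfolding laplace_def
proof (rule sum_nonpos)
  fix i
  have g2: "Ck_on (Suc (Suc 0)) UNIV g" using assms(1) by (simp add: numeral_2_eq_2)
  show "partial_deriv i (partial_deriv i g) x0 \<le> 0"
    by (rule second_deriv_at_max[of "\<lambda>s. g (x0 + axis i s)" "\<lambda>s. partial_deriv i g (x0 + axis i s)"])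
      (use Ck_has_partial_deriv[OF g2] Ck_has_partial_deriv[OF Ck_partial_deriv[OF g2], where x = x0 and s = 0 and i = i]
        assms(2) in auto)
qed

lemma laplace_nonneg_at_min:
  fixes g :: "real ^ 'n \<Rightarrow> real"
  assumes "Ck_on 2 UNIV g" "\<And>x. g x0 \<le> g x"
  shows "laplace g x0 \<ge> 0"
  unfolding laplace_def
proof (rule sum_nonneg)
  fix i
  have g2: "Ck_on (Suc (Suc 0)) UNIV g" using assms(1) by (simp add: numeral_2_eq_2)
  have "- partial_deriv i (partial_deriv i g) x0 \<le> 0"
    by (rule second_deriv_at_max[of "\<lambda>s. - g (x0 + axis i s)" "\<lambda>s. - partial_deriv i g (x0 + axis i s)"])
      (use Ck_has_partial_deriv[OF g2] Ck_has_partial_deriv[OF Ck_partial_deriv[OF g2], where x = x0 and s = 0 and i = i]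
        assms(2) in \<open>auto intro!: derivative_intros\<close>)
  then show "partial_deriv i (partial_deriv i g) x0 \<ge> 0" by simp
qed

text \<open>The Laplacian is nonpositive at a maximum and nonnegative at a minimum, so it takes values of both
  signs and is controlled by its oscillation.\<close>

lemma torus_laplace_bound:
  fixes V :: "real ^ 'n \<Rightarrow> real"
  assumes C2: "Ck_on 2 UNIV V" and per: "torus_periodic V"
    and M: "\<And>x y. \<bar>laplace V x - laplace V y\<bar> \<le> M * norm (x - y)" "M \<ge> 0"
  shows "\<bar>laplace V x\<bar> \<le> M * torus_diam TYPE('n)"
proof -
  have cont: "continuous_on UNIV V" using C2 by (rule Ck_on_imp_continuous_on)
  obtain a where "\<And>x. V x \<le> V a" using torus_periodic_attains_max[OF per cont] by blast
  then have a: "laplace V a \<le> 0" by (rule laplace_nonpos_at_max[OF C2])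
  have "torus_periodic (\<lambda>x. - V x)" "continuous_on UNIV (\<lambda>x. - V x)"
    using per cont by (auto simp: torus_periodic_def intro: continuous_intros)
  then obtain b where "\<And>x. - V x \<le> - V b" using torus_periodic_attains_max by blast
  then have b: "laplace V b \<ge> 0" by (intro laplace_nonneg_at_min[OF C2]) auto
  show ?thesis
    using torus_periodic_Lipschitz_osc[OF torus_periodic_laplace[OF per] M, of x a]
      torus_periodic_Lipschitz_osc[OF torus_periodic_laplace[OF per] M, of x b] a b by linarith
qed

text \<open>Bernstein's method with difference quotients \<open>D i\<close> in place of partial derivatives, because third
  derivatives of \<open>V\<close> need not exist. The Laplacian of the auxiliary function
  \<open>\<Sum> (D i)\<^sup>2 + \<alpha> (V - c)\<^sup>2\<close> is nonpositive at its maximum \<open>x0\<close>. It contains the nonnegative squares of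
  the gradients of the \<open>D i\<close>, which are dropped, and the good term \<open>2 \<alpha> |grad V|\<^sup>2\<close>.\<close>

lemma torus_Bernstein_inequality:
  fixes V :: "real ^ 'n \<Rightarrow> real" and x0 :: "real ^ 'n"
  assumes C2: "Ck_on 2 UNIV V"
    and h: "h > 0" and \<alpha>: "\<alpha> \<ge> 0"
    and D: "\<And>i x. D i x = (V (x + axis i h) - V x) / h"
    and mx: "\<And>x. (\<Sum>i\<in>UNIV. (D i x)\<^sup>2) + \<alpha> * (V x - c)\<^sup>2 \<le> (\<Sum>i\<in>UNIV. (D i x0)\<^sup>2) + \<alpha> * (V x0 - c)\<^sup>2"
  shows "\<alpha> * (norm (grad V x0))\<^sup>2 \<le>
    - (\<Sum>i\<in>UNIV. D i x0 * ((laplace V (x0 + axis i h) - laplace V x0) / h))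
    - \<alpha> * (V x0 - c) * laplace V x0"
proof -
  have C2': "Ck_on (Suc (Suc 0)) UNIV V" using C2 by (simp add: numeral_2_eq_2)
  define V1 where "V1 j x = partial_deriv j V x" for j x
  define V2 where "V2 j x = partial_deriv j (partial_deriv j V) x" for j x
  have dV: "((\<lambda>s. V (x + axis j s)) has_field_derivative V1 j (x + axis j s)) (at s)" for x j s
    unfolding V1_def by (rule Ck_has_partial_deriv[OF C2'])
  have dV1: "((\<lambda>s. V1 j (x + axis j s)) has_field_derivative V2 j (x + axis j s)) (at s)" for x j s
    unfolding V1_def V2_def by (rule Ck_has_partial_deriv[OF Ck_partial_deriv[OF C2']])
  define D1 where "D1 j i x = (V1 j (x + axis i h) - V1 j x) / h" for j i x
  define D2 where "D2 j i x = (V2 j (x + axis i h) - V2 j x) / h" for j i x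
  have sw: "x + axis j s + axis i h = (x + axis i h) + axis j s" for x :: "real ^ 'n" and i j s
    by (simp add: algebra_simps)
  have dD: "((\<lambda>s. D i (x + axis j s)) has_field_derivative D1 j i (x + axis j s)) (at s)" for x i j s
    unfolding D D1_def sw using h by (auto intro!: derivative_eq_intros dV)
  have dD1: "((\<lambda>s. D1 j i (x + axis j s)) has_field_derivative D2 j i (x + axis j s)) (at s)" for x i j s
    unfolding D1_def D2_def sw using h by (auto intro!: derivative_eq_intros dV1)
  have ineq: "(\<Sum>i\<in>UNIV. 2 * ((D1 j i x0)\<^sup>2 + D i x0 * D2 j i x0)) +
      2 * \<alpha> * ((V1 j x0)\<^sup>2 + (V x0 - c) * V2 j x0) \<le> 0" for j
  proof (rule second_deriv_at_max)
    show "((\<lambda>s. (\<Sum>i\<in>UNIV. (D i (x0 + axis j s))\<^sup>2) + \<alpha> * (V (x0 + axis j s) - c)\<^sup>2)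
      has_field_derivative (\<Sum>i\<in>UNIV. 2 * D i (x0 + axis j s) * D1 j i (x0 + axis j s)) +
        2 * \<alpha> * (V (x0 + axis j s) - c) * V1 j (x0 + axis j s)) (at s)" for s
      by (auto intro!: derivative_eq_intros dD dV sum.cong)
    show "((\<lambda>s. (\<Sum>i\<in>UNIV. 2 * D i (x0 + axis j s) * D1 j i (x0 + axis j s)) +
        2 * \<alpha> * (V (x0 + axis j s) - c) * V1 j (x0 + axis j s)) has_field_derivative
      (\<Sum>i\<in>UNIV. 2 * ((D1 j i x0)\<^sup>2 + D i x0 * D2 j i x0)) +
      2 * \<alpha> * ((V1 j x0)\<^sup>2 + (V x0 - c) * V2 j x0)) (at 0)"
      by (rule derivative_eq_intros dD dD1 dV dV1 refl)+ 
        (auto simp: power2_eq_square algebra_simps intro!: sum.cong)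
  qed (use mx in auto)
  have "(\<Sum>j\<in>UNIV. (\<Sum>i\<in>UNIV. 2 * (D i x0 * D2 j i x0)) +
      2 * \<alpha> * ((V1 j x0)\<^sup>2 + (V x0 - c) * V2 j x0)) \<le> 0"
  proof (rule sum_nonpos)
    fix j
    have "(\<Sum>i\<in>UNIV. 2 * (D i x0 * D2 j i x0)) \<le> (\<Sum>i\<in>UNIV. 2 * ((D1 j i x0)\<^sup>2 + D i x0 * D2 j i x0))"
      by (intro sum_mono) auto
    with ineq[of j] show "(\<Sum>i\<in>UNIV. 2 * (D i x0 * D2 j i x0)) +
      2 * \<alpha> * ((V1 j x0)\<^sup>2 + (V x0 - c) * V2 j x0) \<le> 0" by linarith
  qed
  also have "(\<Sum>j\<in>UNIV. (\<Sum>i\<in>UNIV. 2 * (D i x0 * D2 j i x0)) +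
      2 * \<alpha> * ((V1 j x0)\<^sup>2 + (V x0 - c) * V2 j x0)) =
    2 * (\<Sum>i\<in>UNIV. D i x0 * (\<Sum>j\<in>UNIV. D2 j i x0)) +
    2 * \<alpha> * ((\<Sum>j\<in>UNIV. (V1 j x0)\<^sup>2) + (V x0 - c) * (\<Sum>j\<in>UNIV. V2 j x0))"
  proof -
    have "(\<Sum>j\<in>UNIV. \<Sum>i\<in>UNIV. 2 * (D i x0 * D2 j i x0)) = (\<Sum>i\<in>UNIV. \<Sum>j\<in>UNIV. 2 * (D i x0 * D2 j i x0))"
      by (rule sum.swap)
    then show ?thesis by (simp add: sum.distrib sum_distrib_left distrib_left)
  qed
  also have "(\<Sum>j\<in>UNIV. V2 j x0) = laplace V x0" by (simp add: V2_def laplace_def)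
  also have "(\<lambda>i. \<Sum>j\<in>UNIV. D2 j i x0) = (\<lambda>i. (laplace V (x0 + axis i h) - laplace V x0) / h)"
    by (simp add: D2_def V2_def laplace_def sum_subtractf sum_divide_distrib[symmetric] fun_eq_iff)
  also have "(\<Sum>j\<in>UNIV. (V1 j x0)\<^sup>2) = (norm (grad V x0))\<^sup>2"
    by (simp add: V1_def grad_def norm_vec_def L2_set_def sum_nonneg)
  finally show ?thesis by (simp add: algebra_simps)
qed

text \<open>Let \<open>G\<close> be the maximum of \<open>|grad V|\<close>, so that \<open>V\<close> oscillates by at most \<open>G L\<close>. The Bernstein inequality
  bounds \<open>|grad V|\<^sup>2\<close> at the maximum point of the auxiliary function by a multiple of \<open>G M\<close>; comparing with
  the point where \<open>G\<close> is attained costs \<open>\<alpha> G\<^sup>2 L\<^sup>2 = G\<^sup>2 / 2\<close>, by the choice of \<open>\<alpha>\<close>. So \<open>G\<^sup>2 / 2\<close> is at most a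
  multiple of \<open>G M\<close>, up to an error proportional to the step \<open>h\<close> of the difference quotients, and
  \<open>h\<close> is arbitrary.\<close>

lemma torus_grad_bound:
  fixes V :: "real ^ 'n \<Rightarrow> real"
  assumes C2: "Ck_on 2 UNIV V" and per: "torus_periodic V"
    and M: "\<And>x y. \<bar>laplace V x - laplace V y\<bar> \<le> M * norm (x - y)" "M \<ge> 0"
  shows "norm (grad V x) \<le> 2 * (torus_diam TYPE('n))\<^sup>2 * (2 * CARD('n) + 1) * M"
proof -
  define L where "L = torus_diam TYPE('n)"
  define d where "d = real CARD('n)"
  \<comment> \<open>The zero-order term of the auxiliary function is then at most half of \<open>G\<^sup>2\<close>.\<close>
  define \<alpha> where "\<alpha> = 1 / (2 * L\<^sup>2)"
  have L: "L > 0" by (simp add: L_def torus_diam_pos)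
  have \<alpha>: "\<alpha> > 0" "\<alpha> * L\<^sup>2 = 1 / 2" using L by (simp_all add: \<alpha>_def)
  have C2': "Ck_on (Suc (Suc 0)) UNIV V" using C2 by (simp add: numeral_2_eq_2)
  have "torus_periodic (\<lambda>x. norm (grad V x))" "continuous_on UNIV (\<lambda>x. norm (grad V x))"
    using torus_periodic_grad[OF per] continuous_on_grad[OF C2']
    by (auto simp: torus_periodic_def intro: continuous_intros)
  then obtain xm where xm: "\<And>x. norm (grad V x) \<le> norm (grad V xm)"
    using torus_periodic_attains_max by blast
  define G where "G = norm (grad V xm)"
  have G0: "G \<ge> 0" by (simp add: G_def)
  have VG: "\<bar>V x - V y\<bar> \<le> G * norm (x - y)" for x y
    using grad_bound_imp_Lipschitz[OF C2'] xm G_def by metis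
  have osc: "\<bar>V x - V y\<bar> \<le> G * L" for x y
    unfolding L_def by (rule torus_periodic_Lipschitz_osc[OF per VG G0])
  have lap: "\<bar>laplace V x\<bar> \<le> M * L" for x
    unfolding L_def by (rule torus_laplace_bound[OF C2 per M])
  have pG: "\<bar>partial_deriv i V x\<bar> \<le> G" for i x
    using component_le_norm_cart[of "grad V x" i] xm[of x] by (simp add: grad_def G_def)
  have "\<exists>B\<ge>0. \<forall>x y. \<bar>partial_deriv i V x - partial_deriv i V y\<bar> \<le> B * norm (x - y)" for i
    using C1_periodic_Lipschitz[OF Ck_partial_deriv[OF C2'] torus_periodic_partial_deriv[OF per]]
    by metis
  then obtain Bi where Bi: "\<And>i. Bi i \<ge> 0"
    "\<And>i x y. \<bar>partial_deriv i V x - partial_deriv i V y\<bar> \<le> Bi i * norm (x - y)" by metis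
  define B where "B = (\<Sum>i\<in>UNIV. Bi i)"
  have B0: "B \<ge> 0" by (simp add: B_def Bi sum_nonneg)
  have B: "\<bar>partial_deriv i V x - partial_deriv i V y\<bar> \<le> B * norm (x - y)" for i x y
  proof -
    have "Bi i \<le> B" unfolding B_def by (rule member_le_sum) (auto simp: Bi)
    then show ?thesis using Bi(2)[of i x y] by (meson mult_right_mono norm_ge_zero order_trans)
  qed
  have key: "G\<^sup>2 / 2 \<le> G * M * L\<^sup>2 * (2 * d + 1) + 4 * d * G * B * h" if h: "h > 0" for h
  proof -
    define D where "D i x = (V (x + axis i h) - V x) / h" for i x
    have DG: "\<bar>D i x\<bar> \<le> G" for i x
      using VG[of "x + axis i h" x] h by (simp add: D_def norm_axis field_simps)
    have Ddiff: "\<bar>D i x - partial_deriv i V x\<bar> \<le> B * h" for i x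
    proof -
      obtain z where z: "0 < z" "z < h" "V (x + axis i h) - V (x + axis i 0) = (h - 0) * partial_deriv i V (x + axis i z)"
        using MVT2[OF h, of "\<lambda>s. V (x + axis i s)" "\<lambda>s. partial_deriv i V (x + axis i s)"]
          Ck_has_partial_deriv[OF C2'] by blast
      then have "D i x = partial_deriv i V (x + axis i z)" using h by (simp add: D_def)
      then have "\<bar>D i x - partial_deriv i V x\<bar> \<le> B * z"
        using B[of i "x + axis i z" x] z by (simp add: norm_axis)
      then show ?thesis using z B0 by (meson less_imp_le mult_left_mono order_trans)
    qed
    have sq: "\<bar>(D i x)\<^sup>2 - (partial_deriv i V x)\<^sup>2\<bar> \<le> 2 * G * B * h" for i x
    proof -
      have "\<bar>(D i x)\<^sup>2 - (partial_deriv i V x)\<^sup>2\<bar> = \<bar>D i x - partial_deriv i V x\<bar> * \<bar>D i x + partial_deriv i V x\<bar>"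
        by (simp add: abs_mult[symmetric] power2_eq_square algebra_simps)
      also have "\<dots> \<le> (B * h) * (2 * G)"
        using Ddiff[of i x] DG[of i x] pG[of i x] B0 h by (intro mult_mono) auto
      finally show ?thesis by (simp add: algebra_simps)
    qed
    have sumsq: "\<bar>(\<Sum>i\<in>UNIV. (D i x)\<^sup>2) - (norm (grad V x))\<^sup>2\<bar> \<le> 2 * d * G * B * h" for x
    proof -
      have "(norm (grad V x))\<^sup>2 = (\<Sum>i\<in>UNIV. (partial_deriv i V x)\<^sup>2)"
        by (simp add: grad_def norm_vec_def L2_set_def sum_nonneg)
      then have "\<bar>(\<Sum>i\<in>UNIV. (D i x)\<^sup>2) - (norm (grad V x))\<^sup>2\<bar> =
          \<bar>\<Sum>i\<in>UNIV. (D i x)\<^sup>2 - (partial_deriv i V x)\<^sup>2\<bar>" by (simp add: sum_subtractf)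
      also have "\<dots> \<le> (\<Sum>i\<in>(UNIV::'n set). 2 * G * B * h)"
        by (rule order_trans[OF sum_abs sum_mono]) (rule sq)
      finally show ?thesis by (simp add: d_def algebra_simps)
    qed
    define P where "P x = (\<Sum>i\<in>UNIV. (D i x)\<^sup>2) + \<alpha> * (V x - V 0)\<^sup>2" for x
    have cV: "continuous_on UNIV V" using C2 by (rule Ck_on_imp_continuous_on)
    have "continuous_on UNIV P"
      unfolding P_def D_def using h
      by (intro continuous_intros continuous_on_compose2[OF cV]) auto
    moreover have "torus_periodic P"
    proof -
      have "V (x + axis j (2 * pi) + axis i h) = V (x + axis i h)" for x i j
        using torus_periodicD[OF per, of "x + axis i h" j] by (simp add: algebra_simps)
      then show ?thesis using per by (simp add: torus_periodic_def P_def D_def)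
    qed
    ultimately obtain x0 where x0: "\<And>x. P x \<le> P x0" using torus_periodic_attains_max by blast
    have "\<alpha> * (norm (grad V x0))\<^sup>2 \<le>
        - (\<Sum>i\<in>UNIV. D i x0 * ((laplace V (x0 + axis i h) - laplace V x0) / h))
        - \<alpha> * (V x0 - V 0) * laplace V x0"
      by (rule torus_Bernstein_inequality[OF C2 h]) (use \<alpha> x0 in \<open>auto simp: D_def P_def\<close>)
    also have "\<dots> \<le> d * (G * M) + \<alpha> * (G * L * (M * L))"
    proof -
      have "- (D i x0 * ((laplace V (x0 + axis i h) - laplace V x0) / h)) \<le> G * M" for i
      proof -
        have "\<bar>(laplace V (x0 + axis i h) - laplace V x0) / h\<bar> \<le> M"
          using M(1)[of "x0 + axis i h" x0] h by (simp add: norm_axis field_simps)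
        then have "\<bar>D i x0\<bar> * \<bar>(laplace V (x0 + axis i h) - laplace V x0) / h\<bar> \<le> G * M"
          by (intro mult_mono DG G0) auto
        then show ?thesis unfolding abs_mult[symmetric] by linarith
      qed
      then have "(\<Sum>i\<in>UNIV. - (D i x0 * ((laplace V (x0 + axis i h) - laplace V x0) / h)))
          \<le> (\<Sum>i\<in>(UNIV::'n set). G * M)" by (intro sum_mono)
      moreover have "- (\<alpha> * (V x0 - V 0) * laplace V x0) \<le> \<alpha> * (G * L * (M * L))"
      proof -
        have "\<bar>V x0 - V 0\<bar> * \<bar>laplace V x0\<bar> \<le> G * L * (M * L)"
          using G0 L by (intro mult_mono osc lap) auto
        then have "- ((V x0 - V 0) * laplace V x0) \<le> G * L * (M * L)"
          unfolding abs_mult[symmetric] by linarith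
        then have "\<alpha> * - ((V x0 - V 0) * laplace V x0) \<le> \<alpha> * (G * L * (M * L))"
          using \<alpha> by (intro mult_left_mono) auto
        then show ?thesis by (simp add: algebra_simps)
      qed
      ultimately show ?thesis by (simp add: d_def sum_negf)
    qed
    finally have "(2 * L\<^sup>2) * (\<alpha> * (norm (grad V x0))\<^sup>2) \<le> (2 * L\<^sup>2) * (d * (G * M) + \<alpha> * (G * L * (M * L)))"
      using L by (intro mult_left_mono) auto
    moreover have "(2 * L\<^sup>2) * (\<alpha> * X) = X" for X
      using L by (simp add: \<alpha>_def)
    ultimately have "(norm (grad V x0))\<^sup>2 \<le> 2 * L\<^sup>2 * (d * (G * M)) + G * L * (M * L)"
      by (simp only: distrib_left)
    then have gx0: "(norm (grad V x0))\<^sup>2 \<le> G * M * L\<^sup>2 * (2 * d + 1)"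
      by (simp add: algebra_simps power2_eq_square)
    have "(V x0 - V 0)\<^sup>2 \<le> (G * L)\<^sup>2"
      using osc[of x0 0] by (metis abs_le_square_iff abs_of_nonneg G0 L less_imp_le mult_nonneg_nonneg)
    then have "\<alpha> * (V x0 - V 0)\<^sup>2 \<le> \<alpha> * (G * L)\<^sup>2" using \<alpha> by (intro mult_left_mono) auto
    also have "\<dots> = G\<^sup>2 / 2" using \<alpha>(2) by (simp add: power_mult_distrib mult.left_commute)
    finally have v: "\<alpha> * (V x0 - V 0)\<^sup>2 \<le> G\<^sup>2 / 2" .
    have "G\<^sup>2 \<le> (\<Sum>i\<in>UNIV. (D i xm)\<^sup>2) + 2 * d * G * B * h"
      using sumsq[of xm] by (simp add: G_def)
    also have "(\<Sum>i\<in>UNIV. (D i xm)\<^sup>2) \<le> P xm" using \<alpha> by (simp add: P_def)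
    also have "P xm \<le> P x0" by (rule x0)
    also have "P x0 \<le> (norm (grad V x0))\<^sup>2 + 2 * d * G * B * h + G\<^sup>2 / 2"
      using sumsq[of x0] v by (simp add: P_def)
    finally show ?thesis using gx0 by (simp add: algebra_simps)
  qed
  have "G\<^sup>2 / 2 \<le> G * M * L\<^sup>2 * (2 * d + 1) + e" if e: "e > 0" for e
  proof -
    define h where "h = e / (4 * d * G * B + 1)"
    have nn: "4 * d * G * B \<ge> 0" using G0 B0 by (simp add: d_def)
    then have h: "h > 0" using e by (simp add: h_def add_nonneg_pos)
    have "4 * d * G * B * h \<le> (4 * d * G * B + 1) * h" using h by (simp add: algebra_simps)
    also have "\<dots> = e"
    proof -
      have "4 * d * G * B + 1 \<noteq> 0" using nn by linarith
      then show ?thesis unfolding h_def by (rule nonzero_mult_div_cancel_left[of _ e, unfolded times_divide_eq_right[symmetric]])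
    qed
    finally show ?thesis using key[OF h] by linarith
  qed
  then have "G\<^sup>2 / 2 \<le> G * M * L\<^sup>2 * (2 * d + 1)" by (rule field_le_epsilon)
  then have "G * G \<le> G * (2 * L\<^sup>2 * (2 * d + 1) * M)" by (simp add: power2_eq_square algebra_simps)
  then have "G \<le> 2 * L\<^sup>2 * (2 * d + 1) * M"
    using G0 M(2) L by (cases "G = 0") (auto simp: d_def)
  then show ?thesis using xm[of x] by (simp add: G_def L_def d_def algebra_simps)
qed

section \<open>Measure on the torus phase space\<close>

text \<open>Unlike the closed cell, this one contains exactly one representative of every point of the torus.\<close>

definition half_open_cell :: "(real ^ 'n) set" where
  "half_open_cell = {x. \<forall>i. 0 \<le> x $ i \<and> x $ i < 2 * pi}"

lemma ex1_lattice_half_open_cell: "\<exists>!k. x + lattice_vec k \<in> half_open_cell"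
proof -
  have "x + lattice_vec k \<in> half_open_cell \<longleftrightarrow> k = (\<chi> i. - \<lfloor>x $ i / (2 * pi)\<rfloor>)" for k
  proof -
    have "0 \<le> x $ i + 2 * pi * of_int (k $ i) \<and> x $ i + 2 * pi * of_int (k $ i) < 2 * pi
      \<longleftrightarrow> k $ i = - \<lfloor>x $ i / (2 * pi)\<rfloor>" for i
    proof -
      have "0 \<le> x $ i + 2 * pi * of_int (k $ i) \<longleftrightarrow> of_int (- (k $ i)) \<le> x $ i / (2 * pi)"
        by (subst pos_le_divide_eq) (auto simp: algebra_simps)
      moreover have "x $ i + 2 * pi * of_int (k $ i) < 2 * pi \<longleftrightarrow> x $ i / (2 * pi) < of_int (- (k $ i)) + 1"
        by (subst pos_divide_less_eq) (auto simp: algebra_simps)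
      ultimately show ?thesis using floor_eq_iff[of "x $ i / (2 * pi)" "- (k $ i)"] by auto
    qed
    then show ?thesis by (simp add: half_open_cell_def lattice_vec_def vec_eq_iff)
  qed
  then show ?thesis by auto
qed

lemma lattice_vec_minus: "lattice_vec (- k) = - lattice_vec k"
  by (simp add: lattice_vec_def vec_eq_iff)

lemma ex1_lattice_half_open_cell': "\<exists>!k. x - lattice_vec k \<in> half_open_cell"
proof -
  obtain k where k: "x + lattice_vec k \<in> half_open_cell"
    "\<And>k'. x + lattice_vec k' \<in> half_open_cell \<Longrightarrow> k' = k"
    using ex1_lattice_half_open_cell[of x] by auto
  show ?thesis
  proof (rule ex1I[of _ "- k"])
    show "x - lattice_vec (- k) \<in> half_open_cell" using k(1) by (simp add: lattice_vec_minus)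
    show "k' = - k" if "x - lattice_vec k' \<in> half_open_cell" for k'
    proof -
      have "- k' = k" using k(2)[of "- k'"] that by (simp add: lattice_vec_minus)
      then show ?thesis by (metis minus_minus)
    qed
  qed
qed

lemma half_open_cell_borel [measurable]: "half_open_cell \<in> sets borel"
proof -
  have "half_open_cell = {x \<in> space borel. \<forall>i\<in>UNIV. 0 \<le> x $ i \<and> x $ i < 2 * pi}"
    by (simp add: half_open_cell_def)
  also have "\<dots> \<in> sets borel" by measurable
  finally show ?thesis .
qed

lemma nn_integral_count_space_ex1:
  assumes "\<exists>!k. P k"
  shows "(\<integral>\<^sup>+ k. (if P k then 1 else 0) \<partial>count_space UNIV) = 1"
proof -
  obtain k where k: "\<And>k'. P k' \<longleftrightarrow> k' = k" using assms by auto
  have "(\<integral>\<^sup>+ k. (if P k then 1 else 0) \<partial>count_space UNIV) = (\<integral>\<^sup>+ k'. indicator {k} k' \<partial>count_space UNIV)"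
    by (rule nn_integral_cong) (simp add: k indicator_def)
  then show ?thesis by simp
qed

lemma nn_integral_lborel_translation:
  fixes f :: "'a::euclidean_space \<Rightarrow> ennreal"
  assumes [measurable]: "f \<in> borel_measurable borel"
  shows "(\<integral>\<^sup>+ x. f (c + x) \<partial>lborel) = (\<integral>\<^sup>+ x. f x \<partial>lborel)"
proof -
  have "(\<integral>\<^sup>+ x. f x \<partial>lborel) = (\<integral>\<^sup>+ x. f x \<partial>distr lborel borel ((+) c))"
    by (simp add: lborel_distr_plus)
  also have "\<dots> = (\<integral>\<^sup>+ x. f (c + x) \<partial>lborel)" by (rule nn_integral_distr) auto
  finally show ?thesis by simp
qed

definition torus_measure :: "(real ^ 'n) measure" where
  "torus_measure = density lborel (indicator torus_cell)"

lemma torus_cell_borel [measurable]: "torus_cell \<in> sets borel"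
  by (simp add: torus_cell_def)

lemma sets_torus_measure [measurable_cong, simp]: "sets torus_measure = sets borel"
  by (simp add: torus_measure_def)

lemma space_torus_measure [simp]: "space torus_measure = UNIV"
  by (simp add: torus_measure_def)

lemma emeasure_torus_measure: "emeasure torus_measure UNIV \<noteq> \<infinity>"
  using emeasure_compact_finite[OF compact_torus_cell]
  by (simp add: torus_measure_def emeasure_density less_top)

interpretation torus_measure: finite_measure torus_measure
  by (rule finite_measureI) (simp only: space_torus_measure emeasure_torus_measure not_False_eq_True)

lemma AE_torus_measure: "AE x in torus_measure. x \<in> torus_cell"
  unfolding torus_measure_def by (subst AE_density) (auto simp: indicator_def)

lemma nn_integral_torus_measure:
  assumes [measurable]: "h \<in> borel_measurable borel"
  shows "(\<integral>\<^sup>+ x. h x \<partial>torus_measure) = (\<integral>\<^sup>+ x. h x * indicator half_open_cell x \<partial>lborel)"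
proof -
  have "negligible (cbox 0 (\<chi> i. 2 * pi) - box 0 (\<chi> i. 2 * pi) :: (real ^ 'n) set)"
    by (rule negligible_frontier_interval)
  then have "cbox 0 (\<chi> i. 2 * pi) - box 0 (\<chi> i. 2 * pi) \<in> null_sets (lborel :: (real ^ 'n) measure)"
    by (simp add: negligible_iff_null_sets null_sets_completion_iff)
  then have "AE x in lborel. (x :: real ^ 'n) \<notin> cbox 0 (\<chi> i. 2 * pi) - box 0 (\<chi> i. 2 * pi)"
    by (rule AE_not_in)
  then have "AE x in lborel. indicator torus_cell x * h x = h x * indicator half_open_cell x"
  proof (eventually_elim)
    case (elim x)
    then show ?case
      by (auto simp: indicator_def torus_cell_def half_open_cell_def mem_box_cart intro: less_imp_le)
  qed
  then show ?thesis
    unfolding torus_measure_def by (subst nn_integral_density) (auto intro: nn_integral_cong_AE)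
qed

text \<open>Insert the sum over lattice translates of the cell, which is 1, exchange sum and integral,
  translate each term back by its lattice vector, and use that the translates of the shifted cell also
  cover every point exactly once.\<close>

lemma nn_integral_torus_shift:
  fixes h :: "real ^ 'n \<Rightarrow> ennreal"
  assumes [measurable]: "h \<in> borel_measurable borel" and per: "torus_periodic h"
  shows "(\<integral>\<^sup>+ x. h (x + y) \<partial>torus_measure) = (\<integral>\<^sup>+ x. h x \<partial>torus_measure)"
proof -
  let ?Q = "half_open_cell :: (real ^ 'n) set"
  let ?C = "count_space (UNIV :: (int ^ 'n) set)"
  interpret C: sigma_finite_measure ?C
    by (rule sigma_finite_measure_count_space_countable) auto
  interpret P: pair_sigma_finite ?C "lborel :: (real ^ 'n) measure" by unfold_locales
  have ind: "indicator ?Q z = (if z \<in> ?Q then 1 else 0 :: ennreal)" for z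
    by (simp add: indicator_def)
  have "(\<integral>\<^sup>+ x. h (x + y) \<partial>torus_measure) = (\<integral>\<^sup>+ x. h (x + y) * indicator ?Q x \<partial>lborel)"
    by (rule nn_integral_torus_measure) measurable
  also have "\<dots> = (\<integral>\<^sup>+ x. h (y + x) * indicator ?Q ((y + x) - y) \<partial>lborel)"
    by (simp add: add.commute)
  also have "\<dots> = (\<integral>\<^sup>+ x. h x * indicator ?Q (x - y) \<partial>lborel)"
    by (rule nn_integral_lborel_translation) measurable
  also have "\<dots> = (\<integral>\<^sup>+ x. (\<integral>\<^sup>+ k. h x * indicator ?Q (x - y) * indicator ?Q (x - lattice_vec k) \<partial>?C) \<partial>lborel)"
    by (subst nn_integral_cmult) (auto simp: ind nn_integral_count_space_ex1[OF ex1_lattice_half_open_cell'])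
  also have "\<dots> = (\<integral>\<^sup>+ k. (\<integral>\<^sup>+ x. h x * indicator ?Q (x - y) * indicator ?Q (x - lattice_vec k) \<partial>lborel) \<partial>?C)"
    by (rule P.Fubini')
      (auto intro!: measurable_pair_measure_countable1 simp: split_beta')
  also have "\<dots> = (\<integral>\<^sup>+ k. (\<integral>\<^sup>+ x. h x * indicator ?Q x * indicator ?Q ((x - y) + lattice_vec k) \<partial>lborel) \<partial>?C)"
  proof (rule nn_integral_cong)
    fix k :: "int ^ 'n"
    have "(\<integral>\<^sup>+ x. h x * indicator ?Q (x - y) * indicator ?Q (x - lattice_vec k) \<partial>lborel) =
      (\<integral>\<^sup>+ x. h (lattice_vec k + x) * indicator ?Q (lattice_vec k + x - y) * indicator ?Q (lattice_vec k + x - lattice_vec k) \<partial>lborel)"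
      by (rule nn_integral_lborel_translation[symmetric]) measurable
    also have "\<dots> = (\<integral>\<^sup>+ x. h x * indicator ?Q x * indicator ?Q ((x - y) + lattice_vec k) \<partial>lborel)"
      using torus_periodic_lattice[OF per, of _ k] by (simp add: algebra_simps)
    finally show "(\<integral>\<^sup>+ x. h x * indicator ?Q (x - y) * indicator ?Q (x - lattice_vec k) \<partial>lborel) =
      (\<integral>\<^sup>+ x. h x * indicator ?Q x * indicator ?Q ((x - y) + lattice_vec k) \<partial>lborel)" .
  qed
  also have "\<dots> = (\<integral>\<^sup>+ x. (\<integral>\<^sup>+ k. h x * indicator ?Q x * indicator ?Q ((x - y) + lattice_vec k) \<partial>?C) \<partial>lborel)"
    by (rule P.Fubini'[symmetric])
      (auto intro!: measurable_pair_measure_countable1 simp: split_beta')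
  also have "\<dots> = (\<integral>\<^sup>+ x. h x * indicator ?Q x \<partial>lborel)"
    by (subst nn_integral_cmult) (auto simp: ind nn_integral_count_space_ex1[OF ex1_lattice_half_open_cell])
  also have "\<dots> = (\<integral>\<^sup>+ x. h x \<partial>torus_measure)"
    by (rule nn_integral_torus_measure[symmetric]) measurable
  finally show ?thesis .
qed

definition phase_measure :: "((real ^ 'n) \<times> (real ^ 'n)) measure" where
  "phase_measure = torus_measure \<Otimes>\<^sub>M lborel"

lemma sets_phase_measure [measurable_cong, simp]: "sets phase_measure = sets borel"
  unfolding phase_measure_def
  by (subst borel_prod[symmetric]) (intro sets_pair_measure_cong; simp)

lemma space_phase_measure [simp]: "space phase_measure = UNIV"
  by (simp add: phase_measure_def space_pair_measure)

interpretation phase: pair_sigma_finite torus_measure "lborel :: (real ^ 'n) measure"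
  by unfold_locales

lemma phase_measurable_iff: "borel_measurable phase_measure = borel_measurable borel"
  by (rule measurable_cong_sets) auto

lemma phase_measurable_pair:
  fixes f :: "(real ^ 'n) \<times> (real ^ 'n) \<Rightarrow> _"
  shows "f \<in> borel_measurable borel \<Longrightarrow> f \<in> borel_measurable (torus_measure \<Otimes>\<^sub>M lborel)"
  by (simp add: phase_measurable_iff flip: phase_measure_def)

lemma nn_integral_phase:
  assumes "H \<in> borel_measurable borel"
  shows "(\<integral>\<^sup>+ z. H z \<partial>phase_measure) = (\<integral>\<^sup>+ x. \<integral>\<^sup>+ v. H (x, v) \<partial>lborel \<partial>torus_measure)"
    and "(\<integral>\<^sup>+ z. H z \<partial>phase_measure) = (\<integral>\<^sup>+ v. \<integral>\<^sup>+ x. H (x, v) \<partial>torus_measure \<partial>lborel)"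
proof -
  note m = phase_measurable_pair[OF assms]
  show "(\<integral>\<^sup>+ z. H z \<partial>phase_measure) = (\<integral>\<^sup>+ x. \<integral>\<^sup>+ v. H (x, v) \<partial>lborel \<partial>torus_measure)"
    unfolding phase_measure_def by (rule lborel.nn_integral_fst[OF m, symmetric])
  then show "(\<integral>\<^sup>+ z. H z \<partial>phase_measure) = (\<integral>\<^sup>+ v. \<integral>\<^sup>+ x. H (x, v) \<partial>torus_measure \<partial>lborel)"
    using phase.Fubini[OF m] by simp
qed

lemma AE_phase_measure: "AE z in phase_measure. fst z \<in> torus_cell"
  unfolding phase_measure_def
proof (rule phase.AE_pair_measure)
  show "{z \<in> space (torus_measure \<Otimes>\<^sub>M lborel). fst z \<in> torus_cell} \<in> sets (torus_measure \<Otimes>\<^sub>M lborel)"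
    by measurable
  show "AE x in torus_measure. AE v in lborel. fst (x, v) \<in> torus_cell"
    by (rule eventually_mono[OF AE_torus_measure]) simp
qed

section \<open>A measure-preserving time discretisation\<close>

text \<open>One step of the symplectic Euler scheme: the position is advanced with the updated velocity. This
  order makes the step a composition of the two shears \<open>(x, v) \<mapsto> (x, v + \<delta> F x)\<close> and
  \<open>(x, v) \<mapsto> (x + \<delta> v, v)\<close>.\<close>

definition kick_drift :: "real \<Rightarrow> (real ^ 'n \<Rightarrow> real ^ 'n) \<Rightarrow> (real ^ 'n) \<times> (real ^ 'n) \<Rightarrow> (real ^ 'n) \<times> (real ^ 'n)" where
  "kick_drift \<delta> F z =
    (fst z + \<delta> *\<^sub>R (snd z + \<delta> *\<^sub>R F (fst z)), snd z + \<delta> *\<^sub>R F (fst z))"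

primrec discrete_flow :: "real \<Rightarrow> (real \<Rightarrow> real ^ 'n \<Rightarrow> real ^ 'n) \<Rightarrow> nat \<Rightarrow>
    (real ^ 'n) \<times> (real ^ 'n) \<Rightarrow> (real ^ 'n) \<times> (real ^ 'n)" where
  "discrete_flow \<delta> F 0 z = z"
| "discrete_flow \<delta> F (Suc m) z = kick_drift \<delta> (F (of_nat m * \<delta>)) (discrete_flow \<delta> F m z)"

lemma kick_drift_measurable [measurable (raw)]:
  assumes [measurable]: "F \<in> borel_measurable borel"
  shows "kick_drift \<delta> F \<in> borel_measurable borel"
  unfolding kick_drift_def[abs_def] borel_prod[symmetric] by measurable

lemma discrete_flow_measurable:
  assumes "\<And>m. m < n \<Longrightarrow> F (of_nat m * \<delta>) \<in> borel_measurable borel"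
  shows "discrete_flow \<delta> F n \<in> borel_measurable borel"
  using assms
proof (induction n)
  case 0
  then show ?case by simp
next
  case (Suc n)
  have "kick_drift \<delta> (F (of_nat n * \<delta>)) \<circ> discrete_flow \<delta> F n \<in> borel_measurable borel"
    by (rule measurable_comp[OF Suc.IH kick_drift_measurable]) (use Suc.prems in auto)
  then show ?case by (simp add: comp_def)
qed

text \<open>Each of the two shears preserves the measure by Tonelli's theorem and translation invariance, in \<open>v\<close> on
  the whole space and in \<open>x\<close> on the torus.\<close>

lemma nn_integral_kick_drift:
  fixes H :: "(real ^ 'n) \<times> (real ^ 'n) \<Rightarrow> ennreal"
  assumes H[measurable]: "H \<in> borel_measurable borel" and per: "\<And>v. torus_periodic (\<lambda>x. H (x, v))"
    and F[measurable]: "F \<in> borel_measurable borel"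
  shows "(\<integral>\<^sup>+ z. H (kick_drift \<delta> F z) \<partial>phase_measure) = (\<integral>\<^sup>+ z. H z \<partial>phase_measure)"
proof -
  have "(\<lambda>z :: (real ^ 'n) \<times> (real ^ 'n). (fst z + \<delta> *\<^sub>R snd z, snd z)) \<in> borel_measurable borel"
    by (intro borel_measurable_continuous_onI continuous_intros)
  from measurable_comp[OF this H]
  have drift: "(\<lambda>z. H (fst z + \<delta> *\<^sub>R snd z, snd z)) \<in> borel_measurable borel"
    by (simp add: comp_def)
  have "(\<integral>\<^sup>+ z. H (kick_drift \<delta> F z) \<partial>phase_measure) =
      (\<integral>\<^sup>+ x. \<integral>\<^sup>+ v. H (kick_drift \<delta> F (x, v)) \<partial>lborel \<partial>torus_measure)"
    by (rule nn_integral_phase(1)) measurable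
  also have "\<dots> = (\<integral>\<^sup>+ x. \<integral>\<^sup>+ v. H (x + \<delta> *\<^sub>R (\<delta> *\<^sub>R F x + v), \<delta> *\<^sub>R F x + v) \<partial>lborel \<partial>torus_measure)"
    by (simp add: kick_drift_def add.commute)
  also have "\<dots> = (\<integral>\<^sup>+ x. \<integral>\<^sup>+ v. H (x + \<delta> *\<^sub>R v, v) \<partial>lborel \<partial>torus_measure)"
    by (intro nn_integral_cong nn_integral_lborel_translation[where f = "\<lambda>v. H (_ + \<delta> *\<^sub>R v, v)"]) measurable
  also have "\<dots> = (\<integral>\<^sup>+ z. H (fst z + \<delta> *\<^sub>R snd z, snd z) \<partial>phase_measure)"
    by (subst nn_integral_phase(1)[OF drift]) simp_all
  also have "\<dots> = (\<integral>\<^sup>+ v. \<integral>\<^sup>+ x. H (x + \<delta> *\<^sub>R v, v) \<partial>torus_measure \<partial>lborel)"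
    by (subst nn_integral_phase(2)[OF drift]) simp_all
  also have "\<dots> = (\<integral>\<^sup>+ v. \<integral>\<^sup>+ x. H (x, v) \<partial>torus_measure \<partial>lborel)"
    by (intro nn_integral_cong nn_integral_torus_shift per) measurable
  also have "\<dots> = (\<integral>\<^sup>+ z. H z \<partial>phase_measure)" by (rule nn_integral_phase(2)[symmetric]) measurable
  finally show ?thesis .
qed

lemma torus_periodic_kick_drift:
  assumes "\<And>v. torus_periodic (\<lambda>x. H (x, v))" "torus_periodic F"
  shows "torus_periodic (\<lambda>x. H (kick_drift \<delta> F (x, v)))"
  unfolding torus_periodic_def
proof (intro allI)
  fix x i
  have "H ((x + \<delta> *\<^sub>R (v + \<delta> *\<^sub>R F x)) + axis i (2 * pi), v + \<delta> *\<^sub>R F x) =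
    H (x + \<delta> *\<^sub>R (v + \<delta> *\<^sub>R F x), v + \<delta> *\<^sub>R F x)"
    using assms(1) by (simp add: torus_periodic_def)
  then show "H (kick_drift \<delta> F (x + axis i (2 * pi), v)) = H (kick_drift \<delta> F (x, v))"
    using torus_periodicD[OF assms(2), of x i] by (simp add: kick_drift_def algebra_simps)
qed

lemma nn_integral_discrete_flow:
  fixes H :: "(real ^ 'n) \<times> (real ^ 'n) \<Rightarrow> ennreal"
  assumes "H \<in> borel_measurable borel" "\<And>v. torus_periodic (\<lambda>x. H (x, v))"
    and "\<And>m. m < n \<Longrightarrow> F (of_nat m * \<delta>) \<in> borel_measurable borel"
    and "\<And>m. m < n \<Longrightarrow> torus_periodic (F (of_nat m * \<delta>))"
  shows "(\<integral>\<^sup>+ z. H (discrete_flow \<delta> F n z) \<partial>phase_measure) = (\<integral>\<^sup>+ z. H z \<partial>phase_measure)"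
  using assms
proof (induction n arbitrary: H)
  case 0
  then show ?case by simp
next
  case (Suc n)
  let ?F = "F (of_nat n * \<delta>)"
  have F[measurable]: "?F \<in> borel_measurable borel" and Fp: "torus_periodic ?F" using Suc.prems by auto
  note [measurable] = Suc.prems(1)
  have "(\<integral>\<^sup>+ z. H (kick_drift \<delta> ?F (discrete_flow \<delta> F n z)) \<partial>phase_measure) =
      (\<integral>\<^sup>+ z. H (kick_drift \<delta> ?F z) \<partial>phase_measure)"
  proof (rule Suc.IH)
    show "(\<lambda>z. H (kick_drift \<delta> ?F z)) \<in> borel_measurable borel" by measurable
    show "torus_periodic (\<lambda>x. H (kick_drift \<delta> ?F (x, v)))" for v
      by (rule torus_periodic_kick_drift[OF Suc.prems(2) Fp])
  qed (use Suc.prems in auto)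
  also have "\<dots> = (\<integral>\<^sup>+ z. H z \<partial>phase_measure)"
    by (rule nn_integral_kick_drift[OF Suc.prems(1,2) F])
  finally show ?case by simp
qed

lemma integral_discrete_flow:
  fixes H :: "(real ^ 'n) \<times> (real ^ 'n) \<Rightarrow> real"
  assumes H: "integrable phase_measure H" and per: "\<And>v. torus_periodic (\<lambda>x. H (x, v))"
    and F: "\<And>m. m < n \<Longrightarrow> F (of_nat m * \<delta>) \<in> borel_measurable borel"
      "\<And>m. m < n \<Longrightarrow> torus_periodic (F (of_nat m * \<delta>))"
  shows "integrable phase_measure (\<lambda>z. H (discrete_flow \<delta> F n z))"
    and "(\<integral>z. H (discrete_flow \<delta> F n z) \<partial>phase_measure) = (\<integral>z. H z \<partial>phase_measure)"
proof -
  have Hm[measurable]: "H \<in> borel_measurable borel"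
    using H phase_measurable_iff by blast
  have fm[measurable]: "discrete_flow \<delta> F n \<in> borel_measurable borel"
    by (rule discrete_flow_measurable) (use F in auto)
  have *: "(\<integral>\<^sup>+ z. ennreal (g (H (discrete_flow \<delta> F n z))) \<partial>phase_measure) = (\<integral>\<^sup>+ z. ennreal (g (H z)) \<partial>phase_measure)"
    if [measurable]: "g \<in> borel_measurable borel" for g :: "real \<Rightarrow> real"
    by (rule nn_integral_discrete_flow[where H = "\<lambda>z. ennreal (g (H z))"])
      (use per F in \<open>auto simp: torus_periodic_def\<close>)
  show int: "integrable phase_measure (\<lambda>z. H (discrete_flow \<delta> F n z))"
    using H *[of norm] by (simp add: integrable_iff_bounded phase_measurable_iff)
  show "(\<integral>z. H (discrete_flow \<delta> F n z) \<partial>phase_measure) = (\<integral>z. H z \<partial>phase_measure)"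
    using *[of "\<lambda>x. x"] *[of uminus] by (simp add: real_lebesgue_integral_def[OF int] real_lebesgue_integral_def[OF H])
qed

section \<open>Transport along discrete characteristics\<close>

lemma linear_Basis_bound:
  fixes L :: "'a::euclidean_space \<Rightarrow> real"
  assumes "linear L"
  shows "\<bar>L y\<bar> \<le> (\<Sum>b\<in>Basis. \<bar>L b\<bar>) * norm y"
proof -
  have "L y = L (\<Sum>b\<in>Basis. (y \<bullet> b) *\<^sub>R b)" by (simp add: euclidean_representation)
  also have "\<dots> = (\<Sum>b\<in>Basis. (y \<bullet> b) * L b)"
    using assms by (simp add: linear_sum linear_cmul)
  finally have "\<bar>L y\<bar> \<le> (\<Sum>b\<in>Basis. \<bar>(y \<bullet> b) * L b\<bar>)" by simp
  also have "\<dots> \<le> (\<Sum>b\<in>Basis. norm y * \<bar>L b\<bar>)"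
    by (intro sum_mono) (simp add: abs_mult mult_right_mono Basis_le_norm)
  finally show ?thesis by (simp add: sum_distrib_left mult.commute)
qed

lemma C1_uniform_linearization:
  fixes g :: "'a::euclidean_space \<Rightarrow> real"
  assumes C: "compact C" "convex C"
    and g': "\<And>p. p \<in> C \<Longrightarrow> (g has_derivative g' p) (at p within C)"
      "\<And>b. continuous_on C (\<lambda>p. g' p b)"
    and e: "e > 0"
  obtains d where "d > 0"
    "\<And>p q. p \<in> C \<Longrightarrow> q \<in> C \<Longrightarrow> norm (q - p) < d \<Longrightarrow> \<bar>g q - g p - g' p (q - p)\<bar> \<le> e * norm (q - p)"
proof -
  define n where "n = real (card (Basis :: 'a set))"
  have n: "n > 0" by (simp add: n_def)
  have "\<forall>b. \<exists>d>0. \<forall>p\<in>C. \<forall>q\<in>C. dist q p < d \<longrightarrow> dist (g' q b) (g' p b) < e / n"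
    using compact_uniformly_continuous[OF g'(2) C(1)] e n
    unfolding uniformly_continuous_on_def by (metis divide_pos_pos)
  then obtain d where d: "\<And>b. d b > 0"
    "\<And>b p q. p \<in> C \<Longrightarrow> q \<in> C \<Longrightarrow> dist q p < d b \<Longrightarrow> dist (g' q b) (g' p b) < e / n" by metis
  define d0 where "d0 = Min (d ` Basis)"
  have d0: "d0 > 0" "\<And>b. b \<in> Basis \<Longrightarrow> d0 \<le> d b" using d(1) by (auto simp: d0_def)
  show thesis
  proof (rule that[OF d0(1)])
    fix p q assume pq: "p \<in> C" "q \<in> C" "norm (q - p) < d0"
    let ?S = "closed_segment p q"
    have sub: "?S \<subseteq> C" using C(2) pq convex_contains_segment by blast
    have "norm (g q - g p - g' p (q - p)) \<le> norm (q - p) * e"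
    proof (rule differentiable_bound_linearization[where S = ?S])
      show "p + t *\<^sub>R (q - p) \<in> ?S" if "t \<in> {0..1}" for t
        using that by (auto simp: closed_segment_def algebra_simps intro!: exI[of _ t])
      show "(g has_derivative g' x) (at x within ?S)" if "x \<in> ?S" for x
        using g'(1) sub that by (meson has_derivative_subset subsetD)
      show "onorm (g' x - g' p) \<le> e" if x: "x \<in> ?S" for x
      proof (rule onorm_le)
        fix y
        have xC: "x \<in> C" using x sub by auto
        have lin: "linear (g' x - g' p)"
          using has_derivative_linear[OF g'(1)[OF xC]] has_derivative_linear[OF g'(1)[OF pq(1)]]
          by (simp add: fun_diff_def linear_compose_sub)
        have "norm (x - p) \<le> norm (q - p)" using segment_bound1[OF x] by simp
        then have "dist x p < d b" if "b \<in> Basis" for b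
          using pq(3) d0(2)[OF that] by (simp add: dist_norm)
        then have "\<bar>(g' x - g' p) b\<bar> \<le> e / n" if "b \<in> Basis" for b
          using d(2)[OF pq(1) xC, of b] that by (force simp: dist_real_def)
        then have "(\<Sum>b\<in>Basis. \<bar>(g' x - g' p) b\<bar>) \<le> (\<Sum>b\<in>(Basis::'a set). e / n)" by (rule sum_mono)
        also have "\<dots> = e" using n by (simp add: n_def)
        finally show "norm ((g' x - g' p) y) \<le> e * norm y"
          using linear_Basis_bound[OF lin, of y] by (smt (verit) mult_right_mono norm_ge_zero real_norm_def)
      qed
    qed auto
    then show "\<bar>g q - g p - g' p (q - p)\<bar> \<le> e * norm (q - p)" by (simp add: mult.commute)
  qed
qed

lemma discrete_flow_bounds:
  fixes F :: "real \<Rightarrow> real ^ 'n \<Rightarrow> real ^ 'n"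
  assumes F: "\<And>m x. m < n \<Longrightarrow> norm (F (of_nat m * \<delta>) x) \<le> K" and \<delta>: "\<delta> \<ge> 0" and K: "K \<ge> 0"
  shows "norm (snd (discrete_flow \<delta> F n z) - snd z) \<le> n * \<delta> * K"
    and "norm (fst (discrete_flow \<delta> F n z) - fst z) \<le> n * \<delta> * (norm (snd z) + n * \<delta> * K)"
proof -
  have "norm (snd (discrete_flow \<delta> F n z) - snd z) \<le> n * \<delta> * K \<and>
    norm (fst (discrete_flow \<delta> F n z) - fst z) \<le> n * \<delta> * (norm (snd z) + n * \<delta> * K)"
    using F
  proof (induction n)
    case 0
    then show ?case by simp
  next
    case (Suc n)
    let ?w = "discrete_flow \<delta> F n z"
    let ?F = "F (of_nat n * \<delta>) (fst ?w)"
    let ?v = "snd (discrete_flow \<delta> F (Suc n) z)"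
    have IH1: "norm (snd ?w - snd z) \<le> n * \<delta> * K"
      and IH2: "norm (fst ?w - fst z) \<le> n * \<delta> * (norm (snd z) + n * \<delta> * K)"
      using Suc.IH Suc.prems by auto
    have "norm (\<delta> *\<^sub>R ?F) \<le> \<delta> * K" using Suc.prems[of n] \<delta> by (simp add: mult_left_mono)
    moreover have "?v - snd z = (snd ?w - snd z) + \<delta> *\<^sub>R ?F" by (simp add: kick_drift_def)
    ultimately have 1: "norm (?v - snd z) \<le> Suc n * \<delta> * K"
      using IH1 norm_triangle_ineq[of "snd ?w - snd z" "\<delta> *\<^sub>R ?F"]
      by (simp add: algebra_simps)
    have eq: "fst (discrete_flow \<delta> F (Suc n) z) - fst z = (fst ?w - fst z) + \<delta> *\<^sub>R ?v"
      by (simp add: kick_drift_def)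
    have "norm ?v \<le> norm (snd z) + Suc n * \<delta> * K"
      using 1 norm_triangle_ineq[of "snd z" "?v - snd z"] by simp
    then have "norm (\<delta> *\<^sub>R ?v) \<le> \<delta> * (norm (snd z) + Suc n * \<delta> * K)"
      using \<delta> by (simp only: norm_scaleR abs_of_nonneg) (rule mult_left_mono)
    moreover have "n * \<delta> * (norm (snd z) + n * \<delta> * K) \<le> n * \<delta> * (norm (snd z) + Suc n * \<delta> * K)"
      using \<delta> K by (intro mult_left_mono add_left_mono mult_right_mono) auto
    ultimately have "norm (fst (discrete_flow \<delta> F (Suc n) z) - fst z) \<le>
        n * \<delta> * (norm (snd z) + Suc n * \<delta> * K) + \<delta> * (norm (snd z) + Suc n * \<delta> * K)"
      unfolding eq using IH2 norm_triangle_ineq[of "fst ?w - fst z" "\<delta> *\<^sub>R ?v"] by linarith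
    also have "\<dots> = Suc n * \<delta> * (norm (snd z) + Suc n * \<delta> * K)" by (simp add: algebra_simps)
    finally show ?case using 1 by blast
  qed
  then show "norm (snd (discrete_flow \<delta> F n z) - snd z) \<le> n * \<delta> * K"
    "norm (fst (discrete_flow \<delta> F n z) - fst z) \<le> n * \<delta> * (norm (snd z) + n * \<delta> * K)" by auto
qed

text \<open>The properties of a solution of the Vlasov equation, with total force \<open>F\<close> taken as given, on which the
  approximation by the discrete flow rests.\<close>

locale transport_solution =
  fixes T K A :: real
    and F :: "real \<Rightarrow> real ^ 'n \<Rightarrow> real ^ 'n"
    and f :: "real \<Rightarrow> real ^ 'n \<Rightarrow> real ^ 'n \<Rightarrow> real"
  assumes T: "T > 0"
    and F_cont: "\<And>t. t \<in> {0..T} \<Longrightarrow> continuous_on UNIV (F t)"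
    and F_per: "\<And>t. t \<in> {0..T} \<Longrightarrow> torus_periodic (F t)"
    and F_bound: "\<And>t x. t \<in> {0..T} \<Longrightarrow> norm (F t x) \<le> K"
    and smooth: "Cinf_phase T f"
    and transport: "\<And>t x v. t \<in> {0..T} \<Longrightarrow>
      time_deriv T (\<lambda>s. f s x v) t + v \<bullet> grad (\<lambda>y. f t y v) x + F t x \<bullet> grad (f t x) v = 0"
    and moment: "\<And>t x. t \<in> {0..T} \<Longrightarrow> (\<integral>\<^sup>+ v. ennreal ((1 + norm v) * \<bar>f t x v\<bar>) \<partial>lborel) \<le> ennreal A"
    and A_nonneg: "A \<ge> 0"
begin

lemma K_nonneg: "K \<ge> 0"
  using order_trans[OF norm_ge_zero F_bound[of 0 0]] T by simp

abbreviation "slab \<equiv> {0..T} \<times> (UNIV :: ((real ^ 'n) \<times> (real ^ 'n)) set)"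

abbreviation "fu \<equiv> \<lambda>p. f (fst p) (fst (snd p)) (snd (snd p))"

lemma Ck_fu: "Ck_on k slab fu"
  using smooth unfolding Cinf_phase_def Cinf_on_def by (simp add: split_beta' UNIV_Times_UNIV)

lemma f_per: "t \<in> {0..T} \<Longrightarrow> torus_periodic (\<lambda>x. f t x v)"
  using smooth by (auto simp: Cinf_phase_def)

lemma f_cont:
  assumes "t \<in> {0..T}"
  shows "continuous_on UNIV (\<lambda>z. f t (fst z) (snd z))"
proof -
  have "continuous_on UNIV (fu \<circ> (\<lambda>z. (t, z)))"
    by (rule continuous_on_compose)
      (use assms in \<open>auto intro!: continuous_intros continuous_on_subset[OF Ck_on_imp_continuous_on[OF Ck_fu]]\<close>)
  then show ?thesis by (simp add: comp_def)
qed

lemma f_measurable: "t \<in> {0..T} \<Longrightarrow> (\<lambda>z. f t (fst z) (snd z)) \<in> borel_measurable borel"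
  by (intro borel_measurable_continuous_onI f_cont)

text \<open>The transport equation says that the full derivative of \<open>f\<close> vanishes in the direction
  \<open>(1, v, F)\<close> of the characteristics.\<close>

lemma derivative_along_characteristic:
  assumes t: "t \<in> {0..T}" and D: "(fu has_derivative D) (at (t, x, v) within slab)"
  shows "D (1, v, F t x) = 0"
proof -
  have lin: "linear D" using D by (simp add: has_derivative_linear)
  have "D (1, 0) = time_deriv T (\<lambda>s. f s x v) t"
    using has_time_deriv_unique(2)[OF T t D] by simp
  moreover have "D (0, h, 0) = grad (\<lambda>y. f t y v) x \<bullet> h" for h
  proof -
    have "((\<lambda>y. (t, y, v)) has_derivative (\<lambda>h. (0, h, 0))) (at x within UNIV)"
      by (auto intro!: derivative_eq_intros)
    then have "(fu \<circ> (\<lambda>y. (t, y, v)) has_derivative D \<circ> (\<lambda>h. (0, h, 0))) (at x within UNIV)"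
      by (rule diff_chain_within) (use D t in \<open>auto intro: has_derivative_subset\<close>)
    then show ?thesis using has_derivative_eq_grad[of "\<lambda>y. f t y v" "\<lambda>h. D (0, h, 0)"] by (simp add: comp_def)
  qed
  moreover have "D (0, 0, h) = grad (f t x) v \<bullet> h" for h
  proof -
    have "((\<lambda>y. (t, x, y)) has_derivative (\<lambda>h. (0, 0, h))) (at v within UNIV)"
      by (auto intro!: derivative_eq_intros)
    then have "(fu \<circ> (\<lambda>y. (t, x, y)) has_derivative D \<circ> (\<lambda>h. (0, 0, h))) (at v within UNIV)"
      by (rule diff_chain_within) (use D t in \<open>auto intro: has_derivative_subset\<close>)
    then show ?thesis using has_derivative_eq_grad[of "f t x" "\<lambda>h. D (0, 0, h)"] by (simp add: comp_def)
  qed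
  moreover have "D (1, v, F t x) = D (1, 0) + D (0, v, 0) + D (0, 0, F t x)"
    using linear_add[OF lin, of "(1, 0)" "(0, v, 0)"] linear_add[OF lin, of "(1, v, 0)" "(0, 0, F t x)"]
    by (simp add: zero_prod_def)
  ultimately show ?thesis using transport[OF t, of x v] by (simp add: inner_commute)
qed

text \<open>A step of the scheme moves the point \<open>(t, x, v)\<close> by \<open>\<delta> (1, v, F) + \<delta>\<^sup>2 (0, F, 0)\<close>. The derivative of \<open>f\<close>
  annihilates the first summand, so the increment is \<open>o(\<delta>)\<close>, uniformly on compact sets.\<close>

lemma one_step_consistency:
  assumes R: "R \<ge> 0" and e: "e > 0"
  obtains \<eta> where "\<eta> > 0"
    "\<And>t \<delta> z. t \<in> {0..T} \<Longrightarrow> 0 \<le> \<delta> \<Longrightarrow> \<delta> \<le> \<eta> \<Longrightarrow> t + \<delta> \<le> T \<Longrightarrow> norm (fst z) \<le> R \<Longrightarrow> norm (snd z) \<le> R \<Longrightarrow>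
      \<bar>f (t + \<delta>) (fst (kick_drift \<delta> (F t) z)) (snd (kick_drift \<delta> (F t) z)) - f t (fst z) (snd z)\<bar> \<le> e * \<delta>"
proof -
  define Q where "Q = 1 + R + 2 * K"
  have Q: "Q > 0" using R K_nonneg by (simp add: Q_def)
  define C where "C = {0..T} \<times> (cball 0 (R + Q) \<times> cball 0 (R + Q) :: ((real ^ 'n) \<times> (real ^ 'n)) set)"
  have C: "compact C" "convex C" "C \<subseteq> slab"
    by (auto simp: C_def intro!: compact_Times convex_Times)
  obtain D where D: "\<And>p. p \<in> slab \<Longrightarrow> (fu has_derivative D p) (at p within slab)"
    "\<And>h. continuous_on slab (\<lambda>p. D p h)"
    using Ck_fu[of "Suc 0"] by auto
  have DC: "(fu has_derivative D p) (at p within C)" if "p \<in> C" for p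
    using D(1) C(3) that by (meson has_derivative_subset subsetD)
  have cC: "continuous_on C (\<lambda>p. D p h)" for h
    using D(2) C(3) by (rule continuous_on_subset)
  obtain d where d: "d > 0"
    "\<And>p q. p \<in> C \<Longrightarrow> q \<in> C \<Longrightarrow> norm (q - p) < d \<Longrightarrow> \<bar>fu q - fu p - D p (q - p)\<bar> \<le> e / (2 * Q) * norm (q - p)"
    using C1_uniform_linearization[OF C(1,2) DC cC, of "e / (2 * Q)"] e Q by auto
  have "continuous_on C (\<lambda>p. \<Sum>b\<in>Basis. \<bar>D p b\<bar>)" by (intro continuous_intros cC)
  then have "compact ((\<lambda>p. \<Sum>b\<in>Basis. \<bar>D p b\<bar>) ` C)" using C(1) compact_continuous_image by blast
  then obtain B where B: "B > 0" "\<And>p. p \<in> C \<Longrightarrow> (\<Sum>b\<in>Basis. \<bar>D p b\<bar>) \<le> B"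
    by (smt (verit) bounded_pos compact_imp_bounded image_eqI real_norm_def)
  \<comment> \<open>The second bound keeps a step below \<open>d\<close>, as a step is at most \<open>Q\<close> times \<open>\<delta>\<close>; the third makes the
    second-order term \<open>\<delta>\<^sup>2 (0, F, 0)\<close> cost at most \<open>e/2\<close> per unit of time.\<close>
  define \<eta> where "\<eta> = min 1 (min (d / (2 * Q)) (e / (2 * (B * K + 1))))"
  have BK: "B * K \<ge> 0" using B K_nonneg by simp
  show thesis
  proof (rule that[of \<eta>])
    show "\<eta> > 0" using d Q e BK by (simp add: \<eta>_def add_nonneg_pos)
    fix t \<delta> :: real and z :: "(real ^ 'n) \<times> (real ^ 'n)"
    assume t: "t \<in> {0..T}" and \<delta>: "0 \<le> \<delta>" "\<delta> \<le> \<eta>" "t + \<delta> \<le> T" and z: "norm (fst z) \<le> R" "norm (snd z) \<le> R"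
    let ?w = "F t (fst z)"
    let ?p = "(t, fst z, snd z)"
    let ?h = "(1 :: real, snd z + \<delta> *\<^sub>R ?w, ?w)"
    let ?q = "?p + \<delta> *\<^sub>R ?h"
    have \<delta>1: "\<delta> \<le> 1" using \<delta> by (simp add: \<eta>_def)
    have w: "norm ?w \<le> K" using F_bound[OF t] .
    have dw: "norm (\<delta> *\<^sub>R ?w) \<le> K"
      using mult_mono[OF \<delta>1 w] \<delta>(1) by simp
    have n1: "norm (snd z + \<delta> *\<^sub>R ?w) \<le> R + K"
      using norm_triangle_ineq[of "snd z" "\<delta> *\<^sub>R ?w"] z dw by linarith
    have "norm ?h \<le> norm (1::real) + norm (snd z + \<delta> *\<^sub>R ?w, ?w)" by (rule norm_Pair_le)
    also have "\<dots> \<le> 1 + (norm (snd z + \<delta> *\<^sub>R ?w) + norm ?w)" using norm_Pair_le[of "snd z + \<delta> *\<^sub>R ?w" ?w] by simp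
    finally have nh: "norm ?h \<le> Q" using n1 w by (simp add: Q_def)
    have nqp: "norm (?q - ?p) \<le> \<delta> * Q" using nh \<delta>(1) by (simp only: add_diff_cancel_left' norm_scaleR) (simp add: mult_left_mono)
    have qeq: "?q = (t + \<delta>, kick_drift \<delta> (F t) z)"
      by (simp add: kick_drift_def prod_eq_iff)
    have p: "?p \<in> C" using t z Q by (cases z) (auto simp: C_def)
    have "norm (\<delta> *\<^sub>R (snd z + \<delta> *\<^sub>R ?w)) \<le> R + K" using mult_mono[OF \<delta>1 n1] \<delta>(1) by simp
    then have q: "?q \<in> C"
      using t z R n1 \<delta> dw K_nonneg norm_triangle_ineq[of "fst z" "\<delta> *\<^sub>R (snd z + \<delta> *\<^sub>R ?w)"]
        norm_triangle_ineq[of "snd z" "\<delta> *\<^sub>R ?w"]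
      unfolding qeq kick_drift_def by (auto simp: C_def Q_def)
    have "\<delta> * Q \<le> d / 2" using \<delta>(2) Q by (simp add: \<eta>_def field_simps)
    then have "norm (?q - ?p) < d" using nqp d(1) by linarith
    then have "\<bar>fu ?q - fu ?p - D ?p (?q - ?p)\<bar> \<le> e / (2 * Q) * norm (?q - ?p)"
      by (rule d(2)[OF p q])
    also have "\<dots> \<le> e / (2 * Q) * (\<delta> * Q)" using nqp e Q by (intro mult_left_mono) auto
    also have "\<dots> = e / 2 * \<delta>" using Q by simp
    finally have lin1: "\<bar>fu ?q - fu ?p - D ?p (?q - ?p)\<bar> \<le> e / 2 * \<delta>" .
    have pS: "?p \<in> slab" using p C by auto
    have lin: "linear (D ?p)" using has_derivative_linear[OF D(1)[OF pS]] .
    have "D ?p ?h = D ?p (1, snd z, ?w) + \<delta> * D ?p (0, ?w, 0)"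
      using linear_add[OF lin, of "(1, snd z, ?w)" "\<delta> *\<^sub>R (0, ?w, 0)"] linear_cmul[OF lin, of \<delta> "(0, ?w, 0)"]
      by simp
    also have "D ?p (1, snd z, ?w) = 0"
      by (rule derivative_along_characteristic[OF t D(1)[OF pS]])
    finally have "D ?p (?q - ?p) = \<delta> * (\<delta> * D ?p (0, ?w, 0))"
      using linear_cmul[OF lin, of \<delta> ?h] by (simp only: add_diff_cancel_left') simp
    moreover have "\<bar>D ?p (0, ?w, 0)\<bar> \<le> B * K"
    proof -
      have "\<bar>D ?p (0, ?w, 0)\<bar> \<le> (\<Sum>b\<in>Basis. \<bar>D ?p b\<bar>) * norm (0::real, ?w, 0::real^'n)"
        by (rule linear_Basis_bound[OF lin])
      also have "\<dots> \<le> B * K" using B p w by (intro mult_mono) (auto simp: norm_Pair)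
      finally show ?thesis .
    qed
    then have "\<delta> * \<bar>D ?p (0, ?w, 0)\<bar> \<le> \<eta> * (B * K + 1)" using \<delta> by (intro mult_mono) auto
    moreover have "\<eta> * (B * K + 1) \<le> e / 2"
    proof -
      have "\<eta> \<le> e / (2 * (B * K + 1))" by (simp add: \<eta>_def)
      then have "\<eta> * (B * K + 1) \<le> e / (2 * (B * K + 1)) * (B * K + 1)" using BK by (intro mult_right_mono) auto
      also have "\<dots> = e / 2" using BK by (simp add: field_simps add_nonneg_eq_0_iff)
      finally show ?thesis .
    qed
    ultimately have eqs: "D ?p (?q - ?p) = \<delta> * (\<delta> * D ?p (0, ?w, 0))"
      "\<delta> * \<bar>D ?p (0, ?w, 0)\<bar> \<le> e / 2" by linarith+
    have "\<bar>D ?p (?q - ?p)\<bar> = \<delta> * (\<delta> * \<bar>D ?p (0, ?w, 0)\<bar>)"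
      unfolding eqs(1) using \<delta>(1) by (simp add: abs_mult)
    also have "\<dots> \<le> \<delta> * (e / 2)" using eqs(2) \<delta>(1) by (rule mult_left_mono)
    finally have "\<bar>D ?p (?q - ?p)\<bar> \<le> \<delta> * (e / 2)" .
    moreover have "\<bar>fu ?q - fu ?p\<bar> \<le> \<bar>fu ?q - fu ?p - D ?p (?q - ?p)\<bar> + \<bar>D ?p (?q - ?p)\<bar>" by linarith
    moreover have "e / 2 * \<delta> + \<delta> * (e / 2) = e * \<delta>" by simp
    ultimately have "\<bar>fu ?q - fu ?p\<bar> \<le> e * \<delta>" using lin1 by linarith
    then show "\<bar>f (t + \<delta>) (fst (kick_drift \<delta> (F t) z)) (snd (kick_drift \<delta> (F t) z)) - f t (fst z) (snd z)\<bar> \<le> e * \<delta>"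
      unfolding qeq by simp
  qed
qed

text \<open>The increments of \<open>n\<close> steps add up to \<open>n o(\<delta>)\<close>, which is small as \<open>n \<delta>\<close> stays below \<open>T\<close>. The
  trajectories stay in a ball whose radius depends on \<open>R\<close>, \<open>T\<close> and \<open>K\<close> only.\<close>

lemma f_along_discrete_flow:
  assumes R: "R \<ge> 0" and e: "e > 0"
  obtains \<eta> where "\<eta> > 0"
    "\<And>\<delta> n z. 0 \<le> \<delta> \<Longrightarrow> \<delta> \<le> \<eta> \<Longrightarrow> of_nat n * \<delta> \<le> T \<Longrightarrow> norm (fst z) \<le> R \<Longrightarrow> norm (snd z) \<le> R \<Longrightarrow>
      \<bar>f (of_nat n * \<delta>) (fst (discrete_flow \<delta> F n z)) (snd (discrete_flow \<delta> F n z)) - f 0 (fst z) (snd z)\<bar>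
        \<le> e * (of_nat n * \<delta>)"
proof -
  define R' where "R' = R + T * (R + T * K) + T * K"
  have R': "R' \<ge> 0" using R T K_nonneg by (simp add: R'_def)
  obtain \<eta> where \<eta>: "\<eta> > 0" and step:
    "\<And>t \<delta> z. t \<in> {0..T} \<Longrightarrow> 0 \<le> \<delta> \<Longrightarrow> \<delta> \<le> \<eta> \<Longrightarrow> t + \<delta> \<le> T \<Longrightarrow> norm (fst z) \<le> R' \<Longrightarrow> norm (snd z) \<le> R' \<Longrightarrow>
      \<bar>f (t + \<delta>) (fst (kick_drift \<delta> (F t) z)) (snd (kick_drift \<delta> (F t) z)) - f t (fst z) (snd z)\<bar> \<le> e * \<delta>"
    using one_step_consistency[OF R' e] by blast
  show thesis
  proof (rule that[OF \<eta>])
    fix \<delta> n and z :: "(real ^ 'n) \<times> (real ^ 'n)"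
    assume \<delta>: "0 \<le> \<delta>" "\<delta> \<le> \<eta>" and n: "of_nat n * \<delta> \<le> T" and z: "norm (fst z) \<le> R" "norm (snd z) \<le> R"
    show "\<bar>f (of_nat n * \<delta>) (fst (discrete_flow \<delta> F n z)) (snd (discrete_flow \<delta> F n z)) - f 0 (fst z) (snd z)\<bar>
        \<le> e * (of_nat n * \<delta>)"
      using n
    proof (induction n)
      case 0
      then show ?case by simp
    next
      case (Suc n)
      let ?t = "of_nat n * \<delta>"
      let ?z = "discrete_flow \<delta> F n z"
      have tT: "?t + \<delta> \<le> T" using Suc.prems by (simp add: algebra_simps)
      then have t: "?t \<in> {0..T}" using \<delta>(1) by auto
      have Fm: "norm (F (of_nat m * \<delta>) x) \<le> K" if "m < n" for m x
      proof (rule F_bound)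
        have "of_nat m * \<delta> \<le> ?t" using that \<delta>(1) by (intro mult_right_mono) auto
        then show "of_nat m * \<delta> \<in> {0..T}" using t \<delta>(1) by auto
      qed
      have tK: "?t * K \<le> T * K" using t K_nonneg by (intro mult_right_mono) auto
      have v: "norm (snd ?z - snd z) \<le> T * K"
        using discrete_flow_bounds(1)[of n F \<delta> K z, OF Fm \<delta>(1) K_nonneg] tK by linarith
      have "norm (fst ?z - fst z) \<le> ?t * (norm (snd z) + ?t * K)"
        using discrete_flow_bounds(2)[of n F \<delta> K z, OF Fm \<delta>(1) K_nonneg] .
      also have "\<dots> \<le> T * (R + T * K)" using t z tK K_nonneg by (intro mult_mono add_mono) auto
      finally have x: "norm (fst ?z - fst z) \<le> T * (R + T * K)" .
      have nn: "T * K \<ge> 0" "T * (R + T * K) \<ge> 0" using T K_nonneg R by auto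
      have "norm (snd ?z) \<le> R'" "norm (fst ?z) \<le> R'"
        using v x z nn norm_triangle_ineq[of "snd ?z - snd z" "snd z"] norm_triangle_ineq[of "fst ?z - fst z" "fst z"]
        by (simp_all add: R'_def)
      then have "\<bar>f (?t + \<delta>) (fst (kick_drift \<delta> (F ?t) ?z)) (snd (kick_drift \<delta> (F ?t) ?z)) - f ?t (fst ?z) (snd ?z)\<bar> \<le> e * \<delta>"
        using step[OF t \<delta> tT] by blast
      moreover have "of_nat (Suc n) * \<delta> = ?t + \<delta>" by (simp add: algebra_simps)
      moreover have "\<bar>f ?t (fst ?z) (snd ?z) - f 0 (fst z) (snd z)\<bar> \<le> e * ?t"
        using Suc.IH t by auto
      ultimately show ?case by (simp add: distrib_left)
    qed
  qed
qed

end

context transport_solution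
begin

lemma f_moment_integrable:
  assumes t: "t \<in> {0..T}"
  shows "integrable phase_measure (\<lambda>z. (1 + norm (snd z)) * \<bar>f t (fst z) (snd z)\<bar>)"
    and "(\<integral>z. (1 + norm (snd z)) * \<bar>f t (fst z) (snd z)\<bar> \<partial>phase_measure)
      \<le> A * measure (torus_measure :: (real ^ 'n) measure) UNIV"
proof -
  let ?g = "\<lambda>z. (1 + norm (snd z)) * \<bar>f t (fst z) (snd z)\<bar>"
  have m: "?g \<in> borel_measurable borel"
    by (intro borel_measurable_continuous_onI continuous_intros f_cont[OF t])
  have nonneg: "?g z \<ge> 0" for z by simp
  have "(\<integral>\<^sup>+ z. ennreal (?g z) \<partial>phase_measure) =
      (\<integral>\<^sup>+ x. \<integral>\<^sup>+ v. ennreal (?g (x, v)) \<partial>lborel \<partial>torus_measure)"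
    by (rule nn_integral_phase(1)) (use m in measurable)
  also have "\<dots> \<le> (\<integral>\<^sup>+ x. ennreal A \<partial>(torus_measure :: (real ^ 'n) measure))"
    by (rule nn_integral_mono) (use moment[OF t] in simp)
  also have "\<dots> = ennreal (A * measure (torus_measure :: (real ^ 'n) measure) UNIV)"
    using A_nonneg by (simp add: torus_measure.emeasure_eq_measure ennreal_mult)
  finally have le: "(\<integral>\<^sup>+ z. ennreal (?g z) \<partial>phase_measure) \<le> ennreal (A * measure (torus_measure :: (real ^ 'n) measure) UNIV)" .
  show int: "integrable phase_measure ?g"
  proof (rule integrableI_nonneg)
    show "?g \<in> borel_measurable phase_measure" using m phase_measurable_iff by blast
    show "(\<integral>\<^sup>+ z. ennreal (?g z) \<partial>phase_measure) < \<infinity>"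
      using le by (rule order.strict_trans1) simp
  qed (simp add: nonneg)
  have "ennreal (\<integral>z. ?g z \<partial>phase_measure) = (\<integral>\<^sup>+ z. ennreal (?g z) \<partial>phase_measure)"
    by (rule nn_integral_eq_integral[symmetric, OF int]) (simp add: nonneg)
  with le have "ennreal (\<integral>z. ?g z \<partial>phase_measure) \<le> ennreal (A * measure (torus_measure :: (real ^ 'n) measure) UNIV)"
    by simp
  moreover have "A * measure (torus_measure :: (real ^ 'n) measure) UNIV \<ge> 0" using A_nonneg by simp
  ultimately show "(\<integral>z. ?g z \<partial>phase_measure) \<le> A * measure (torus_measure :: (real ^ 'n) measure) UNIV"
    using ennreal_le_iff by blast
qed

lemma f_weighted_integrable:
  assumes t: "t \<in> {0..T}" and g: "g \<in> borel_measurable borel"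
    and b: "\<And>z. \<bar>g z\<bar> \<le> c * (1 + norm (snd z))" 
  shows "integrable phase_measure (\<lambda>z. g z * f t (fst z) (snd z))"
proof (rule Bochner_Integration.integrable_bound)
  show "integrable phase_measure (\<lambda>z. c * ((1 + norm (snd z)) * \<bar>f t (fst z) (snd z)\<bar>))"
    by (intro integrable_mult_right f_moment_integrable t)
  show "(\<lambda>z. g z * f t (fst z) (snd z)) \<in> borel_measurable phase_measure"
    using g f_measurable[OF t] by (simp add: phase_measurable_iff)
  have "norm (g z * f t (fst z) (snd z)) \<le> norm (c * ((1 + norm (snd z)) * \<bar>f t (fst z) (snd z)\<bar>))" for z
  proof -
    have "norm (g z * f t (fst z) (snd z)) \<le> (c * (1 + norm (snd z))) * \<bar>f t (fst z) (snd z)\<bar>"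
      using b[of z] by (simp add: abs_mult mult_right_mono)
    also have "\<dots> \<le> norm (c * ((1 + norm (snd z)) * \<bar>f t (fst z) (snd z)\<bar>))"
      by (simp add: mult.assoc)
    finally show ?thesis .
  qed
  then show "AE z in phase_measure. norm (g z * f t (fst z) (snd z)) \<le> norm (c * ((1 + norm (snd z)) * \<bar>f t (fst z) (snd z)\<bar>))"
    by simp
qed

lemma integral_against_density:
  assumes t: "t \<in> {0..T}" and a: "continuous_on UNIV a" "\<And>x. \<bar>a x\<bar> \<le> c"
  shows "integrable phase_measure (\<lambda>z. a (fst z) * f t (fst z) (snd z))"
    and "(\<integral>z. a (fst z) * f t (fst z) (snd z) \<partial>phase_measure) = (\<integral>x. a x * spatial_density (f t) x \<partial>torus_measure)"
    and "integrable torus_measure (\<lambda>x. a x * spatial_density (f t) x)"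
proof -
  have c0: "c \<ge> 0" using a(2)[of 0] by linarith
  have am: "(\<lambda>z. a (fst z)) \<in> borel_measurable (borel :: ((real ^ 'n) \<times> (real ^ 'n)) measure)"
    by (intro borel_measurable_continuous_onI continuous_on_compose2[OF a(1)] continuous_intros) auto
  have ab: "\<bar>a (fst z)\<bar> \<le> c * (1 + norm (snd z))" for z :: "(real ^ 'n) \<times> (real ^ 'n)"
  proof -
    have "\<bar>a (fst z)\<bar> \<le> c * 1" using a(2) by simp
    also have "\<dots> \<le> c * (1 + norm (snd z))" using c0 by (intro mult_left_mono) auto
    finally show ?thesis .
  qed
  show int: "integrable phase_measure (\<lambda>z. a (fst z) * f t (fst z) (snd z))"
    by (rule f_weighted_integrable[OF t am ab])
  have int': "integrable (torus_measure \<Otimes>\<^sub>M lborel) (\<lambda>z. a (fst z) * f t (fst z) (snd z))"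
    using int by (simp add: phase_measure_def)
  show "(\<integral>z. a (fst z) * f t (fst z) (snd z) \<partial>phase_measure) = (\<integral>x. a x * spatial_density (f t) x \<partial>torus_measure)"
    using phase.integral_fst'[OF int'] by (simp add: phase_measure_def spatial_density_def)
  show "integrable torus_measure (\<lambda>x. a x * spatial_density (f t) x)"
    using phase.integrable_fst'[OF int'] by (simp add: spatial_density_def)
qed

text \<open>By measure preservation the first integral may be evaluated along the discrete flow, and there \<open>f t\<close> is
  close to \<open>f 0\<close> uniformly for bounded velocities. For velocities above \<open>R\<close> both functions are compared
  with their first moments: velocities change by at most \<open>K T\<close>, so the tails cost at most a multiple of
  \<open>1 / (R - K T)\<close>, again by measure preservation.\<close>

lemma discrete_flow_approximation:
  assumes t: "0 < t" "t \<le> T" and a: "continuous_on UNIV a" "torus_periodic a" "\<And>x. \<bar>a x\<bar> \<le> c"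
    and e: "e > 0"
  obtains N0 where "N0 > 0"
    "\<And>N. N \<ge> N0 \<Longrightarrow> \<bar>(\<integral>z. a (fst z) * f t (fst z) (snd z) \<partial>phase_measure) -
      (\<integral>z. a (fst (discrete_flow (t / of_nat N) F N z)) * f 0 (fst z) (snd z) \<partial>phase_measure)\<bar> \<le> e"
proof -
  have tT: "t \<in> {0..T}" and zT: "0 \<in> {0..T}" using t T by auto
  have c0: "c \<ge> 0" using a(3)[of 0] by linarith
  define vol where "vol = measure (torus_measure :: (real ^ 'n) measure) UNIV"
  define P where "P = c * (2 * (A * vol))"
  have P0: "P \<ge> 0" using A_nonneg c0 by (simp add: P_def vol_def)
  \<comment> \<open>The cell lies in the ball of radius \<open>R\<close>, and the velocity tails above \<open>R\<close> cost at most \<open>e/2\<close>.\<close>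
  define R where "R = max (torus_diam TYPE('n)) (K * T + 1 + 2 * P / e)"
  have KT: "K * T \<ge> 0" using K_nonneg T by simp
  have Pe: "2 * P / e \<ge> 0" using P0 e by simp
  have RR: "K * T + 1 + 2 * P / e \<le> R" "torus_diam TYPE('n) \<le> R" by (simp_all add: R_def)
  then have R: "R \<ge> 0" "R - K * T \<ge> 1" "R - K * T > 2 * P / e" using Pe KT by linarith+
  have PR: "P / (R - K * T) \<le> e / 2"
    using R(2,3) e by (simp add: field_simps)
  define W where "W = measure (phase_measure :: ((real ^ 'n) \<times> (real ^ 'n)) measure) {z. norm (snd z) \<le> R}"
  have finW: "emeasure (phase_measure :: ((real ^ 'n) \<times> (real ^ 'n)) measure) {z. norm (snd z) \<le> R} < \<infinity>"
  proof -
    have "{z :: (real ^ 'n) \<times> (real ^ 'n). norm (snd z) \<le> R} = UNIV \<times> cball 0 R" by auto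
    then have "emeasure (phase_measure :: ((real ^ 'n) \<times> (real ^ 'n)) measure) {z. norm (snd z) \<le> R} =
        emeasure torus_measure (UNIV :: (real ^ 'n) set) * emeasure lborel (cball (0 :: real ^ 'n) R)"
      unfolding phase_measure_def by (simp add: lborel.emeasure_pair_measure_Times)
    also have "\<dots> < \<infinity>"
      using torus_measure.emeasure_finite[where 'a = 'n, unfolded less_top] emeasure_compact_finite[OF compact_cball, of "0 :: real ^ 'n" R]
      by (simp add: ennreal_mult_less_top)
    finally show ?thesis .
  qed
  have Wm: "{z. norm (snd z) \<le> R} \<in> sets (phase_measure :: ((real ^ 'n) \<times> (real ^ 'n)) measure)"
    by (simp, intro borel_closed closed_Collect_le continuous_intros)
  have W0: "W \<ge> 0" by (simp add: W_def)
  define e1 where "e1 = e / (2 * (c * T * W + 1))"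
  have cTW: "c * T * W \<ge> 0" using c0 T W0 by simp
  have e1: "e1 > 0" using e cTW by (simp add: e1_def add_nonneg_pos)
  have ce1: "c * (e1 * T * W) \<le> e / 2"
  proof -
    have "c * (e1 * T * W) = (c * T * W) * e1" by simp
    also have "\<dots> \<le> (c * T * W + 1) * e1" using e1 by (intro mult_right_mono) auto
    also have "\<dots> = e / 2"
    proof -
      have "X * (e / (2 * X)) = e / 2" if "X \<noteq> 0" for X using that by simp
      moreover have "c * T * W + 1 \<noteq> 0" using cTW by linarith
      ultimately show ?thesis unfolding e1_def by blast
    qed
    finally show ?thesis .
  qed
  obtain \<eta> where \<eta>: "\<eta> > 0" and near:
    "\<And>\<delta> n z. 0 \<le> \<delta> \<Longrightarrow> \<delta> \<le> \<eta> \<Longrightarrow> of_nat n * \<delta> \<le> T \<Longrightarrow> norm (fst z) \<le> R \<Longrightarrow> norm (snd z) \<le> R \<Longrightarrow>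
      \<bar>f (of_nat n * \<delta>) (fst (discrete_flow \<delta> F n z)) (snd (discrete_flow \<delta> F n z)) - f 0 (fst z) (snd z)\<bar>
        \<le> e1 * (of_nat n * \<delta>)"
    using f_along_discrete_flow[OF R(1) e1] by blast
  obtain N0 :: nat where N0: "N0 > 0" "t / N0 \<le> \<eta>"
  proof -
    obtain N :: nat where "t / \<eta> < N" using reals_Archimedean2 by blast
    moreover from this have "N > 0" using \<eta> t by (metis divide_pos_pos gr0I less_trans of_nat_0 order_less_irrefl)
    ultimately show thesis using that[of N] \<eta> by (simp add: field_simps less_imp_le)
  qed
  show thesis
  proof (rule that[OF N0(1)])
    fix N assume N: "N \<ge> N0"
    define \<delta> where "\<delta> = t / real N"
    have Npos: "N > 0" using N N0 by simp
    have \<delta>: "\<delta> > 0" "\<delta> \<le> \<eta>" "real N * \<delta> = t"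
    proof -
      show "\<delta> > 0" "real N * \<delta> = t" using t Npos by (simp_all add: \<delta>_def)
      have "\<delta> \<le> t / N0" unfolding \<delta>_def using t N N0 by (intro divide_left_mono) auto
      then show "\<delta> \<le> \<eta>" using N0 by linarith
    qed
    have times: "real m * \<delta> \<in> {0..T}" if "m < N" for m
    proof -
      have "real m * \<delta> \<le> real N * \<delta>" using that \<delta> by (intro mult_right_mono) auto
      then show ?thesis using \<delta> t by auto
    qed
    define \<Phi> where "\<Phi> = discrete_flow \<delta> F N"
    have Fm: "F (real m * \<delta>) \<in> borel_measurable borel" "torus_periodic (F (real m * \<delta>))" if "m < N" for m
      using borel_measurable_continuous_onI[OF F_cont[OF times[OF that]]] F_per[OF times[OF that]] by auto
    have \<Phi>m: "\<Phi> \<in> borel_measurable borel"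
      unfolding \<Phi>_def by (rule discrete_flow_measurable) (use Fm in auto)
    have cm: "(\<lambda>z. g (\<Phi> z)) \<in> borel_measurable borel" if "g \<in> borel_measurable borel" for g :: "_ \<Rightarrow> real"
      using measurable_comp[OF \<Phi>m that] by (simp add: comp_def)
    have \<Phi>b: "norm (snd (\<Phi> z) - snd z) \<le> K * T" for z
    proof -
      have "norm (snd (\<Phi> z) - snd z) \<le> real N * \<delta> * K"
        unfolding \<Phi>_def by (rule discrete_flow_bounds(1)) (use F_bound times \<delta> K_nonneg in auto)
      also have "\<dots> \<le> K * T" using \<delta>(3) t K_nonneg by (simp add: mult.commute mult_left_mono)
      finally show ?thesis .
    qed
    define g where "g z = f t (fst z) (snd z)" for z
    define g0 where "g0 z = f 0 (fst z) (snd z)" for z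
    have am: "(\<lambda>z. a (fst z)) \<in> borel_measurable (borel :: ((real ^ 'n) \<times> (real ^ 'n)) measure)"
      by (intro borel_measurable_continuous_onI continuous_on_compose2[OF a(1)] continuous_intros) auto
    have ig: "integrable phase_measure (\<lambda>z. a (fst z) * g z)"
      unfolding g_def by (rule integral_against_density(1)[OF tT a(1,3)])
    have ap: "torus_periodic (\<lambda>x. a (fst (x, v)) * g (x, v))" for v
      using a(2) f_per[OF tT, of v] by (simp add: torus_periodic_def g_def)
    have ig\<Phi>: "integrable phase_measure (\<lambda>z. a (fst (\<Phi> z)) * g (\<Phi> z))"
      and eqg: "(\<integral>z. a (fst (\<Phi> z)) * g (\<Phi> z) \<partial>phase_measure) = (\<integral>z. a (fst z) * g z \<partial>phase_measure)"
      unfolding \<Phi>_def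
      using integral_discrete_flow[OF ig ap, of N F \<delta>] Fm by auto
    have ig0: "integrable phase_measure (\<lambda>z. a (fst (\<Phi> z)) * g0 z)"
      unfolding g0_def
    proof (rule f_weighted_integrable[OF zT cm[OF am]])
      fix z :: "(real ^ 'n) \<times> (real ^ 'n)"
      have "\<bar>a (fst (\<Phi> z))\<bar> \<le> c * 1" using a(3) by simp
      also have "\<dots> \<le> c * (1 + norm (snd z))" using c0 by (intro mult_left_mono) auto
      finally show "\<bar>a (fst (\<Phi> z))\<bar> \<le> c * (1 + norm (snd z))" .
    qed
    define m where "m s z = (1 + norm (snd z)) * \<bar>f s (fst z) (snd z)\<bar>" for s and z :: "(real ^ 'n) \<times> (real ^ 'n)"
    have im: "integrable phase_measure (m t)" "integrable phase_measure (m 0)"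
      "(\<integral>z. m t z \<partial>phase_measure) \<le> A * vol" "(\<integral>z. m 0 z \<partial>phase_measure) \<le> A * vol"
      using f_moment_integrable[OF tT] f_moment_integrable[OF zT] by (simp_all add: m_def[abs_def] vol_def)
    have mp: "torus_periodic (\<lambda>x. m t (x, v))" for v
      using f_per[OF tT, of v] by (simp add: torus_periodic_def m_def)
    have im\<Phi>: "integrable phase_measure (\<lambda>z. m t (\<Phi> z))"
      "(\<integral>z. m t (\<Phi> z) \<partial>phase_measure) = (\<integral>z. m t z \<partial>phase_measure)"
      unfolding \<Phi>_def
      using integral_discrete_flow[OF im(1) mp, of N F \<delta>] Fm by auto
    have iW: "integrable phase_measure (indicator {z :: (real ^ 'n) \<times> (real ^ 'n). norm (snd z) \<le> R} :: _ \<Rightarrow> real)"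
      using Wm finW by (rule integrable_real_indicator)
    define b where "b z = c * (e1 * T * indicator {z. norm (snd z) \<le> R} z + (m t (\<Phi> z) + m 0 z) / (R - K * T))" for z
    have ib: "integrable phase_measure b"
      unfolding b_def[abs_def] by (intro integrable_mult_right Bochner_Integration.integrable_add integrable_divide iW im im\<Phi>)
    have "(\<integral>z. b z \<partial>phase_measure) = c * (e1 * T * W + ((\<integral>z. m t z \<partial>phase_measure) + (\<integral>z. m 0 z \<partial>phase_measure)) / (R - K * T))"
      unfolding b_def[abs_def] using iW im im\<Phi> by (simp add: W_def)
    also have "\<dots> \<le> c * (e1 * T * W + (2 * (A * vol)) / (R - K * T))"
      using c0 im R(2) by (intro mult_left_mono add_left_mono divide_right_mono) auto
    also have "\<dots> = c * (e1 * T * W) + P / (R - K * T)" by (simp add: P_def distrib_left)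
    also have "\<dots> \<le> e" using ce1 PR by linarith
    finally have bint: "(\<integral>z. b z \<partial>phase_measure) \<le> e" .
    have "AE z in phase_measure. norm (a (fst (\<Phi> z)) * g (\<Phi> z) - a (fst (\<Phi> z)) * g0 z) \<le> b z"
      using AE_phase_measure
    proof eventually_elim
      case (elim z)
      have "\<bar>g (\<Phi> z) - g0 z\<bar> \<le> e1 * T * indicator {z. norm (snd z) \<le> R} z + (m t (\<Phi> z) + m 0 z) / (R - K * T)"
      proof (cases "norm (snd z) \<le> R")
        case True
        have "norm (fst z) \<le> R" using norm_torus_cell[OF elim] RR(2) by simp
        from near[OF less_imp_le[OF \<delta>(1)] \<delta>(2) _ this True, of N] \<delta>(3) t
        have "\<bar>g (\<Phi> z) - g0 z\<bar> \<le> e1 * t" by (simp add: \<Phi>_def g_def g0_def)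
        also have "\<dots> \<le> e1 * T" using e1 t by simp
        finally show ?thesis using True R(2) by (simp add: m_def add_increasing2)
      next
        case False
        have "R - K * T \<le> 1 + norm (snd (\<Phi> z))"
          using \<Phi>b[of z] False norm_triangle_ineq2[of "snd z" "snd z - snd (\<Phi> z)"]
          by (simp add: norm_minus_commute)
        then have 1: "(R - K * T) * \<bar>g (\<Phi> z)\<bar> \<le> m t (\<Phi> z)"
          unfolding m_def g_def by (rule mult_right_mono) simp
        have 2: "(R - K * T) * \<bar>g0 z\<bar> \<le> m 0 z"
          unfolding m_def g0_def by (rule mult_right_mono) (use False KT in auto)
        have "(R - K * T) * \<bar>g (\<Phi> z) - g0 z\<bar> \<le> (R - K * T) * (\<bar>g (\<Phi> z)\<bar> + \<bar>g0 z\<bar>)"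
          using R(2) by (intro mult_left_mono abs_triangle_ineq4) auto
        also have "\<dots> \<le> m t (\<Phi> z) + m 0 z" using 1 2 by (simp add: distrib_left)
        finally show ?thesis using False R(2) by (simp add: field_simps)
      qed
      then have "\<bar>a (fst (\<Phi> z))\<bar> * \<bar>g (\<Phi> z) - g0 z\<bar> \<le> b z"
        unfolding b_def using a(3) c0 by (intro mult_mono) auto
      then show ?case by (simp add: abs_mult[symmetric] right_diff_distrib)
    qed
    then have "(\<integral>z. norm (a (fst (\<Phi> z)) * g (\<Phi> z) - a (fst (\<Phi> z)) * g0 z) \<partial>phase_measure) \<le> (\<integral>z. b z \<partial>phase_measure)"
      by (intro integral_mono_AE integrable_norm Bochner_Integration.integrable_diff ig\<Phi> ig0 ib)
    then have "norm (\<integral>z. a (fst (\<Phi> z)) * g (\<Phi> z) - a (fst (\<Phi> z)) * g0 z \<partial>phase_measure) \<le> (\<integral>z. b z \<partial>phase_measure)"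
      by (rule order_trans[OF integral_norm_bound])
    then show "\<bar>(\<integral>z. a (fst z) * f t (fst z) (snd z) \<partial>phase_measure) -
      (\<integral>z. a (fst (discrete_flow (t / of_nat N) F N z)) * f 0 (fst z) (snd z) \<partial>phase_measure)\<bar> \<le> e"
      using bint ig\<Phi> ig0 eqg by (simp add: \<Phi>_def \<delta>_def g_def g0_def)
  qed
qed

end

section \<open>Separation of characteristics driven by different fields\<close>

text \<open>The velocity reached from rest after \<open>m\<close> steps of the scheme under the scalar force \<open>s^k / k!\<close>; the
  displacement is \<open>drift_sum\<close>.\<close>

definition kick_sum :: "nat \<Rightarrow> real \<Rightarrow> nat \<Rightarrow> real" where
  "kick_sum k \<delta> m = (\<Sum>i<m. \<delta> * ((of_nat i * \<delta>) ^ k / fact k))"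

definition drift_sum :: "nat \<Rightarrow> real \<Rightarrow> nat \<Rightarrow> real" where
  "drift_sum k \<delta> m = (\<Sum>j<m. \<delta> * kick_sum k \<delta> (Suc j))"

lemma kick_sum_nonneg: "\<delta> \<ge> 0 \<Longrightarrow> kick_sum k \<delta> m \<ge> 0"
  by (auto simp: kick_sum_def intro!: sum_nonneg)

lemma kick_sum_mono: "\<delta> \<ge> 0 \<Longrightarrow> m \<le> n \<Longrightarrow> kick_sum k \<delta> m \<le> kick_sum k \<delta> n"
  unfolding kick_sum_def by (rule sum_mono2) auto

text \<open>Keep only the kicks in the second third of the time interval and the drifts in the last third.\<close>

lemma drift_sum_lower_bound:
  assumes \<delta>: "\<delta> \<ge> 0"
  shows "(of_nat p * \<delta>) ^ (k + 2) / fact k \<le> drift_sum k \<delta> (3 * p)"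
proof -
  have "of_nat p * (\<delta> * ((of_nat p * \<delta>) ^ k / fact k)) = (\<Sum>i\<in>{p..<2*p}. \<delta> * ((of_nat p * \<delta>) ^ k / fact k))"
    by simp
  also have "\<dots> \<le> (\<Sum>i\<in>{p..<2*p}. \<delta> * ((of_nat i * \<delta>) ^ k / fact k))"
    using \<delta> by (intro sum_mono mult_left_mono divide_right_mono power_mono mult_right_mono) auto
  also have "\<dots> \<le> kick_sum k \<delta> (2 * p)"
    unfolding kick_sum_def using \<delta> by (intro sum_mono2) auto
  finally have c: "of_nat p * (\<delta> * ((of_nat p * \<delta>) ^ k / fact k)) \<le> kick_sum k \<delta> (2 * p)" .
  have "of_nat p * (\<delta> * (of_nat p * (\<delta> * ((of_nat p * \<delta>) ^ k / fact k)))) \<le> of_nat p * (\<delta> * kick_sum k \<delta> (2 * p))"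
    using c \<delta> by (intro mult_left_mono) auto
  also have "\<dots> = (\<Sum>j\<in>{2*p..<3*p}. \<delta> * kick_sum k \<delta> (2 * p))" by simp
  also have "\<dots> \<le> (\<Sum>j\<in>{2*p..<3*p}. \<delta> * kick_sum k \<delta> (Suc j))"
    using \<delta> by (intro sum_mono mult_left_mono kick_sum_mono) auto
  also have "\<dots> \<le> drift_sum k \<delta> (3 * p)"
    unfolding drift_sum_def using \<delta> by (intro sum_mono2) (auto simp: kick_sum_nonneg)
  finally show ?thesis by (simp add: power_add power2_eq_square algebra_simps)
qed

text \<open>Two passes over the scheme. The first shows that positions differ by at most \<open>E = O(t^(k+2))\<close>; the
  smallness \<open>K t\<^sup>2 \<le> 1/2\<close> absorbs the feedback of the separation through the Lipschitz force. The
  second replaces the force difference by \<open>s^k / k!\<close> times \<open>q = p x\<close>, frozen at the initial position, from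
  which the trajectory moves by at most \<open>t (|v| + K)\<close>.\<close>

lemma discrete_flow_separation:
  fixes F1 F2 :: "real \<Rightarrow> real ^ 'n \<Rightarrow> real ^ 'n" and w :: "real ^ 'n \<Rightarrow> real" and p :: "real ^ 'n \<Rightarrow> real ^ 'n"
  assumes t: "0 < t" "t \<le> 1" "K * t\<^sup>2 \<le> 1 / 2" and N: "N > 0"
    and K: "K \<ge> 0" and B: "B \<ge> 0" and W: "W \<ge> 0"
    and F2: "\<And>s x. s \<in> {0..<t} \<Longrightarrow> norm (F2 s x) \<le> K"
    and F1L: "\<And>s x y. s \<in> {0..<t} \<Longrightarrow> norm (F1 s x - F1 s y) \<le> K * norm (x - y)"
    and diff: "\<And>s x. s \<in> {0..<t} \<Longrightarrow> norm (F1 s x - F2 s x - (s ^ k / fact k) *\<^sub>R p x) \<le> B * s ^ Suc k"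
    and p: "\<And>x. norm (p x) \<le> W" "\<And>x y. norm (p x - p y) \<le> W * norm (x - y)"
    and w: "\<And>x y. \<bar>w x - w y - p y \<bullet> (x - y)\<bar> \<le> W * (norm (x - y))\<^sup>2"
  shows "\<bar>w (fst (discrete_flow (t / N) F1 N z)) - w (fst (discrete_flow (t / N) F2 N z))
      - drift_sum k (t / N) N * (norm (p (fst z)))\<^sup>2\<bar>
    \<le> W * (2 * (W + B) * (1 + K) + (2 * K * (W + B) + B + W * (1 + K)) + 4 * (W + B)\<^sup>2)
      * t ^ (k + 3) * (1 + norm (snd z))"
proof -
  define \<delta> where "\<delta> = t / N"
  have \<delta>: "\<delta> > 0" "N * \<delta> = t" using t N by (simp_all add: \<delta>_def)
  have mt: "m * \<delta> \<le> t" if "m \<le> N" for m :: nat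
  proof -
    have "m * \<delta> \<le> N * \<delta>" using that \<delta>(1) by (intro mult_right_mono) auto
    then show ?thesis using \<delta> by simp
  qed
  have times: "m * \<delta> \<in> {0..<t}" if "m < N" for m :: nat
  proof -
    have "m * \<delta> < N * \<delta>" using that \<delta>(1) by (intro mult_strict_right_mono) auto
    then show ?thesis using \<delta> by simp
  qed
  define X where "X m = fst (discrete_flow \<delta> F1 m z)" for m
  define Y where "Y m = fst (discrete_flow \<delta> F2 m z)" for m
  define dv where "dv m = snd (discrete_flow \<delta> F1 m z) - snd (discrete_flow \<delta> F2 m z)" for m
  define dx where "dx m = X m - Y m" for m
  define q where "q = p (fst z)"
  define a where "a m = F1 (m * \<delta>) (X m) - F2 (m * \<delta>) (Y m)" for m :: nat
  have dv_Suc: "dv (Suc m) = dv m + \<delta> *\<^sub>R a m" for m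
    by (simp add: dv_def a_def X_def Y_def kick_drift_def algebra_simps)
  have dx_Suc: "dx (Suc m) = dx m + \<delta> *\<^sub>R dv (Suc m)" for m
    by (simp add: dx_def dv_def X_def Y_def kick_drift_def algebra_simps)
  have zero: "dv 0 = 0" "dx 0 = 0" by (simp_all add: dv_def dx_def X_def Y_def)
  define G where "G = W + B"
  have G: "G \<ge> 0" using W B by (simp add: G_def)
  \<comment> \<open>Twice the bound that holds without feedback, leaving room for the feedback term \<open>K t\<^sup>2 E\<close>.\<close>
  define E where "E = 2 * G * t ^ (k + 2)"
  have E: "E \<ge> 0" using G t by (simp add: E_def)
  have spow: "(m * \<delta>) ^ j \<le> t ^ j" if "m \<le> N" for m j :: nat
    using mt[OF that] \<delta> by (intro power_mono) auto
  have fact1: "r / fact k \<le> r" if "r \<ge> 0" for r :: real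
    using mult_left_mono[OF fact_ge_1[of k] that] by (simp add: divide_le_eq)
  have diff1: "norm (F1 (m * \<delta>) x - F2 (m * \<delta>) x) \<le> G * t ^ k" if m: "m < N" for m x
  proof -
    have "norm (F1 (m * \<delta>) x - F2 (m * \<delta>) x) \<le>
        norm (F1 (m * \<delta>) x - F2 (m * \<delta>) x - ((m * \<delta>) ^ k / fact k) *\<^sub>R p x) + norm (((m * \<delta>) ^ k / fact k) *\<^sub>R p x)"
      using norm_triangle_ineq[of "F1 (m * \<delta>) x - F2 (m * \<delta>) x - ((m * \<delta>) ^ k / fact k) *\<^sub>R p x" "((m * \<delta>) ^ k / fact k) *\<^sub>R p x"]
      by simp
    also have "\<dots> \<le> B * (m * \<delta>) ^ Suc k + t ^ k * W"
    proof (rule add_mono[OF diff[OF times[OF m]]])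
      have "(m * \<delta>) ^ k / fact k \<le> t ^ k"
        using fact1[of "(m * \<delta>) ^ k"] spow[of m k] m \<delta> by simp
      then show "norm (((m * \<delta>) ^ k / fact k) *\<^sub>R p x) \<le> t ^ k * W"
        using p(1)[of x] \<delta> t by (simp only: norm_scaleR) (intro mult_mono; simp)
    qed
    also have "B * (m * \<delta>) ^ Suc k \<le> B * t ^ k"
    proof (rule mult_left_mono[OF _ B])
      have "(m * \<delta>) ^ Suc k \<le> t ^ Suc k" using spow[of m "Suc k"] m by simp
      also have "\<dots> \<le> t ^ k" using t by (simp add: mult_left_le_one_le)
      finally show "(m * \<delta>) ^ Suc k \<le> t ^ k" .
    qed
    finally show ?thesis by (simp add: G_def algebra_simps)
  qed
  define H where "H = G * t ^ k + K * E"
  have H: "H \<ge> 0" using G K E t by (simp add: H_def)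
  have tH: "t * (t * H) \<le> E"
  proof -
    have "t * (t * H) = G * t ^ (k + 2) + (K * t\<^sup>2) * E"
      by (simp add: H_def power_add power2_eq_square algebra_simps)
    also have "\<dots> \<le> G * t ^ (k + 2) + (1 / 2) * E" using t E by (intro add_left_mono mult_right_mono) auto
    also have "\<dots> = E" by (simp add: E_def)
    finally show ?thesis .
  qed
  have crude: "norm (dv m) \<le> m * \<delta> * H \<and> norm (dx m) \<le> m * \<delta> * (t * H)" if "m \<le> N" for m
    using that
  proof (induction m)
    case 0
    then show ?case by (simp add: zero)
  next
    case (Suc m)
    then have m: "m < N" and IH: "norm (dv m) \<le> m * \<delta> * H" "norm (dx m) \<le> m * \<delta> * (t * H)" by auto
    have "m * \<delta> * (t * H) \<le> t * (t * H)" using mt[of m] m H t by (intro mult_right_mono) auto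
    then have dxE: "norm (dx m) \<le> E" using IH(2) tH by linarith
    have "norm (a m) \<le> norm (F1 (m * \<delta>) (X m) - F1 (m * \<delta>) (Y m)) + norm (F1 (m * \<delta>) (Y m) - F2 (m * \<delta>) (Y m))"
      using norm_triangle_ineq[of "F1 (m * \<delta>) (X m) - F1 (m * \<delta>) (Y m)" "F1 (m * \<delta>) (Y m) - F2 (m * \<delta>) (Y m)"]
      by (simp add: a_def)
    also have "\<dots> \<le> K * norm (dx m) + G * t ^ k"
      unfolding dx_def by (intro add_mono F1L times m diff1)
    also have "\<dots> \<le> H" using mult_left_mono[OF dxE K] by (simp add: H_def)
    finally have "norm (\<delta> *\<^sub>R a m) \<le> \<delta> * H" using \<delta> by (simp add: mult_left_mono)
    then have v: "norm (dv (Suc m)) \<le> Suc m * \<delta> * H"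
      unfolding dv_Suc using IH(1) norm_triangle_ineq[of "dv m" "\<delta> *\<^sub>R a m"] by (simp add: algebra_simps)
    also have "\<dots> \<le> t * H" using mt[OF Suc.prems] H by (intro mult_right_mono) auto
    finally have "norm (\<delta> *\<^sub>R dv (Suc m)) \<le> \<delta> * (t * H)" using \<delta> by (simp add: mult_left_mono)
    then have "norm (dx (Suc m)) \<le> Suc m * \<delta> * (t * H)"
      unfolding dx_Suc using IH(2) norm_triangle_ineq[of "dx m" "\<delta> *\<^sub>R dv (Suc m)"] by (simp add: algebra_simps)
    with v show ?case by blast
  qed
  have dxE: "norm (dx m) \<le> E" if "m \<le> N" for m
  proof -
    have "m * \<delta> * (t * H) \<le> t * (t * H)" using mt[OF that] H t by (intro mult_right_mono) auto
    then show ?thesis using crude[OF that] tH by linarith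
  qed
  define V where "V = norm (snd z) + K"
  have V: "V \<ge> 0" using K by (simp add: V_def)
  have Yx: "norm (Y m - fst z) \<le> t * V" if "m \<le> N" for m
  proof -
    have "norm (Y m - fst z) \<le> m * \<delta> * (norm (snd z) + m * \<delta> * K)"
      unfolding Y_def by (rule discrete_flow_bounds(2)) (use F2 times that \<delta> K in auto)
    also have "\<dots> \<le> t * (norm (snd z) + 1 * K)"
      using mt[OF that] t \<delta> K by (intro mult_mono add_left_mono mult_right_mono) auto
    finally show ?thesis by (simp add: V_def)
  qed
  have pY: "norm (p (Y m) - q) \<le> W * (t * V)" if "m \<le> N" for m
    using p(2)[of "Y m" "fst z"] mult_left_mono[OF Yx[OF that] W] by (simp add: q_def)
  define Q where "Q = 2 * K * G + B + W * V"
  have Q: "Q \<ge> 0" using K G B W V by (simp add: Q_def)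
  have am: "norm (a m - ((m * \<delta>) ^ k / fact k) *\<^sub>R q) \<le> t ^ (k + 1) * Q" if m: "m < N" for m
  proof -
    let ?s = "m * \<delta>" let ?c = "(m * \<delta>) ^ k / fact k"
    have eq: "a m - ?c *\<^sub>R q = (F1 ?s (X m) - F1 ?s (Y m)) + (F1 ?s (Y m) - F2 ?s (Y m) - ?c *\<^sub>R p (Y m)) + ?c *\<^sub>R (p (Y m) - q)"
      by (simp add: a_def algebra_simps)
    have 1: "norm (F1 ?s (X m) - F1 ?s (Y m)) \<le> K * E"
      using F1L[OF times[OF m], of "X m" "Y m"] mult_left_mono[OF dxE[of m] K] m by (simp add: dx_def)
    have 2: "norm (F1 ?s (Y m) - F2 ?s (Y m) - ?c *\<^sub>R p (Y m)) \<le> B * t ^ (k + 1)"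
      using diff[OF times[OF m], of "Y m"] mult_left_mono[OF spow[of m "Suc k"] B] m by simp
    have 3: "norm (?c *\<^sub>R (p (Y m) - q)) \<le> t ^ k * (W * (t * V))"
    proof -
      have "?c \<le> t ^ k" using fact1[of "?s ^ k"] spow[of m k] m \<delta> by simp
      then show ?thesis using pY[of m] m \<delta> t by (simp only: norm_scaleR) (intro mult_mono; simp)
    qed
    have "E = 2 * G * t ^ (k + 1) * t" by (simp add: E_def)
    also have "\<dots> \<le> 2 * G * t ^ (k + 1) * 1" using t G by (intro mult_left_mono) auto
    finally have "K * E \<le> K * (2 * G * t ^ (k + 1))" using K by (intro mult_left_mono) auto
    then have "norm (a m - ?c *\<^sub>R q) \<le> K * (2 * G * t ^ (k + 1)) + B * t ^ (k + 1) + t ^ k * (W * (t * V))"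
      unfolding eq using 1 2 3
      by (meson add_mono norm_triangle_mono order_trans)
    then show ?thesis by (simp add: Q_def algebra_simps)
  qed
  have fine: "norm (dv m - kick_sum k \<delta> m *\<^sub>R q) \<le> m * \<delta> * (t ^ (k + 1) * Q) \<and>
      norm (dx m - drift_sum k \<delta> m *\<^sub>R q) \<le> m * \<delta> * (t ^ (k + 2) * Q)" if "m \<le> N" for m
    using that
  proof (induction m)
    case 0
    then show ?case by (simp add: zero kick_sum_def drift_sum_def)
  next
    case (Suc m)
    then have m: "m < N" and IH: "norm (dv m - kick_sum k \<delta> m *\<^sub>R q) \<le> m * \<delta> * (t ^ (k + 1) * Q)"
      "norm (dx m - drift_sum k \<delta> m *\<^sub>R q) \<le> m * \<delta> * (t ^ (k + 2) * Q)" by auto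
    have eqv: "dv (Suc m) - kick_sum k \<delta> (Suc m) *\<^sub>R q =
        (dv m - kick_sum k \<delta> m *\<^sub>R q) + \<delta> *\<^sub>R (a m - ((m * \<delta>) ^ k / fact k) *\<^sub>R q)"
      by (simp add: dv_Suc kick_sum_def algebra_simps)
    have "norm (\<delta> *\<^sub>R (a m - ((m * \<delta>) ^ k / fact k) *\<^sub>R q)) \<le> \<delta> * (t ^ (k + 1) * Q)"
      using am[OF m] \<delta> by (simp only: norm_scaleR abs_of_pos) (intro mult_left_mono; simp)
    then have "norm (dv (Suc m) - kick_sum k \<delta> (Suc m) *\<^sub>R q) \<le> m * \<delta> * (t ^ (k + 1) * Q) + \<delta> * (t ^ (k + 1) * Q)"
      unfolding eqv using IH(1) by (intro norm_triangle_mono)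
    then have v: "norm (dv (Suc m) - kick_sum k \<delta> (Suc m) *\<^sub>R q) \<le> Suc m * \<delta> * (t ^ (k + 1) * Q)"
      by (simp add: algebra_simps)
    also have "\<dots> \<le> t * (t ^ (k + 1) * Q)" using mt[OF Suc.prems] Q t by (intro mult_right_mono) auto
    finally have "norm (\<delta> *\<^sub>R (dv (Suc m) - kick_sum k \<delta> (Suc m) *\<^sub>R q)) \<le> \<delta> * (t ^ (k + 2) * Q)"
      using \<delta> by (simp only: norm_scaleR abs_of_pos) (intro mult_left_mono; simp)
    moreover have "dx (Suc m) - drift_sum k \<delta> (Suc m) *\<^sub>R q =
        (dx m - drift_sum k \<delta> m *\<^sub>R q) + \<delta> *\<^sub>R (dv (Suc m) - kick_sum k \<delta> (Suc m) *\<^sub>R q)"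
      by (simp add: dx_Suc drift_sum_def algebra_simps)
    ultimately have "norm (dx (Suc m) - drift_sum k \<delta> (Suc m) *\<^sub>R q) \<le> m * \<delta> * (t ^ (k + 2) * Q) + \<delta> * (t ^ (k + 2) * Q)"
      using IH(2) norm_triangle_mono by metis
    then have "norm (dx (Suc m) - drift_sum k \<delta> (Suc m) *\<^sub>R q) \<le> Suc m * \<delta> * (t ^ (k + 2) * Q)"
      by (simp add: algebra_simps)
    with v show ?case by blast
  qed
  have dxN: "norm (dx N - drift_sum k \<delta> N *\<^sub>R q) \<le> t ^ (k + 3) * Q"
    using fine[of N] \<delta>(2) by (simp add: numeral_3_eq_3 numeral_2_eq_2 mult.assoc)
  have tE: "t * E \<le> t ^ (k + 3) * (2 * G)" by (simp add: E_def power_add numeral_3_eq_3 power2_eq_square)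
  have EE: "E\<^sup>2 \<le> t ^ (k + 3) * (4 * G\<^sup>2)"
  proof -
    have "t ^ (2 * k + 4) \<le> t ^ (k + 3)" using t by (intro power_decreasing) auto
    moreover have "E\<^sup>2 = t ^ (2 * k + 4) * (4 * G\<^sup>2)"
    proof -
      have "(k + 2) * 2 = 2 * k + 4" by simp
      then have "(t ^ (k + 2))\<^sup>2 = t ^ (2 * k + 4)" by (simp only: power_mult[symmetric])
      then show ?thesis by (simp add: E_def power_mult_distrib)
    qed
    ultimately show ?thesis by (simp add: mult_right_mono)
  qed
  have "\<bar>w (X N) - w (Y N) - drift_sum k \<delta> N * (norm q)\<^sup>2\<bar> \<le>
      \<bar>w (X N) - w (Y N) - p (Y N) \<bullet> dx N\<bar> + \<bar>(p (Y N) - q) \<bullet> dx N\<bar> + \<bar>q \<bullet> (dx N - drift_sum k \<delta> N *\<^sub>R q)\<bar>"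
    by (simp add: inner_diff_left inner_diff_right power2_norm_eq_inner)
  also have "\<dots> \<le> W * E\<^sup>2 + W * (t * V) * E + W * (t ^ (k + 3) * Q)"
  proof (intro add_mono)
    have "(norm (dx N))\<^sup>2 \<le> E\<^sup>2" using dxE[of N] by (intro power_mono) auto
    then show "\<bar>w (X N) - w (Y N) - p (Y N) \<bullet> dx N\<bar> \<le> W * E\<^sup>2"
      using w[of "X N" "Y N"] mult_left_mono[OF _ W] by (fastforce simp: dx_def)
    have "norm (p (Y N) - q) * norm (dx N) \<le> W * (t * V) * E"
      using pY[of N] dxE[of N] W V t by (intro mult_mono) auto
    then show "\<bar>(p (Y N) - q) \<bullet> dx N\<bar> \<le> W * (t * V) * E"
      using Cauchy_Schwarz_ineq2[of "p (Y N) - q" "dx N"] by linarith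
    have "norm q * norm (dx N - drift_sum k \<delta> N *\<^sub>R q) \<le> W * (t ^ (k + 3) * Q)"
      using p(1) dxN W unfolding q_def by (intro mult_mono) auto
    then show "\<bar>q \<bullet> (dx N - drift_sum k \<delta> N *\<^sub>R q)\<bar> \<le> W * (t ^ (k + 3) * Q)"
      using Cauchy_Schwarz_ineq2[of q "dx N - drift_sum k \<delta> N *\<^sub>R q"] by linarith
  qed
  also have "\<dots> \<le> W * (t ^ (k + 3) * (4 * G\<^sup>2)) + W * V * (t ^ (k + 3) * (2 * G)) + W * (t ^ (k + 3) * Q)"
  proof -
    have "W * V * (t * E) \<le> W * V * (t ^ (k + 3) * (2 * G))" using tE W V by (intro mult_left_mono) auto
    then have "W * (t * V) * E \<le> W * V * (t ^ (k + 3) * (2 * G))" by (simp add: ac_simps)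
    then show ?thesis using mult_left_mono[OF EE W] by linarith
  qed
  also have "\<dots> = W * (2 * G * V + Q + 4 * G\<^sup>2) * t ^ (k + 3)" by (simp add: algebra_simps)
  also have "\<dots> \<le> W * ((2 * G * (1 + K) + (2 * K * G + B + W * (1 + K)) + 4 * G\<^sup>2) * (1 + norm (snd z))) * t ^ (k + 3)"
  proof (intro mult_right_mono mult_left_mono)
    define n where "n = norm (snd z)"
    have n: "n \<ge> 0" by (simp add: n_def)
    have V': "V \<le> (1 + K) * (1 + n)" using K n by (simp add: V_def n_def algebra_simps)
    have "2 * G * V \<le> 2 * G * ((1 + K) * (1 + n))" using V' G by (intro mult_left_mono) auto
    moreover have "W * V \<le> W * ((1 + K) * (1 + n))" using V' W by (intro mult_left_mono) auto
    moreover have "(2 * K * G + B + 4 * G\<^sup>2) * 1 \<le> (2 * K * G + B + 4 * G\<^sup>2) * (1 + n)"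
      using K G B n by (intro mult_left_mono) auto
    ultimately show "2 * G * V + Q + 4 * G\<^sup>2 \<le> (2 * G * (1 + K) + (2 * K * G + B + W * (1 + K)) + 4 * G\<^sup>2) * (1 + norm (snd z))"
      unfolding n_def[symmetric] Q_def by (simp add: algebra_simps)
  qed (use W t in auto)
  finally show ?thesis
    by (simp add: X_def Y_def \<delta>_def q_def G_def ac_simps)
qed

section \<open>Equal densities force the leading order of the field difference to vanish\<close>

lemma C2_periodic_bounds:
  fixes w :: "real ^ 'n \<Rightarrow> real"
  assumes C2: "Ck_on 2 UNIV w" and per: "torus_periodic w"
  obtains W where "W \<ge> 0" "\<And>x. norm (grad w x) \<le> W"
    "\<And>x y. norm (grad w x - grad w y) \<le> W * norm (x - y)"
    "\<And>x y. \<bar>w x - w y - grad w y \<bullet> (x - y)\<bar> \<le> W * (norm (x - y))\<^sup>2"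
proof -
  have C2': "Ck_on (Suc (Suc 0)) UNIV w" using C2 by (simp add: numeral_2_eq_2)
  obtain B0 where B0: "B0 \<ge> 0" "\<And>x. norm (grad w x) \<le> B0"
    using torus_periodic_bounded[OF torus_periodic_grad[OF per] continuous_on_grad[OF C2']] by metis
  have "\<exists>B\<ge>0. \<forall>x y. \<bar>partial_deriv i w x - partial_deriv i w y\<bar> \<le> B * norm (x - y)" for i
    using C1_periodic_Lipschitz[OF Ck_partial_deriv[OF C2'] torus_periodic_partial_deriv[OF per]] by metis
  then obtain Bi where Bi: "\<And>i. Bi i \<ge> 0"
    "\<And>i x y. \<bar>partial_deriv i w x - partial_deriv i w y\<bar> \<le> Bi i * norm (x - y)" by metis
  define W where "W = B0 + (\<Sum>i\<in>UNIV. Bi i)"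
  have W0: "W \<ge> 0" using B0 Bi by (simp add: W_def sum_nonneg)
  have WB: "B0 \<le> W" "(\<Sum>i\<in>UNIV. Bi i) \<le> W" using B0 Bi by (simp_all add: W_def sum_nonneg)
  have Lip: "norm (grad w x - grad w y) \<le> W * norm (x - y)" for x y
  proof -
    have "norm (grad w x - grad w y) \<le> (\<Sum>i\<in>UNIV. \<bar>(grad w x - grad w y) $ i\<bar>)" by (rule norm_le_l1_cart)
    also have "\<dots> \<le> (\<Sum>i\<in>UNIV. Bi i * norm (x - y))"
      by (rule sum_mono) (simp add: grad_def Bi(2))
    also have "\<dots> = (\<Sum>i\<in>UNIV. Bi i) * norm (x - y)" by (simp add: sum_distrib_right)
    also have "\<dots> \<le> W * norm (x - y)" using WB by (intro mult_right_mono) auto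
    finally show ?thesis .
  qed
  have quad: "\<bar>w x - w y - grad w y \<bullet> (x - y)\<bar> \<le> W * (norm (x - y))\<^sup>2" for x y
  proof -
    have "norm (w x - w y - grad w y \<bullet> (x - y)) \<le> norm (x - y) * (W * norm (x - y))"
    proof (rule differentiable_bound_linearization[where S = "closed_segment y x" and f' = "\<lambda>z h. grad w z \<bullet> h"])
      show "y + t *\<^sub>R (x - y) \<in> closed_segment y x" if "t \<in> {0..1}" for t
        using that by (auto simp: closed_segment_def algebra_simps intro!: exI[of _ t])
      show "(w has_derivative (\<bullet>) (grad w z)) (at z within closed_segment y x)" for z
        using Ck_has_grad[OF C2'] by (rule has_derivative_at_withinI)
      show "onorm ((\<bullet>) (grad w z) - (\<bullet>) (grad w y)) \<le> W * norm (x - y)" if z: "z \<in> closed_segment y x" for z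
      proof (rule onorm_le)
        fix h :: "real ^ 'n"
        have "norm (z - y) \<le> norm (x - y)" using segment_bound1[OF z] by simp
        then have "norm (grad w z - grad w y) \<le> W * norm (x - y)"
          using Lip[of z y] mult_left_mono[OF _ W0] by fastforce
        then have "norm (grad w z - grad w y) * norm h \<le> W * norm (x - y) * norm h"
          by (rule mult_right_mono) simp
        then show "norm (((\<bullet>) (grad w z) - (\<bullet>) (grad w y)) h) \<le> W * norm (x - y) * norm h"
          using Cauchy_Schwarz_ineq2[of "grad w z - grad w y" h] by (simp add: inner_diff_left)
      qed
    qed auto
    then show ?thesis by (simp add: power2_eq_square mult.left_commute)
  qed
  show thesis
    by (rule that[OF W0 _ Lip quad]) (use B0 WB order_trans in blast)
qed

lemma negligible_imp_AE_lborel: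
  assumes "negligible (N :: 'a::euclidean_space set)"
  shows "AE x in lborel. x \<notin> N"
proof -
  have "N \<in> null_sets (completion lborel)" using assms by (simp add: negligible_iff_null_sets)
  then obtain N' where "N' \<in> null_sets lborel" "N \<subseteq> N'"
    by (auto simp: null_sets_completion_iff2)
  then show ?thesis by (auto intro: AE_I')
qed

lemma AE_torus_imp_everywhere:
  fixes p :: "real ^ 'n \<Rightarrow> 'b::real_normed_vector"
  assumes "AE x in torus_measure. p x = 0" "continuous_on UNIV p" "torus_periodic p"
  shows "p x = 0"
proof (rule ccontr)
  assume "p x \<noteq> 0"
  then obtain y where y: "y \<in> torus_cell" "p y \<noteq> 0" using torus_periodic_ex_cell[OF assms(3)] by metis
  let ?U = "{x. p x \<noteq> 0}" and ?B = "box 0 (\<chi> i. 2 * pi) :: (real ^ 'n) set"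
  have U: "open ?U"
    by (rule open_Collect_neq[OF assms(2)]) (rule continuous_on_const)
  have ne: "?B \<noteq> {}" by (simp add: interval_ne_empty_cart)
  have "y \<in> closure ?B" using y(1) closure_box[OF ne] by (simp add: torus_cell_def)
  then have "?U \<inter> ?B \<noteq> {}"
    using open_Int_closure_eq_empty[OF U, of ?B] y(2) by blast
  moreover have "open (?U \<inter> ?B)" using U by (intro open_Int open_box)
  ultimately have "\<not> negligible (?U \<inter> ?B)" using open_not_negligible by blast
  moreover have "negligible (?U \<inter> ?B)"
  proof -
    have "AE x in lborel. x \<in> torus_cell \<longrightarrow> p x = 0"
      using assms(1) unfolding torus_measure_def by (subst (asm) AE_density) (auto simp: indicator_def split: if_splits)
    then have "AE x in lborel. x \<notin> ?U \<inter> ?B"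
      by eventually_elim (use box_subset_cbox in \<open>auto simp: torus_cell_def\<close>)
    moreover have "?U \<inter> ?B \<in> sets lborel" using U by (auto intro: borel_open)
    ultimately have "?U \<inter> ?B \<in> null_sets lborel" by (simp add: AE_iff_null_sets)
    then show ?thesis using negligible_iff_null_sets null_sets_completionI by blast
  qed
  ultimately show False by blast
qed

text \<open>The heart of the proof: test the equality of the densities against \<open>w\<close> and compare powers of \<open>t\<close>. For
  fixed \<open>t\<close> the number \<open>N\<close> of steps is chosen so large that the discretisation error is below
  \<open>t^(k+3)\<close>, and divisible by 3 so that the lower bound for the drift applies; then \<open>t\<close> tends to 0.\<close>

lemma grad_eq_0_if_equal_densities:
  fixes w :: "real ^ 'n \<Rightarrow> real"
  assumes S1: "transport_solution T K A F1 f1" and S2: "transport_solution T K A F2 f2"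
    and init: "f1 0 = f0" "f2 0 = f0" and nonneg: "\<And>x v. f0 x v \<ge> 0"
    and nodal: "negligible {x \<in> torus_cell. spatial_density f0 x = 0}"
    and dens: "\<And>t x. t \<in> {0..<T} \<Longrightarrow> spatial_density (f1 t) x = spatial_density (f2 t) x"
    and Lip: "\<And>s x y. s \<in> {0..<T} \<Longrightarrow> norm (F1 s x - F1 s y) \<le> K * norm (x - y)"
    and diff: "\<And>s x. s \<in> {0..<T} \<Longrightarrow> norm (F1 s x - F2 s x - (s ^ k / fact k) *\<^sub>R grad w x) \<le> B * s ^ Suc k"
    and B: "B \<ge> 0" and C2: "Ck_on 2 UNIV w" and per: "torus_periodic w"
  shows "grad w x = 0"
proof -
  interpret S1: transport_solution T K A F1 f1 by (rule S1)
  interpret S2: transport_solution T K A F2 f2 by (rule S2)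
  note T = S1.T and K0 = S1.K_nonneg and A0 = S1.A_nonneg
  have C2': "Ck_on (Suc (Suc 0)) UNIV w" using C2 by (simp add: numeral_2_eq_2)
  obtain W where W: "W \<ge> 0" "\<And>x. norm (grad w x) \<le> W"
    "\<And>x y. norm (grad w x - grad w y) \<le> W * norm (x - y)"
    "\<And>x y. \<bar>w x - w y - grad w y \<bullet> (x - y)\<bar> \<le> W * (norm (x - y))\<^sup>2"
    using C2_periodic_bounds[OF C2 per] by metis
  have wc: "continuous_on UNIV w" using C2 by (rule Ck_on_imp_continuous_on)
  obtain c where c: "\<And>x. \<bar>w x\<bar> \<le> c" using torus_periodic_bounded[OF per wc] by (metis real_norm_def)
  have c0: "c \<ge> 0" using c[of 0] by linarith
  have gc: "continuous_on UNIV (\<lambda>x. (norm (grad w x))\<^sup>2)"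
    by (intro continuous_intros continuous_on_grad[OF C2'])
  have gb: "\<bar>(norm (grad w x))\<^sup>2\<bar> \<le> W\<^sup>2" for x using W(2)[of x] by (simp add: power_mono)
  have zT: "0 \<in> {0..T}" using T by simp
  define vol where "vol = measure (torus_measure :: (real ^ 'n) measure) UNIV"
  have vol0: "vol \<ge> 0" by (simp add: vol_def)
  define I where "I = (\<integral>z. (norm (grad w (fst z)))\<^sup>2 * f0 (fst z) (snd z) \<partial>phase_measure)"
  have iI: "integrable phase_measure (\<lambda>z. (norm (grad w (fst z)))\<^sup>2 * f0 (fst z) (snd z))"
    using S1.integral_against_density(1)[OF zT gc gb] init by simp
  have I_density: "I = (\<integral>x. (norm (grad w x))\<^sup>2 * spatial_density f0 x \<partial>torus_measure)"
    using S1.integral_against_density(2)[OF zT gc gb] init by (simp add: I_def)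
  have I0: "I \<ge> 0" unfolding I_def by (rule integral_nonneg_AE) (simp add: nonneg)
  define Q where "Q = W * (2 * (W + B) * (1 + K) + (2 * K * (W + B) + B + W * (1 + K)) + 4 * (W + B)\<^sup>2)"
  have Q0: "Q \<ge> 0" using W(1) B K0 by (simp add: Q_def)
  define c1 where "c1 = (1 / 3 :: real) ^ (k + 2) / fact k"
  have c1: "c1 > 0" by (simp add: c1_def)
  have est: "c1 * I \<le> (2 + Q * (A * vol)) * t" if t: "0 < t" "t \<le> 1" "t < T" "K * t\<^sup>2 \<le> 1 / 2" for t
  proof -
    have tT: "t \<in> {0..T}" "t \<le> T" using t by auto
    have e: "t ^ (k + 3) > 0" using t by simp
    obtain N1 where N1: "N1 > 0"
      "\<And>N. N \<ge> N1 \<Longrightarrow> \<bar>(\<integral>z. w (fst z) * f1 t (fst z) (snd z) \<partial>phase_measure) -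
      (\<integral>z. w (fst (discrete_flow (t / of_nat N) F1 N z)) * f1 0 (fst z) (snd z) \<partial>phase_measure)\<bar> \<le> t ^ (k + 3)"
      using S1.discrete_flow_approximation[OF t(1) tT(2) wc per c e] by blast
    obtain N2 where N2: "N2 > 0"
      "\<And>N. N \<ge> N2 \<Longrightarrow> \<bar>(\<integral>z. w (fst z) * f2 t (fst z) (snd z) \<partial>phase_measure) -
      (\<integral>z. w (fst (discrete_flow (t / of_nat N) F2 N z)) * f2 0 (fst z) (snd z) \<partial>phase_measure)\<bar> \<le> t ^ (k + 3)"
      using S2.discrete_flow_approximation[OF t(1) tT(2) wc per c e] by blast
    define q where "q = N1 + N2"
    define N where "N = 3 * q"
    have N: "N > 0" "N \<ge> N1" "N \<ge> N2" "q > 0" using N1(1) by (auto simp: N_def q_def)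
    define \<delta> where "\<delta> = t / real N"
    have \<delta>: "\<delta> > 0" using t N by (simp add: \<delta>_def)
    define J1 where "J1 = (\<integral>z. w (fst (discrete_flow \<delta> F1 N z)) * f0 (fst z) (snd z) \<partial>phase_measure)"
    define J2 where "J2 = (\<integral>z. w (fst (discrete_flow \<delta> F2 N z)) * f0 (fst z) (snd z) \<partial>phase_measure)"
    have "(\<integral>z. w (fst z) * f1 t (fst z) (snd z) \<partial>phase_measure) = (\<integral>z. w (fst z) * f2 t (fst z) (snd z) \<partial>phase_measure)"
      unfolding S1.integral_against_density(2)[OF tT(1) wc c] S2.integral_against_density(2)[OF tT(1) wc c]
      using dens[of t] t by simp
    then have J: "\<bar>J1 - J2\<bar> \<le> 2 * t ^ (k + 3)"
      using N1(2)[OF N(2)] N2(2)[OF N(3)] by (simp add: J1_def J2_def \<delta>_def init)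
    have times: "real m * \<delta> \<in> {0..T}" if "m < N" for m
    proof -
      have "real m * \<delta> \<le> real N * \<delta>" using that \<delta> by (intro mult_right_mono) auto
      then show ?thesis using \<delta> tT N by (simp add: \<delta>_def)
    qed
    have fm: "discrete_flow \<delta> F1 N \<in> borel_measurable borel" "discrete_flow \<delta> F2 N \<in> borel_measurable borel"
      by (rule discrete_flow_measurable, rule borel_measurable_continuous_onI, use times S1.F_cont S2.F_cont in blast)+
    have wfst: "(\<lambda>z :: (real ^ 'n) \<times> (real ^ 'n). w (fst z)) \<in> borel_measurable borel"
      by (intro borel_measurable_continuous_onI continuous_on_compose2[OF wc] continuous_intros) auto
    have wm: "(\<lambda>z. w (fst (discrete_flow \<delta> F1 N z))) \<in> borel_measurable borel"
      "(\<lambda>z. w (fst (discrete_flow \<delta> F2 N z))) \<in> borel_measurable borel"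
      using measurable_comp[OF fm(1) wfst] measurable_comp[OF fm(2) wfst] by (simp_all add: comp_def)
    have bd: "\<bar>w x\<bar> \<le> c * (1 + norm v)" for x v :: "real ^ 'n"
    proof -
      have "c * 1 \<le> c * (1 + norm v)" using c0 by (intro mult_left_mono) auto
      then show ?thesis using c[of x] by linarith
    qed
    have iJ: "integrable phase_measure (\<lambda>z. w (fst (discrete_flow \<delta> F1 N z)) * f0 (fst z) (snd z))"
      "integrable phase_measure (\<lambda>z. w (fst (discrete_flow \<delta> F2 N z)) * f0 (fst z) (snd z))"
      using S1.f_weighted_integrable[OF zT wm(1) bd] S1.f_weighted_integrable[OF zT wm(2) bd] init by simp_all
    define S where "S = drift_sum k \<delta> N"
    let ?h = "\<lambda>z. w (fst (discrete_flow \<delta> F1 N z)) * f0 (fst z) (snd z) - w (fst (discrete_flow \<delta> F2 N z)) * f0 (fst z) (snd z)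
        - S * ((norm (grad w (fst z)))\<^sup>2 * f0 (fst z) (snd z))"
    let ?b = "\<lambda>z. Q * t ^ (k + 3) * ((1 + norm (snd z)) * \<bar>f0 (fst z) (snd z)\<bar>)"
    have ih: "integrable phase_measure ?h"
      by (intro Bochner_Integration.integrable_diff iJ integrable_mult_right iI)
    have ib: "integrable phase_measure ?b"
      using S1.f_moment_integrable(1)[OF zT] init by (intro integrable_mult_right) simp
    have "norm (?h z) \<le> ?b z" for z
    proof -
      have "\<bar>w (fst (discrete_flow \<delta> F1 N z)) - w (fst (discrete_flow \<delta> F2 N z)) - S * (norm (grad w (fst z)))\<^sup>2\<bar>
          \<le> Q * t ^ (k + 3) * (1 + norm (snd z))"
        unfolding S_def Q_def \<delta>_def
        by (rule discrete_flow_separation[OF t(1,2,4) N(1) K0 B W(1)])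
          (use t S2.F_bound Lip diff W in auto)
      then have "\<bar>w (fst (discrete_flow \<delta> F1 N z)) - w (fst (discrete_flow \<delta> F2 N z)) - S * (norm (grad w (fst z)))\<^sup>2\<bar> * \<bar>f0 (fst z) (snd z)\<bar>
          \<le> Q * t ^ (k + 3) * (1 + norm (snd z)) * \<bar>f0 (fst z) (snd z)\<bar>" by (rule mult_right_mono) simp
      then show ?thesis by (simp only: abs_mult[symmetric] real_norm_def left_diff_distrib mult.assoc)
    qed
    then have "\<bar>\<integral>z. ?h z \<partial>phase_measure\<bar> \<le> (\<integral>z. ?b z \<partial>phase_measure)"
      using Bochner_Integration.integral_norm_bound_integral[OF ih ib] by simp
    also have "(\<integral>z. ?h z \<partial>phase_measure) = J1 - J2 - S * I"
      using iJ iI by (simp add: J1_def J2_def I_def)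
    also have "(\<integral>z. ?b z \<partial>phase_measure) = Q * t ^ (k + 3) * (\<integral>z. (1 + norm (snd z)) * \<bar>f0 (fst z) (snd z)\<bar> \<partial>phase_measure)"
      by (rule integral_mult_right_zero)
    also have "\<dots> \<le> Q * t ^ (k + 3) * (A * vol)"
      using S1.f_moment_integrable(2)[OF zT] init Q0 e by (intro mult_left_mono) (auto simp: vol_def)
    finally have "S * I \<le> 2 * t ^ (k + 3) + Q * t ^ (k + 3) * (A * vol)" using J by linarith
    moreover have "t ^ (k + 2) * c1 \<le> S"
    proof -
      have q\<delta>: "real q * \<delta> = t / 3" using N by (simp add: \<delta>_def N_def)
      have "t ^ (k + 2) * c1 = (t / 3) ^ (k + 2) / fact k" by (simp add: c1_def power_divide)
      then show ?thesis
        using drift_sum_lower_bound[of \<delta> q k] \<delta> unfolding q\<delta> S_def N_def by simp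
    qed
    then have "t ^ (k + 2) * c1 * I \<le> S * I" using I0 by (intro mult_right_mono)
    ultimately have "t ^ (k + 2) * (c1 * I) \<le> t ^ (k + 2) * ((2 + Q * (A * vol)) * t)"
      by (simp add: power_add numeral_3_eq_3 numeral_2_eq_2 algebra_simps)
    then show ?thesis using t by (simp add: mult_le_cancel_left)
  qed
  \<comment> \<open>Times below \<open>t0\<close> satisfy the smallness conditions of the separation estimate and lie below \<open>T\<close>,
    where the densities are known to agree.\<close>
  define t0 where "t0 = min 1 (min (T / 2) (1 / (2 * K + 1)))"
  have t0: "t0 > 0" "t0 \<le> 1" "t0 < T" using T K0 by (auto simp: t0_def)
  have small: "K * t\<^sup>2 \<le> 1 / 2" if "0 < t" "t \<le> t0" for t
  proof -
    have "t \<le> 1" "t \<le> 1 / (2 * K + 1)" using that by (auto simp: t0_def)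
    then have "t\<^sup>2 \<le> 1 / (2 * K + 1)" using that by (simp add: power2_eq_square) (meson mult_left_le order_trans less_imp_le)
    then have "K * t\<^sup>2 \<le> K * (1 / (2 * K + 1))" using K0 by (rule mult_left_mono)
    also have "\<dots> \<le> 1 / 2" using K0 by (simp add: field_simps)
    finally show ?thesis .
  qed
  have "c1 * I \<le> 0 + e" if e: "e > 0" for e
  proof -
    define M where "M = 2 + Q * (A * vol)"
    have M: "M > 0" using Q0 A0 vol0 by (simp add: M_def add_pos_nonneg)
    define t where "t = min t0 (e / M)"
    have t: "0 < t" "t \<le> t0" "M * t \<le> e" using t0 e M by (auto simp: t_def min_def field_simps)
    then show ?thesis using est[of t] small[of t] t0 by (simp add: M_def)
  qed
  then have "c1 * I \<le> 0" by (rule field_le_epsilon)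
  then have I00: "I = 0" using c1 I0 by (simp add: mult_le_0_iff)
  have dn: "spatial_density f0 x \<ge> 0" for x
    unfolding spatial_density_def by (rule integral_nonneg_AE) (simp add: nonneg)
  have "AE x in torus_measure. (norm (grad w x))\<^sup>2 * spatial_density f0 x = 0"
    using I00 unfolding I_density
    using integral_nonneg_eq_0_iff_AE[OF S1.integral_against_density(3)[OF zT gc gb, unfolded init]] dn by simp
  moreover have "AE x in torus_measure. x \<notin> {x \<in> torus_cell. spatial_density f0 x = 0}"
    using negligible_imp_AE_lborel[OF nodal] unfolding torus_measure_def
    by (subst AE_density) auto
  ultimately have "AE x in torus_measure. grad w x = 0"
    using AE_torus_measure by eventually_elim auto
  then show ?thesis
    by (rule AE_torus_imp_everywhere[OF _ continuous_on_grad[OF C2'] torus_periodic_grad[OF per]])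
qed

section \<open>Time derivatives of smooth functions on a time slab\<close>

lemma Ck_on_slice:
  fixes G :: "real \<times> 'b::real_normed_vector \<Rightarrow> real"
  assumes "Ck_on k ({0..T} \<times> UNIV) G" "t \<in> {0..T}"
  shows "Ck_on k UNIV (\<lambda>y. G (t, y))"
proof -
  have "bounded_linear (\<lambda>y :: 'b. (0 :: real, y))"
    by (intro bounded_linear_Pair bounded_linear_zero bounded_linear_ident)
  from Ck_on_compose_affine[OF this _ assms(1), of "(t, 0)"] assms(2)
  show ?thesis by simp
qed

lemma time_deriv_cong:
  assumes "\<And>s. s \<in> {0..T} \<Longrightarrow> f s = g s" "t \<in> {0..T}"
  shows "time_deriv T f t = time_deriv T g t"
proof -
  have "(f has_vector_derivative d) (at t within {0..T}) \<longleftrightarrow> (g has_vector_derivative d) (at t within {0..T})" for d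
    using assms by (metis has_vector_derivative_transform)
  then show ?thesis by (simp add: time_deriv_def vector_derivative_def)
qed

lemma time_deriv_eqI:
  assumes "T > 0" "t \<in> {0..T}" "(f has_field_derivative d) (at t within {0..T})"
  shows "time_deriv T f t = d"
  unfolding time_deriv_def
  using assms by (intro vector_derivative_within_closed_interval)
    (auto simp: has_real_derivative_iff_has_vector_derivative)

lemma continuous_on_axis [continuous_intros]:
  fixes h :: "'a::topological_space \<Rightarrow> real"
  assumes "continuous_on X h"
  shows "continuous_on X (\<lambda>p. axis i (h p) :: real ^ 'n)"
proof -
  have "continuous_on X (\<lambda>p. h p *\<^sub>R (axis i 1 :: real ^ 'n))" by (intro continuous_intros assms)
  then show ?thesis by (rule continuous_on_eq) (rule axis_scaleR[symmetric])
qed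

text \<open>Time derivatives are one-sided at 0, where the commutation is needed, so it is derived from the
  Leibniz rule: differentiate in time the integral of the space derivative along a segment, and then
  differentiate with respect to the end point of the segment.\<close>

lemma partial_deriv_time_deriv_commute:
  fixes G :: "real \<times> (real ^ 'n) \<Rightarrow> real"
  assumes T: "T > 0" and t: "t \<in> {0..T}" and G: "Ck_on 2 ({0..T} \<times> UNIV) G"
  shows "partial_deriv i (\<lambda>x. time_deriv T (\<lambda>s. G (s, x)) t) x =
    time_deriv T (\<lambda>s. partial_deriv i (\<lambda>x. G (s, x)) x) t"
proof -
  let ?S = "{0..T} \<times> (UNIV :: (real ^ 'n) set)"
  have G2: "Ck_on (Suc (Suc 0)) ?S G" using G by (simp add: numeral_2_eq_2)
  define P where "P s y = time_deriv T (\<lambda>s. G (s, y)) s" for s y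
  define Q where "Q s y = partial_deriv i (\<lambda>x. G (s, x)) y" for s y
  have Q_line: "Q s y = line_deriv (0, axis i 1) G (s, y)" for s y
    by (simp add: Q_def partial_deriv_eq_line_deriv line_deriv_def)
  have Q1: "Ck_on (Suc 0) ?S (\<lambda>(s, y). Q s y)"
  proof -
    have "(\<lambda>(s, y). Q s y) = line_deriv (0, axis i 1) G" by (auto simp: Q_line)
    moreover have "Ck_on (Suc 0) ?S (line_deriv (0, axis i 1) G)"
      by (rule Ck_line_deriv[OF G2]) auto
    ultimately show ?thesis by (simp only:)
  qed
  have P1: "Ck_on (Suc 0) ?S (\<lambda>(s, y). P s y)"
    using Ck_time_deriv[OF T G2] by (simp add: P_def)
  define R where "R s y = time_deriv T (\<lambda>s. Q s y) s" for s y
  have R0: "continuous_on ?S (\<lambda>(s, y). R s y)"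
    using Ck_time_deriv[OF T Q1] by (simp add: R_def)
  have dQ: "((\<lambda>s. Q s y) has_field_derivative R s y) (at s within {0..T})" if "s \<in> {0..T}" for s y
    using Ck_has_time_deriv[OF T that Q1, of y] by (simp add: R_def)
  have dG: "((\<lambda>s. G (s, y)) has_field_derivative P s y) (at s within {0..T})" if "s \<in> {0..T}" for s y
    using Ck_has_time_deriv[OF T that G2, of y] by (simp add: P_def)
  have Gx: "((\<lambda>r. G (s, y + axis i r)) has_field_derivative Q s (y + axis i r)) (at r)" if "s \<in> {0..T}" for s y r
    using Ck_has_partial_deriv[OF Ck_on_slice[OF G2 that], where x = y and i = i and s = r] by (simp add: Q_def)
  have FTC: "((\<lambda>r. Q s (x + axis i r)) has_integral G (s, x + axis i \<sigma>) - G (s, x)) {0..\<sigma>}"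
    if "s \<in> {0..T}" "\<sigma> \<ge> 0" for s \<sigma>
  proof -
    have "((\<lambda>r. Q s (x + axis i r)) has_integral G (s, x + axis i \<sigma>) - G (s, x + axis i 0)) {0..\<sigma>}"
    proof (rule fundamental_theorem_of_calculus[OF that(2), where f = "\<lambda>r. G (s, x + axis i r)"])
      fix r
      show "((\<lambda>r. G (s, x + axis i r)) has_vector_derivative Q s (x + axis i r)) (at r within {0..\<sigma>})"
        by (rule has_vector_derivative_at_within)
          (use Gx[OF that(1), of x r] in \<open>simp add: has_real_derivative_iff_has_vector_derivative\<close>)
    qed
    then show ?thesis by simp
  qed
  have key: "integral {0..\<sigma>} (\<lambda>r. R t (x + axis i r)) = P t (x + axis i \<sigma>) - P t x" if \<sigma>: "\<sigma> \<ge> 0" for \<sigma>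
  proof -
    have "((\<lambda>s. integral (cbox 0 \<sigma>) (\<lambda>r. Q s (x + axis i r))) has_field_derivative
        integral (cbox 0 \<sigma>) (\<lambda>r. R t (x + axis i r))) (at t within {0..T})"
    proof (rule leibniz_rule_field_derivative[where f = "\<lambda>s r. Q s (x + axis i r)" and fx = "\<lambda>s r. R s (x + axis i r)"])
      show "((\<lambda>s. Q s (x + axis i r)) has_field_derivative R s (x + axis i r)) (at s within {0..T})"
        if "s \<in> {0..T}" for s r by (rule dQ[OF that])
      show "(\<lambda>r. Q s (x + axis i r)) integrable_on cbox 0 \<sigma>" if "s \<in> {0..T}" for s
        using FTC[OF that \<sigma>] by auto
      show "continuous_on ({0..T} \<times> cbox 0 \<sigma>) (\<lambda>(s, r). R s (x + axis i r))"
      proof -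
        have "continuous_on ({0..T} \<times> cbox 0 \<sigma>) (\<lambda>p. (case (fst p, x + axis i (snd p)) of (s, y) \<Rightarrow> R s y))"
          by (rule continuous_on_compose2[OF R0, where f = "\<lambda>p. (fst p, x + axis i (snd p))"])
            (intro continuous_intros, auto)
        then show ?thesis by (simp add: split_beta')
      qed
    qed (use t in auto)
    moreover have "((\<lambda>s. G (s, x + axis i \<sigma>) - G (s, x)) has_field_derivative P t (x + axis i \<sigma>) - P t x) (at t within {0..T})"
      by (intro DERIV_diff dG t)
    then have "((\<lambda>s. integral (cbox 0 \<sigma>) (\<lambda>r. Q s (x + axis i r))) has_field_derivative P t (x + axis i \<sigma>) - P t x) (at t within {0..T})"
      unfolding has_field_derivative_def
      by (rule has_derivative_transform[OF t, rotated]) (use integral_unique[OF FTC[OF _ \<sigma>]] in simp)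
    ultimately show ?thesis using time_deriv_eqI[OF T t] by (metis cbox_interval)
  qed
  have "continuous_on {0..1} (\<lambda>r. case (t, x + axis i r) of (s, y) \<Rightarrow> R s y)"
    by (rule continuous_on_compose2[OF R0, where f = "\<lambda>r. (t, x + axis i r)"])
      (intro continuous_intros, use t in auto)
  then have "continuous_on {0..1} (\<lambda>r. R t (x + axis i r))" by simp
  then have "((\<lambda>\<sigma>. integral {0..\<sigma>} (\<lambda>r. R t (x + axis i r))) has_vector_derivative R t (x + axis i 0)) (at 0 within {0..1})"
    by (rule integral_has_vector_derivative) auto
  then have "((\<lambda>\<sigma>. P t (x + axis i \<sigma>) - P t x) has_vector_derivative R t x) (at 0 within {0..1})"
    using has_vector_derivative_transform[of 0 "{0..1}" "\<lambda>\<sigma>. P t (x + axis i \<sigma>) - P t x"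
      "\<lambda>\<sigma>. integral {0..\<sigma>} (\<lambda>r. R t (x + axis i r))"] key by simp
  moreover have "((\<lambda>\<sigma>. P t (x + axis i \<sigma>) - P t x) has_vector_derivative partial_deriv i (P t) x) (at 0 within {0..1})"
  proof -
    have "((\<lambda>\<sigma>. P t (x + axis i \<sigma>)) has_field_derivative partial_deriv i (P t) x) (at 0)"
      using Ck_has_partial_deriv[OF Ck_on_slice[OF P1 t], where x = x and i = i and s = 0] by simp
    then have "((\<lambda>\<sigma>. P t (x + axis i \<sigma>) - P t x) has_field_derivative partial_deriv i (P t) x - 0) (at 0)"
      by (intro DERIV_diff DERIV_const)
    then show ?thesis
      by (simp add: has_real_derivative_iff_has_vector_derivative has_vector_derivative_at_within)
  qed
  ultimately have "partial_deriv i (P t) x = R t x"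
    using vector_derivative_within_closed_interval[of 0 1 0 "\<lambda>\<sigma>. P t (x + axis i \<sigma>) - P t x" "R t x"]
      vector_derivative_within_closed_interval[of 0 1 0 "\<lambda>\<sigma>. P t (x + axis i \<sigma>) - P t x" "partial_deriv i (P t) x"]
    by simp
  then show ?thesis by (simp add: P_def[abs_def] R_def Q_def)
qed

lemma Cinf_torus_Ck: "Cinf_torus T V \<Longrightarrow> Ck_on k ({0..T} \<times> UNIV) (\<lambda>p. V (fst p) (snd p))"
  unfolding Cinf_torus_def Cinf_on_def by (simp add: split_beta')

lemma Cinf_torusI:
  assumes "\<And>t. t \<in> {0..T} \<Longrightarrow> torus_periodic (V t)" "\<And>k. Ck_on k ({0..T} \<times> UNIV) (\<lambda>p. V (fst p) (snd p))"
  shows "Cinf_torus T V"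
  using assms unfolding Cinf_torus_def Cinf_on_def by (simp add: split_beta')

lemma Cinf_torus_periodic: "Cinf_torus T V \<Longrightarrow> t \<in> {0..T} \<Longrightarrow> torus_periodic (V t)"
  by (simp add: Cinf_torus_def)

lemma Cinf_torus_slice: "Cinf_torus T V \<Longrightarrow> t \<in> {0..T} \<Longrightarrow> Ck_on k UNIV (V t)"
  using Ck_on_slice[OF Cinf_torus_Ck, of T V t k] by simp

lemma Cinf_torus_bounded:
  assumes "Cinf_torus T V"
  shows "\<exists>B\<ge>0. \<forall>s\<in>{0..T}. \<forall>x. \<bar>V s x\<bar> \<le> B"
proof -
  have "continuous_on ({0..T} \<times> UNIV) (\<lambda>p. V (fst p) (snd p))"
    using Cinf_torus_Ck[OF assms, of 0] by simp
  then have "compact ((\<lambda>p. V (fst p) (snd p)) ` ({0..T} \<times> torus_cell))"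
    by (intro compact_continuous_image compact_Times compact_torus_cell) (auto elim: continuous_on_subset)
  then obtain B where B: "B > 0" "\<And>y. y \<in> (\<lambda>p. V (fst p) (snd p)) ` ({0..T} \<times> torus_cell) \<Longrightarrow> norm y \<le> B"
    by (meson bounded_pos compact_imp_bounded)
  have "\<bar>V s x\<bar> \<le> B" if s: "s \<in> {0..T}" for s x
  proof -
    obtain y where y: "y \<in> torus_cell" "V s y = V s x"
      by (rule torus_periodic_ex_cell[OF Cinf_torus_periodic[OF assms s]])
    have "V s y \<in> (\<lambda>p. V (fst p) (snd p)) ` ({0..T} \<times> torus_cell)"
      using s y(1) by (intro image_eqI[of _ _ "(s, y)"]) auto
    from B(2)[OF this] y(2) show ?thesis by simp
  qed
  then show ?thesis using B(1) by (auto intro!: exI[of _ B])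
qed

lemma Cinf_torus_diff:
  assumes "Cinf_torus T V1" "Cinf_torus T V2"
  shows "Cinf_torus T (\<lambda>t x. V1 t x - V2 t x)"
proof (rule Cinf_torusI)
  show "torus_periodic (\<lambda>x. V1 t x - V2 t x)" if "t \<in> {0..T}" for t
    using Cinf_torus_periodic[OF assms(1) that] Cinf_torus_periodic[OF assms(2) that]
    by (simp add: torus_periodic_def)
  show "Ck_on k ({0..T} \<times> UNIV) (\<lambda>p. V1 (fst p) (snd p) - V2 (fst p) (snd p))" for k
    by (rule Ck_on_diff[OF Cinf_torus_Ck[OF assms(1)] Cinf_torus_Ck[OF assms(2)]])
qed

lemma Cinf_torus_partial_deriv:
  assumes "Cinf_torus T V"
  shows "Cinf_torus T (\<lambda>t. partial_deriv i (V t))"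
proof (rule Cinf_torusI)
  show "torus_periodic (partial_deriv i (V t))" if "t \<in> {0..T}" for t
    using assms that by (intro torus_periodic_partial_deriv Cinf_torus_periodic)
  show "Ck_on k ({0..T} \<times> UNIV) (\<lambda>p. partial_deriv i (V (fst p)) (snd p))" for k
    using Ck_line_deriv[OF Cinf_torus_Ck[OF assms, of "Suc k"], of "(0, axis i 1)"]
    by (auto simp: partial_deriv_eq_line_deriv line_deriv_def[abs_def])
qed

lemma Cinf_torus_time_deriv:
  assumes T: "T > 0" and V: "Cinf_torus T V"
  shows "Cinf_torus T (\<lambda>t x. time_deriv T (\<lambda>s. V s x) t)"
proof (rule Cinf_torusI)
  show "torus_periodic (\<lambda>x. time_deriv T (\<lambda>s. V s x) t)" if t: "t \<in> {0..T}" for t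
    unfolding torus_periodic_def
    by (intro allI time_deriv_cong t) (use Cinf_torus_periodic[OF V] in \<open>auto simp: torus_periodic_def\<close>)
  show "Ck_on k ({0..T} \<times> UNIV) (\<lambda>p. time_deriv T (\<lambda>s. V s (snd p)) (fst p))" for k
    using Ck_time_deriv[OF T Cinf_torus_Ck[OF V, of "Suc k"]] by (simp add: split_beta')
qed

lemma Cinf_torus_funpow_time_deriv:
  assumes T: "T > 0" and V: "Cinf_torus T V"
  shows "Cinf_torus T (\<lambda>t x. (time_deriv T ^^ k) (\<lambda>s. V s x) t)"
  by (induction k) (use V Cinf_torus_time_deriv[OF T] in auto)

lemma partial_deriv_funpow_time_deriv_commute:
  assumes T: "T > 0" and V: "Cinf_torus T V" and t: "t \<in> {0..T}"
  shows "partial_deriv i (\<lambda>x. (time_deriv T ^^ k) (\<lambda>s. V s x) t) x =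
    (time_deriv T ^^ k) (\<lambda>s. partial_deriv i (V s) x) t"
  using t
proof (induction k arbitrary: t)
  case 0
  then show ?case by simp
next
  case (Suc k)
  have "partial_deriv i (\<lambda>x. time_deriv T (\<lambda>s. (time_deriv T ^^ k) (\<lambda>s. V s x) s) t) x =
    time_deriv T (\<lambda>s. partial_deriv i (\<lambda>x. (time_deriv T ^^ k) (\<lambda>s. V s x) s) x) t"
    using partial_deriv_time_deriv_commute[OF T Suc.prems Cinf_torus_Ck[OF Cinf_torus_funpow_time_deriv[OF T V, of k]], of i x]
    by simp
  also have "\<dots> = time_deriv T ((time_deriv T ^^ k) (\<lambda>s. partial_deriv i (V s) x)) t"
    by (rule time_deriv_cong[OF Suc.IH Suc.prems])
  finally show ?case by simp
qed

text \<open>Taylor's formula in time for each partial derivative in space, with a remainder that is uniform in \<open>x\<close> by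
  periodicity.\<close>

lemma grad_time_Taylor:
  assumes T: "T > 0" and V: "Cinf_torus T V"
    and vanish: "\<And>j x. j < k \<Longrightarrow> grad (\<lambda>x. (time_deriv T ^^ j) (\<lambda>s. V s x) 0) x = 0"
  obtains B where "B \<ge> 0" "\<And>s x. s \<in> {0..T} \<Longrightarrow>
    norm (grad (V s) x - (s ^ k / fact k) *\<^sub>R grad (\<lambda>x. (time_deriv T ^^ k) (\<lambda>s. V s x) 0) x) \<le> B * s ^ Suc k"
proof -
  have zT: "0 \<in> {0..T}" using T by simp
  define D where "D i j s x = (time_deriv T ^^ j) (\<lambda>s. partial_deriv i (V s) x) s" for i j s x
  have DC: "Cinf_torus T (D i j)" for i j
    unfolding D_def[abs_def] by (rule Cinf_torus_funpow_time_deriv[OF T Cinf_torus_partial_deriv[OF V]])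
  have "\<exists>B\<ge>0. \<forall>s\<in>{0..T}. \<forall>x. \<bar>D i (Suc k) s x\<bar> \<le> B" for i
    by (rule Cinf_torus_bounded[OF DC])
  then obtain B where B: "\<And>i. B i \<ge> 0" "\<And>i s x. s \<in> {0..T} \<Longrightarrow> \<bar>D i (Suc k) s x\<bar> \<le> B i" by metis
  have D0: "D i j 0 x = grad (\<lambda>x. (time_deriv T ^^ j) (\<lambda>s. V s x) 0) x $ i" for i j x
    using partial_deriv_funpow_time_deriv_commute[OF T V zT, of i j x] by (simp add: D_def grad_def)
  have comp: "\<bar>D i 0 s x - s ^ k / fact k * D i k 0 x\<bar> \<le> B i * s ^ Suc k" if s: "s \<in> {0..T}" for i s x
  proof -
    have "norm (D i 0 s x - (\<Sum>j\<le>k. D i j 0 x * (s - 0) ^ j / fact j)) \<le> B i * norm (s - 0) ^ Suc k / fact k"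
    proof (rule field_Taylor[where S = "{0..T}" and f = "\<lambda>j s. D i j s x"])
      show "((\<lambda>s. D i j s x) has_field_derivative D i (Suc j) s x) (at s within {0..T})" if "s \<in> {0..T}" for j s
        using Ck_has_time_deriv[OF T that Cinf_torus_Ck[OF DC[of i j], of "Suc 0"], of x] by (simp add: D_def)
    qed (use s zT B in auto)
    also have "(\<Sum>j\<le>k. D i j 0 x * (s - 0) ^ j / fact j) = (\<Sum>j\<le>k. if j = k then D i k 0 x * s ^ k / fact k else 0)"
      by (rule sum.cong) (auto simp: D0 vanish)
    also have "\<dots> = s ^ k / fact k * D i k 0 x" by simp
    also have "B i * norm (s - 0) ^ Suc k / fact k \<le> B i * s ^ Suc k"
    proof -
      have "B i * s ^ Suc k * 1 \<le> B i * s ^ Suc k * fact k"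
        using B(1)[of i] s by (intro mult_left_mono fact_ge_1) auto
      then show ?thesis using s by (simp add: divide_le_eq)
    qed
    finally show ?thesis by simp
  qed
  show thesis
  proof (rule that[of "\<Sum>i\<in>UNIV. B i"])
    show "(\<Sum>i\<in>UNIV. B i) \<ge> 0" by (simp add: B sum_nonneg)
    fix s x assume s: "s \<in> {0..T}"
    let ?d = "grad (V s) x - (s ^ k / fact k) *\<^sub>R grad (\<lambda>x. (time_deriv T ^^ k) (\<lambda>s. V s x) 0) x"
    have "norm ?d \<le> (\<Sum>i\<in>UNIV. \<bar>?d $ i\<bar>)" by (rule norm_le_l1_cart)
    also have "\<dots> \<le> (\<Sum>i\<in>UNIV. B i * s ^ Suc k)"
    proof (rule sum_mono)
      fix i
      have "D i 0 s x = grad (V s) x $ i" by (simp add: D_def grad_def)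
      then have "?d $ i = D i 0 s x - s ^ k / fact k * D i k 0 x" by (simp add: D0)
      then show "\<bar>?d $ i\<bar> \<le> B i * s ^ Suc k" using comp[OF s] by metis
    qed
    finally show "norm ?d \<le> (\<Sum>i\<in>UNIV. B i) * s ^ Suc k" by (simp add: sum_distrib_right)
  qed
qed

lemma Cinf_torus_grad_bounds:
  fixes V :: "real \<Rightarrow> real ^ 'n \<Rightarrow> real"
  assumes V: "Cinf_torus T V"
  obtains K where "K \<ge> 0" "\<And>t x. t \<in> {0..T} \<Longrightarrow> norm (grad (V t) x) \<le> K"
    "\<And>t x y. t \<in> {0..T} \<Longrightarrow> norm (grad (V t) x - grad (V t) y) \<le> K * norm (x - y)"
proof -

  have "\<exists>B\<ge>0. \<forall>s\<in>{0..T}. \<forall>x. \<bar>partial_deriv i (V s) x\<bar> \<le> B" for i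
    by (rule Cinf_torus_bounded[OF Cinf_torus_partial_deriv[OF V]])
  then obtain B1 where B1: "\<And>i. B1 i \<ge> 0" "\<And>i s x. s \<in> {0..T} \<Longrightarrow> \<bar>partial_deriv i (V s) x\<bar> \<le> B1 i" by metis
  have "\<exists>B\<ge>0. \<forall>s\<in>{0..T}. \<forall>x. \<bar>partial_deriv j (partial_deriv i (V s)) x\<bar> \<le> B" for i j
    by (rule Cinf_torus_bounded[OF Cinf_torus_partial_deriv[OF Cinf_torus_partial_deriv[OF V]]])
  note ex = this
  define B2 where "B2 i j = (SOME B. B \<ge> 0 \<and> (\<forall>s\<in>{0..T}. \<forall>x. \<bar>partial_deriv j (partial_deriv i (V s)) x\<bar> \<le> B))" for i j
  have B2: "B2 i j \<ge> 0" "s \<in> {0..T} \<Longrightarrow> \<bar>partial_deriv j (partial_deriv i (V s)) x\<bar> \<le> B2 i j" for i j s x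
    using someI_ex[OF ex[of j i]] unfolding B2_def by blast+
  define K where "K = (\<Sum>i\<in>UNIV. B1 i) + (\<Sum>i\<in>UNIV. \<Sum>j\<in>UNIV. B2 i j)"
  have nn: "(\<Sum>i\<in>UNIV. B1 i) \<ge> 0" "(\<Sum>i\<in>UNIV. \<Sum>j\<in>UNIV. B2 i j) \<ge> 0"
    using B1 B2 by (simp_all add: sum_nonneg)
  show thesis
  proof (rule that[of K])
    show "K \<ge> 0" using nn by (simp add: K_def)
    fix t x assume t: "t \<in> {0..T}"
    have "norm (grad (V t) x) \<le> (\<Sum>i\<in>UNIV. \<bar>grad (V t) x $ i\<bar>)" by (rule norm_le_l1_cart)
    also have "\<dots> \<le> (\<Sum>i\<in>UNIV. B1 i)" by (rule sum_mono) (use B1(2)[OF t] in \<open>simp add: grad_def\<close>)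
    finally show "norm (grad (V t) x) \<le> K" using nn by (simp add: K_def)
    fix y
    have comp: "\<bar>partial_deriv i (V t) x - partial_deriv i (V t) y\<bar> \<le> (\<Sum>j\<in>UNIV. B2 i j) * norm (x - y)" for i
    proof (rule grad_bound_imp_Lipschitz)
      show "Ck_on (Suc 0) UNIV (partial_deriv i (V t))"
        by (rule Cinf_torus_slice[OF Cinf_torus_partial_deriv[OF V] t])
      fix z
      have "norm (grad (partial_deriv i (V t)) z) \<le> (\<Sum>j\<in>UNIV. \<bar>grad (partial_deriv i (V t)) z $ j\<bar>)" by (rule norm_le_l1_cart)
      also have "\<dots> \<le> (\<Sum>j\<in>UNIV. B2 i j)" by (rule sum_mono) (use B2(2)[OF t] in \<open>simp add: grad_def\<close>)
      finally show "norm (grad (partial_deriv i (V t)) z) \<le> (\<Sum>j\<in>UNIV. B2 i j)" .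
    qed
    have "norm (grad (V t) x - grad (V t) y) \<le> (\<Sum>i\<in>UNIV. \<bar>(grad (V t) x - grad (V t) y) $ i\<bar>)" by (rule norm_le_l1_cart)
    also have "\<dots> \<le> (\<Sum>i\<in>UNIV. (\<Sum>j\<in>UNIV. B2 i j) * norm (x - y))"
      by (rule sum_mono) (simp add: grad_def comp)
    also have "\<dots> = (\<Sum>i\<in>UNIV. \<Sum>j\<in>UNIV. B2 i j) * norm (x - y)" by (simp add: sum_distrib_right)
    also have "\<dots> \<le> K * norm (x - y)" using nn by (intro mult_right_mono) (auto simp: K_def)
    finally show "norm (grad (V t) x - grad (V t) y) \<le> K * norm (x - y)" .
  qed
qed

section \<open>Regularity of the density and of the self-consistent field\<close>

text \<open>The majorants in the moment bounds are only Lebesgue measurable, while the density is an integral with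
  respect to the Borel measure; continuity of the integrand allows passing between the two.\<close>

lemma lebesgue_dominated_bound:
  fixes g D :: "'a::euclidean_space \<Rightarrow> real"
  assumes g: "continuous_on UNIV g" and D: "integrable lebesgue D" and b: "\<And>v. \<bar>g v\<bar> \<le> c * D v"
  shows "integrable lborel g" and "\<bar>\<integral>v. g v \<partial>lborel\<bar> \<le> c * (\<integral>v. D v \<partial>lebesgue)"
    and "(\<integral>\<^sup>+ v. ennreal \<bar>g v\<bar> \<partial>lborel) \<le> ennreal (c * (\<integral>v. D v \<partial>lebesgue))"
proof -
  have gm: "g \<in> borel_measurable lborel" using g by (simp add: borel_measurable_continuous_onI)
  have cD: "integrable lebesgue (\<lambda>v. c * D v)" using D by simp
  have gl: "integrable lebesgue g"
    by (rule Bochner_Integration.integrable_bound[OF cD])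
      (use gm order_trans[OF b abs_ge_self] in \<open>auto intro: measurable_completion\<close>)
  then show int: "integrable lborel g" using integrable_completion[OF gm] by blast
  have "\<bar>\<integral>v. g v \<partial>lborel\<bar> = \<bar>\<integral>v. g v \<partial>lebesgue\<bar>" using integral_completion[OF gm] by simp
  also have "\<dots> \<le> (\<integral>v. \<bar>g v\<bar> \<partial>lebesgue)" by (rule integral_abs_bound)
  also have le: "\<dots> \<le> (\<integral>v. c * D v \<partial>lebesgue)" using gl cD b by (intro integral_mono) auto
  finally show "\<bar>\<integral>v. g v \<partial>lborel\<bar> \<le> c * (\<integral>v. D v \<partial>lebesgue)" by simp
  have "(\<integral>\<^sup>+ v. ennreal \<bar>g v\<bar> \<partial>lborel) = ennreal (\<integral>v. \<bar>g v\<bar> \<partial>lborel)"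
    using int by (intro nn_integral_eq_integral) auto
  also have "(\<integral>v. \<bar>g v\<bar> \<partial>lborel) = (\<integral>v. \<bar>g v\<bar> \<partial>lebesgue)"
    by (rule integral_completion[symmetric]) (use gm in measurable)
  finally show "(\<integral>\<^sup>+ v. ennreal \<bar>g v\<bar> \<partial>lborel) \<le> ennreal (c * (\<integral>v. D v \<partial>lebesgue))"
    using le by (simp add: ennreal_leI)
qed

lemma foldr_partial_deriv_le_tensor_norm:
  fixes "is" :: "'n::finite list"
  assumes "length is = k"
  shows "\<bar>foldr partial_deriv is g x\<bar> \<le> deriv_tensor_norm k g x"
proof -
  have "finite {is :: 'n list. length is = k}" using finite_lists_length_eq[of "UNIV :: 'n set" k] by simp
  then have "(foldr partial_deriv is g x)\<^sup>2 \<le> (\<Sum>is | length (is :: 'n list) = k. (foldr partial_deriv is g x)\<^sup>2)"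
    by (rule member_le_sum[where f = "\<lambda>is. (foldr partial_deriv is g x)\<^sup>2", rotated 2]) (use assms in auto)
  then show ?thesis unfolding deriv_tensor_norm_def by (intro real_le_rsqrt) simp
qed

lemma Cinf_phase_foldr_partial_deriv:
  fixes f :: "real \<Rightarrow> real ^ 'n \<Rightarrow> real ^ 'n \<Rightarrow> real"
  assumes "Cinf_phase T f"
  shows "Cinf_phase T (\<lambda>t x v. foldr partial_deriv is (\<lambda>y. f t y v) x)"
proof (induction "is")
  case Nil
  then show ?case using assms by simp
next
  case (Cons i "is")
  let ?g = "\<lambda>t x v. foldr partial_deriv is (\<lambda>y. f t y v) x"
  have "line_deriv (0, axis i 1, 0) (\<lambda>(t, x, v). ?g t x v) =
      (\<lambda>(t, x, v). partial_deriv i (foldr partial_deriv is (\<lambda>y. f t y v)) x)"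
    by (auto simp: line_deriv_def partial_deriv_eq_line_deriv)
  moreover have "Cinf_on ({0..T} \<times> UNIV \<times> UNIV) (line_deriv (0, axis i 1, 0) (\<lambda>(t, x, v). ?g t x v))"
    by (rule Cinf_line_deriv) (use Cons in \<open>auto simp: Cinf_phase_def\<close>)
  moreover have "torus_periodic (partial_deriv i (foldr partial_deriv is (\<lambda>y. f t y v)))" if "t \<in> {0..T}" for t v
    using Cons that by (intro torus_periodic_partial_deriv) (simp add: Cinf_phase_def)
  ultimately show ?case by (simp add: Cinf_phase_def)
qed

lemma Cinf_phase_bounded:
  fixes f :: "real \<Rightarrow> real ^ 'n \<Rightarrow> real ^ 'n \<Rightarrow> real"
  assumes f: "Cinf_phase T f"
  shows "\<exists>B\<ge>0. \<forall>t\<in>{0..T}. \<forall>x v. norm v \<le> 1 \<longrightarrow> \<bar>f t x v\<bar> \<le> B"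
proof -
  let ?G = "\<lambda>(t, x, v). f t x v"
  have "Ck_on 0 ({0..T} \<times> UNIV \<times> UNIV) ?G" using f by (auto simp: Cinf_phase_def Cinf_on_def)
  then have "continuous_on ({0..T} \<times> UNIV \<times> UNIV) ?G" by simp
  then have "compact (?G ` ({0..T} \<times> torus_cell \<times> cball 0 1))"
    by (intro compact_continuous_image compact_Times compact_torus_cell) (auto elim: continuous_on_subset)
  then obtain B where B: "B > 0" "\<And>y. y \<in> ?G ` ({0..T} \<times> torus_cell \<times> cball 0 1) \<Longrightarrow> norm y \<le> B"
    by (meson bounded_pos compact_imp_bounded)
  have "\<bar>f t x v\<bar> \<le> B" if t: "t \<in> {0..T}" and v: "norm v \<le> 1" for t x v
  proof -
    have "torus_periodic (\<lambda>x. f t x v)" using f t by (simp add: Cinf_phase_def)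
    then obtain y where y: "y \<in> torus_cell" "f t y v = f t x v" by (rule torus_periodic_ex_cell)
    have "?G (t, y, v) \<in> ?G ` ({0..T} \<times> torus_cell \<times> cball 0 1)"
      by (rule imageI) (use y t v in simp)
    from B(2)[OF this] y(2) show ?thesis by simp
  qed
  then show ?thesis using B(1) by (auto intro!: exI[of _ B])
qed

text \<open>For velocities at least 1 the weight in the moment bounds can be dropped; smaller velocities form a
  compact set, on which smooth functions are bounded.\<close>

lemma derivative_majorant:
  fixes f :: "real \<Rightarrow> real ^ 'n \<Rightarrow> real ^ 'n \<Rightarrow> real"
  assumes f: "Cinf_phase T f" and mb: "moment_bounds T f"
  obtains D where "integrable lebesgue D" "\<And>v. D v \<ge> 0"
    "\<And>is t x v. length is = k \<Longrightarrow> t \<in> {0..T} \<Longrightarrow> \<bar>foldr partial_deriv is (\<lambda>y. f t y v) x\<bar> \<le> D v"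
    "\<And>t x v. t \<in> {0..T} \<Longrightarrow> norm v ^ (k + 1) * deriv_tensor_norm k (\<lambda>y. f t y v) x \<le> D v"
proof -
  obtain C :: "real ^ 'n \<Rightarrow> real" where C: "integrable lebesgue C"
    "\<And>t x v. t \<in> {0..T} \<Longrightarrow> norm v ^ (k + 1) * deriv_tensor_norm k (\<lambda>y. f t y v) x \<le> C v"
    using mb unfolding moment_bounds_def by metis
  have "\<forall>is. \<exists>B\<ge>0. \<forall>t\<in>{0..T}. \<forall>x v. norm v \<le> 1 \<longrightarrow> \<bar>foldr partial_deriv is (\<lambda>y. f t y v) x\<bar> \<le> B"
    using Cinf_phase_bounded[OF Cinf_phase_foldr_partial_deriv[OF f]] by blast
  then obtain B :: "'n list \<Rightarrow> real" where B: "\<And>is. B is \<ge> 0"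
    "\<And>is t x v. t \<in> {0..T} \<Longrightarrow> norm v \<le> 1 \<Longrightarrow> \<bar>foldr partial_deriv is (\<lambda>y. f t y v) x\<bar> \<le> B is"
    by metis
  have fin: "finite {is :: 'n list. length is = k}" using finite_lists_length_eq[of "UNIV :: 'n set" k] by simp
  define M where "M = (\<Sum>is | length is = k. B is)"
  have M0: "M \<ge> 0" using B(1) by (simp add: M_def sum_nonneg)
  define D where "D v = \<bar>C v\<bar> + M * indicator (cball 0 1) v" for v
  show thesis
  proof (rule that[of D])
    have "integrable lebesgue (indicator (cball 0 1) :: real ^ 'n \<Rightarrow> real)"
      using emeasure_compact_finite[OF compact_cball, of "0 :: real ^ 'n" 1]
      by (intro integrable_real_indicator) simp_all
    then show "integrable lebesgue D" unfolding D_def[abs_def] using C(1) by (intro Bochner_Integration.integrable_add integrable_mult_right integrable_abs)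
    show "D v \<ge> 0" for v using M0 by (simp add: D_def)
    show "\<bar>foldr partial_deriv is (\<lambda>y. f t y v) x\<bar> \<le> D v" if l: "length is = k" and t: "t \<in> {0..T}" for "is" t x v
    proof (cases "norm v \<le> 1")
      case True
      have "B is \<le> M" unfolding M_def by (rule member_le_sum) (use l fin B in auto)
      then have "\<bar>foldr partial_deriv is (\<lambda>y. f t y v) x\<bar> \<le> M" using B(2)[OF t True, of "is" x] by linarith
      then show ?thesis using True by (simp add: D_def)
    next
      case False
      let ?d = "deriv_tensor_norm k (\<lambda>y. f t y v) x"
      have d0: "?d \<ge> 0" by (simp add: deriv_tensor_norm_def sum_nonneg)
      have "\<bar>foldr partial_deriv is (\<lambda>y. f t y v) x\<bar> \<le> ?d" by (rule foldr_partial_deriv_le_tensor_norm[OF l])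
      also have "\<dots> \<le> norm v ^ (k + 1) * ?d"
        using mult_right_mono[OF one_le_power[of "norm v" "k + 1"] d0] False by simp
      also have "\<dots> \<le> C v" by (rule C(2)[OF t])
      also have "\<dots> \<le> D v"
      proof -
        have "0 \<le> M * indicator (cball 0 1) v" using M0 by simp
        then show ?thesis unfolding D_def using abs_ge_self[of "C v"] by linarith
      qed
      finally show ?thesis .
    qed
    show "norm v ^ (k + 1) * deriv_tensor_norm k (\<lambda>y. f t y v) x \<le> D v" if t: "t \<in> {0..T}" for t x v
    proof -
      have "0 \<le> M * indicator (cball 0 1) v" using M0 by simp
      then show ?thesis using C(2)[OF t, of v x] by (simp add: D_def)
    qed
  qed
qed

lemma Cinf_phase_slice_x:
  fixes f :: "real \<Rightarrow> real ^ 'n \<Rightarrow> real ^ 'n \<Rightarrow> real"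
  assumes "Cinf_phase T f" "t \<in> {0..T}"
  shows "Ck_on k UNIV (\<lambda>x. f t x v)"
proof -
  have "bounded_linear (\<lambda>x :: real ^ 'n. (0 :: real, x, 0 :: real ^ 'n))"
    by (intro bounded_linear_Pair bounded_linear_zero bounded_linear_ident)
  moreover have "Ck_on k ({0..T} \<times> UNIV \<times> UNIV) (\<lambda>(t, x, v). f t x v)"
    using assms(1) by (auto simp: Cinf_phase_def Cinf_on_def)
  ultimately have "Ck_on k UNIV (\<lambda>x. (\<lambda>(t, x, v). f t x v) ((t, 0, v) + (0, x, 0)))"
    by (intro Ck_on_compose_affine) (use assms(2) in auto)
  then show ?thesis by simp
qed

lemma Cinf_phase_slice_v:
  fixes f :: "real \<Rightarrow> real ^ 'n \<Rightarrow> real ^ 'n \<Rightarrow> real"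
  assumes "Cinf_phase T f" "t \<in> {0..T}"
  shows "continuous_on UNIV (f t x)"
proof -
  have "bounded_linear (\<lambda>v :: real ^ 'n. (0 :: real, 0 :: real ^ 'n, v))"
    by (intro bounded_linear_Pair bounded_linear_zero bounded_linear_ident)
  moreover have "Ck_on 0 ({0..T} \<times> UNIV \<times> UNIV) (\<lambda>(t, x, v). f t x v)"
    using assms(1) by (auto simp: Cinf_phase_def Cinf_on_def)
  ultimately have "Ck_on 0 UNIV (\<lambda>v. (\<lambda>(t, x, v). f t x v) ((t, x, 0) + (0, 0, v)))"
    by (intro Ck_on_compose_affine) (use assms(2) in auto)
  then show ?thesis by simp
qed

lemma partial_bounds_imp_Lipschitz:
  fixes g :: "real ^ 'n \<Rightarrow> real"
  assumes g: "Ck_on (Suc k) UNIV g" and b: "\<And>i x. \<bar>partial_deriv i g x\<bar> \<le> D"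
  shows "\<bar>g x - g y\<bar> \<le> real CARD('n) * D * norm (x - y)"
proof (rule grad_bound_imp_Lipschitz[OF g])
  fix z
  have "norm (grad g z) \<le> (\<Sum>i\<in>UNIV. \<bar>grad g z $ i\<bar>)" by (rule norm_le_l1_cart)
  also have "\<dots> \<le> (\<Sum>i\<in>(UNIV :: 'n set). D)" by (rule sum_mono) (simp add: grad_def b)
  finally show "norm (grad g z) \<le> real CARD('n) * D" by simp
qed

text \<open>The moment bounds of orders 1 and 2 allow differentiating the density twice under the integral. The result
  is stated with first and second differences, which is how it enters the Poisson equation.\<close>

lemma density_regularity:
  fixes f :: "real \<Rightarrow> real ^ 'n \<Rightarrow> real ^ 'n \<Rightarrow> real"
  assumes f: "Cinf_phase T f" and mb: "moment_bounds T f"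
  obtains A M where "A \<ge> 0" "M \<ge> 0"
    "\<And>t x. t \<in> {0..T} \<Longrightarrow> (\<integral>\<^sup>+ v. ennreal ((1 + norm v) * \<bar>f t x v\<bar>) \<partial>lborel) \<le> ennreal A"
    "\<And>t x y. t \<in> {0..T} \<Longrightarrow> \<bar>spatial_density (f t) x - spatial_density (f t) y\<bar> \<le> M * norm (x - y)"
    "\<And>t x y h. t \<in> {0..T} \<Longrightarrow> \<bar>(spatial_density (f t) (x + h) - spatial_density (f t) x) -
        (spatial_density (f t) (y + h) - spatial_density (f t) y)\<bar> \<le> M * norm h * norm (x - y)"
proof -
  define d where "d = real CARD('n)"
  obtain D0 :: "real ^ 'n \<Rightarrow> real" where D0: "integrable lebesgue D0" "\<And>v. D0 v \<ge> 0"
    "\<And>is t x v. length is = 0 \<Longrightarrow> t \<in> {0..T} \<Longrightarrow> \<bar>foldr partial_deriv is (\<lambda>y. f t y v) x\<bar> \<le> D0 v"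
    "\<And>t x v. t \<in> {0..T} \<Longrightarrow> norm v ^ (0 + 1) * deriv_tensor_norm 0 (\<lambda>y. f t y v) x \<le> D0 v"
    by (rule derivative_majorant[OF f mb, where k = 0]) (rule that; assumption)
  obtain D1 :: "real ^ 'n \<Rightarrow> real" where D1: "integrable lebesgue D1" "\<And>v. D1 v \<ge> 0"
    "\<And>is t x v. length is = 1 \<Longrightarrow> t \<in> {0..T} \<Longrightarrow> \<bar>foldr partial_deriv is (\<lambda>y. f t y v) x\<bar> \<le> D1 v"
    by (rule derivative_majorant[OF f mb, where k = 1]) (rule that; assumption)
  obtain D2 :: "real ^ 'n \<Rightarrow> real" where D2: "integrable lebesgue D2" "\<And>v. D2 v \<ge> 0"
    "\<And>is t x v. length is = 2 \<Longrightarrow> t \<in> {0..T} \<Longrightarrow> \<bar>foldr partial_deriv is (\<lambda>y. f t y v) x\<bar> \<le> D2 v"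
    by (rule derivative_majorant[OF f mb, where k = 2]) (rule that; assumption)
  have b0: "\<bar>f t x v\<bar> \<le> D0 v" if "t \<in> {0..T}" for t x v using D0(3)[of "[]" t v x] that by simp
  have b0': "norm v * \<bar>f t x v\<bar> \<le> D0 v" if "t \<in> {0..T}" for t x v
    using D0(4)[of t v x] that by (simp add: deriv_tensor_norm_def)
  have b1: "\<bar>partial_deriv i (\<lambda>y. f t y v) x\<bar> \<le> D1 v" if "t \<in> {0..T}" for i t x v
    using D1(3)[of "[i]" t v x] that by simp
  have b2: "\<bar>partial_deriv j (partial_deriv i (\<lambda>y. f t y v)) x\<bar> \<le> D2 v" if "t \<in> {0..T}" for i j t x v
    using D2(3)[of "[j, i]" t v x] that by simp
  define I0 where "I0 = (\<integral>v. D0 v \<partial>lebesgue)"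
  define I1 where "I1 = (\<integral>v. D1 v \<partial>lebesgue)"
  define I2 where "I2 = (\<integral>v. D2 v \<partial>lebesgue)"
  have I: "I0 \<ge> 0" "I1 \<ge> 0" "I2 \<ge> 0"
    using D0(2) D1(2) D2(2) by (auto simp: I0_def I1_def I2_def intro: integral_nonneg_AE)
  note fc = Cinf_phase_slice_v[OF f]
  have fint: "integrable lborel (f t x)" if t: "t \<in> {0..T}" for t x
    by (rule lebesgue_dominated_bound(1)[OF fc[OF t] D0(1), of x 1]) (use b0[OF t] in simp)
  define M where "M = d * I1 + d * (d * I2)"
  have d0: "d \<ge> 0" by (simp add: d_def)
  have nn: "d * I1 \<ge> 0" "d * (d * I2) \<ge> 0" using I d0 by simp_all
  show thesis
  proof (rule that[of "2 * I0" M])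
    show "2 * I0 \<ge> 0" "M \<ge> 0" using I nn by (simp_all add: M_def)
    fix t x assume t: "t \<in> {0..T}"
    have "(\<integral>\<^sup>+ v. ennreal \<bar>(1 + norm v) * f t x v\<bar> \<partial>lborel) \<le> ennreal (2 * I0)"
      unfolding I0_def
    proof (rule lebesgue_dominated_bound(3)[OF _ D0(1)])
      show "continuous_on UNIV (\<lambda>v. (1 + norm v) * f t x v)" by (intro continuous_intros fc t)
      show "\<bar>(1 + norm v) * f t x v\<bar> \<le> 2 * D0 v" for v
        using b0[OF t, of x v] b0'[OF t, of v x] unfolding abs_mult by (simp add: distrib_right)
    qed
    then show "(\<integral>\<^sup>+ v. ennreal ((1 + norm v) * \<bar>f t x v\<bar>) \<partial>lborel) \<le> ennreal (2 * I0)"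
      by (simp add: abs_mult)
    fix y
    have "\<bar>spatial_density (f t) x - spatial_density (f t) y\<bar> = \<bar>\<integral>v. f t x v - f t y v \<partial>lborel\<bar>"
      using fint[OF t] by (simp add: spatial_density_def)
    also have "\<dots> \<le> (d * norm (x - y)) * I1"
      unfolding I1_def
    proof (rule lebesgue_dominated_bound(2)[OF _ D1(1)])
      show "continuous_on UNIV (\<lambda>v. f t x v - f t y v)" by (intro continuous_intros fc t)
      show "\<bar>f t x v - f t y v\<bar> \<le> d * norm (x - y) * D1 v" for v
        using partial_bounds_imp_Lipschitz[OF Cinf_phase_slice_x[OF f t, of "Suc 0"] b1[OF t], of x v y]
        by (simp add: d_def mult.commute mult.left_commute)
    qed
    also have "\<dots> = (d * I1) * norm (x - y)" by simp
    also have "\<dots> \<le> M * norm (x - y)" using nn by (intro mult_right_mono) (auto simp: M_def)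
    finally show "\<bar>spatial_density (f t) x - spatial_density (f t) y\<bar> \<le> M * norm (x - y)" .
    fix h
    have "\<bar>(spatial_density (f t) (x + h) - spatial_density (f t) x) - (spatial_density (f t) (y + h) - spatial_density (f t) y)\<bar>
      = \<bar>\<integral>v. (f t (x + h) v - f t x v) - (f t (y + h) v - f t y v) \<partial>lborel\<bar>"
      using fint[OF t] by (simp add: spatial_density_def)
    also have "\<dots> \<le> (d * d * norm h * norm (x - y)) * I2"
      unfolding I2_def
    proof (rule lebesgue_dominated_bound(2)[OF _ D2(1)])
      show "continuous_on UNIV (\<lambda>v. (f t (x + h) v - f t x v) - (f t (y + h) v - f t y v))" by (intro continuous_intros fc t)
      fix v
      let ?\<phi> = "\<lambda>x. f t x v"
      have \<phi>: "Ck_on k UNIV ?\<phi>" for k by (rule Cinf_phase_slice_x[OF f t])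
      have "\<bar>partial_deriv i (\<lambda>x. ?\<phi> (x + h) - ?\<phi> x) z\<bar> \<le> d * D2 v * norm h" for i z
      proof -
        have "grad (\<lambda>x. ?\<phi> (x + h) - ?\<phi> x) z = grad ?\<phi> (z + h) - grad ?\<phi> z"
          using grad_diff[OF Ck_on_shift[OF \<phi>, of "Suc 0" h] \<phi>[of "Suc 0"], of z]
          by (simp only: grad_shift[of "\<lambda>x. f t x v" h z])
        then have "partial_deriv i (\<lambda>x. ?\<phi> (x + h) - ?\<phi> x) z = partial_deriv i ?\<phi> (z + h) - partial_deriv i ?\<phi> z"
          by (simp add: grad_def vec_eq_iff)
        then show ?thesis
          using partial_bounds_imp_Lipschitz[OF Ck_partial_deriv[OF \<phi>[of "Suc (Suc 0)"]] b2[OF t], of i "z + h" z]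
          by (simp add: d_def)
      qed
      then show "\<bar>(f t (x + h) v - f t x v) - (f t (y + h) v - f t y v)\<bar> \<le> d * d * norm h * norm (x - y) * D2 v"
        using partial_bounds_imp_Lipschitz[OF Ck_on_diff[OF Ck_on_shift[OF \<phi>, of "Suc 0" h] \<phi>[of "Suc 0"]], of "d * D2 v * norm h" x y]
        by (simp add: d_def ac_simps)
    qed
    also have "\<dots> = d * (d * I2) * norm h * norm (x - y)" by simp
    also have "\<dots> \<le> M * norm h * norm (x - y)" using nn by (intro mult_right_mono) (auto simp: M_def)
    finally show "\<bar>(spatial_density (f t) (x + h) - spatial_density (f t) x) - (spatial_density (f t) (y + h) - spatial_density (f t) y)\<bar>
      \<le> M * norm h * norm (x - y)" .
  qed
qed

lemma laplace_diff:
  fixes f g :: "real ^ 'n \<Rightarrow> real"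
  assumes f: "Ck_on 2 UNIV f" and g: "Ck_on 2 UNIV g"
  shows "laplace (\<lambda>x. f x - g x) x = laplace f x - laplace g x"
proof -
  have f2: "Ck_on (Suc (Suc 0)) UNIV f" and g2: "Ck_on (Suc (Suc 0)) UNIV g"
    using f g by (simp_all add: numeral_2_eq_2)
  have pd: "partial_deriv i (\<lambda>x. a x - b x) = (\<lambda>x. partial_deriv i a x - partial_deriv i b x)"
    if "Ck_on (Suc k) UNIV a" "Ck_on (Suc k) UNIV b" for i k and a b :: "real ^ 'n \<Rightarrow> real"
    using grad_diff[OF that] by (auto simp: grad_def vec_eq_iff)
  show ?thesis
    unfolding laplace_def pd[OF f2 g2] pd[OF Ck_partial_deriv[OF f2] Ck_partial_deriv[OF g2]]
    by (rule sum_subtractf)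
qed

definition elliptic_const :: "'n itself \<Rightarrow> real" where
  "elliptic_const _ = 2 * (torus_diam TYPE('n))\<^sup>2 * (2 * CARD('n) + 1)"

lemma elliptic_const_nonneg: "elliptic_const TYPE('n::finite) \<ge> 0"
  by (simp add: elliptic_const_def)

text \<open>The first bound is the gradient estimate for \<open>V\<close>. For the second, apply it to the translate difference
  \<open>V(x + h) - V(x)\<close>, whose Laplacian has a Lipschitz constant proportional to \<open>|h|\<close>.\<close>

lemma Poisson_field_bounds:
  fixes V :: "real ^ 'n \<Rightarrow> real"
  assumes C2: "Ck_on 2 UNIV V" and per: "torus_periodic V" and eq: "\<And>x. - laplace V x = \<rho> x - 1"
    and M: "M \<ge> 0" "\<And>x y. \<bar>\<rho> x - \<rho> y\<bar> \<le> M * norm (x - y)"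
      "\<And>x y h. \<bar>(\<rho> (x + h) - \<rho> x) - (\<rho> (y + h) - \<rho> y)\<bar> \<le> M * norm h * norm (x - y)"
  shows "norm (grad V x) \<le> elliptic_const TYPE('n) * M"
    and "norm (grad V x - grad V y) \<le> elliptic_const TYPE('n) * M * norm (x - y)"
proof -
  have lap: "laplace V x = 1 - \<rho> x" for x using eq[of x] by simp
  show "norm (grad V x) \<le> elliptic_const TYPE('n) * M"
    unfolding elliptic_const_def
    by (rule torus_grad_bound[OF C2 per]) (use M in \<open>auto simp: lap abs_minus_commute\<close>)
  have *: "norm (grad V (y + h) - grad V y) \<le> elliptic_const TYPE('n) * (M * norm h)" for h y
  proof -
    let ?U = "\<lambda>x. V (x + h) - V x"
    have sh: "Ck_on 2 UNIV (\<lambda>x. V (x + h))" by (rule Ck_on_shift[OF C2])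
    have U2: "Ck_on 2 UNIV ?U" by (rule Ck_on_diff[OF sh C2])
    have Up: "torus_periodic ?U"
      unfolding torus_periodic_def
    proof (intro allI)
      fix x i
      have "V (x + axis i (2 * pi) + h) = V (x + h)"
        using torus_periodicD[OF per, of "x + h" i] by (simp add: ac_simps)
      then show "V (x + axis i (2 * pi) + h) - V (x + axis i (2 * pi)) = V (x + h) - V x"
        using torus_periodicD[OF per, of x i] by simp
    qed
    have lapU: "laplace ?U x = \<rho> x - \<rho> (x + h)" for x
      using laplace_diff[OF sh C2, of x] by (simp add: laplace_shift lap)
    have "norm (grad ?U y) \<le> elliptic_const TYPE('n) * (M * norm h)"
      unfolding elliptic_const_def
    proof (rule torus_grad_bound[OF U2 Up])
      show "\<bar>laplace ?U x - laplace ?U z\<bar> \<le> M * norm h * norm (x - z)" for x z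
        using M(3)[of x h z] by (simp add: lapU)
    qed (use M in simp)
    moreover have "grad ?U y = grad V (y + h) - grad V y"
      using grad_diff[of 1 "\<lambda>x. V (x + h)" V y] sh C2 by (simp add: grad_shift numeral_2_eq_2)
    ultimately show ?thesis by simp
  qed
  show "norm (grad V x - grad V y) \<le> elliptic_const TYPE('n) * M * norm (x - y)"
    using *[of y "x - y"] by simp
qed

text \<open>The gradient estimate with Lipschitz constant 0.\<close>

lemma Poisson_field_unique:
  fixes V1 V2 :: "real ^ 'n \<Rightarrow> real"
  assumes "Ck_on 2 UNIV V1" "torus_periodic V1" "Ck_on 2 UNIV V2" "torus_periodic V2"
    and "\<And>x. laplace V1 x = laplace V2 x"
  shows "grad V1 x = grad V2 x"
proof -
  have "norm (grad (\<lambda>x. V1 x - V2 x) x) \<le> 2 * (torus_diam TYPE('n))\<^sup>2 * (2 * CARD('n) + 1) * 0"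
  proof (rule torus_grad_bound)
    show "Ck_on 2 UNIV (\<lambda>x. V1 x - V2 x)" using assms by (intro Ck_on_diff)
    show "torus_periodic (\<lambda>x. V1 x - V2 x)" using assms by (simp add: torus_periodic_def)
    show "\<bar>laplace (\<lambda>x. V1 x - V2 x) x - laplace (\<lambda>x. V1 x - V2 x) y\<bar> \<le> 0 * norm (x - y)" for x y
      using laplace_diff[OF assms(1,3)] assms(5) by simp
  qed simp
  moreover have "grad (\<lambda>x. V1 x - V2 x) x = grad V1 x - grad V2 x"
    using grad_diff[of 1 V1 V2 x] assms by (simp add: numeral_2_eq_2)
  ultimately show ?thesis by simp
qed

section \<open>Real-analytic functions and their Taylor series\<close>

text \<open>Abel's limit theorem. With the tails \<open>r n\<close> of the series, summation by parts gives
  \<open>\<Sum> b n x^n = \<Sum> b n - (1 - x) \<Sum> r (n+1) x^n\<close>. The finitely many large tails are killed by the factor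
  \<open>1 - x\<close>, and the small ones contribute at most \<open>e/2 (1 - x) \<Sum> x^n = e/2\<close>.\<close>

lemma Abel_limit:
  fixes b :: "nat \<Rightarrow> real"
  assumes b: "summable b"
  shows "((\<lambda>x. \<Sum>n. b n * x ^ n) \<longlongrightarrow> suminf b) (at_left 1)"
proof -
  define r where "r n = (\<Sum>m. b (m + n))" for n
  have r_eq: "r n = suminf b - (\<Sum>i<n. b i)" for n
    unfolding r_def by (rule suminf_minus_initial_segment[OF b])
  have b_eq: "b n = r n - r (Suc n)" for n by (simp add: r_eq)
  have r0: "r 0 = suminf b" by (simp add: r_def)
  have "(\<lambda>n. suminf b - (\<Sum>i<n. b i)) \<longlonglongrightarrow> suminf b - suminf b"
    by (intro tendsto_diff tendsto_const summable_LIMSEQ b)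
  then have r_lim: "r \<longlonglongrightarrow> 0" by (simp add: r_eq[abs_def])
  then have "Bseq r" using convergent_imp_Bseq convergentI by blast
  then obtain M where M: "\<And>n. \<bar>r n\<bar> \<le> M" unfolding Bseq_def by auto
  have sr: "summable (\<lambda>n. r (n + k) * x ^ n)" if x: "0 \<le> x" "x < 1" for x k
  proof (rule summable_comparison_test'[where N = 0])
    show "summable (\<lambda>n. M * x ^ n)" using x by (intro summable_mult summable_geometric) auto
    show "norm (r (n + k) * x ^ n) \<le> M * x ^ n" for n
      using M[of "n + k"] x by (simp add: abs_mult mult_right_mono)
  qed
  have formula: "(\<Sum>n. b n * x ^ n) = suminf b - (1 - x) * (\<Sum>n. r (Suc n) * x ^ n)" if x: "0 \<le> x" "x < 1" for x
  proof -
    have s0: "summable (\<lambda>n. r n * x ^ n)" and s1: "summable (\<lambda>n. r (Suc n) * x ^ n)"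
      using sr[OF x, of 0] sr[OF x, of 1] by simp_all
    have "(\<Sum>n. b n * x ^ n) = (\<Sum>n. r n * x ^ n - r (Suc n) * x ^ n)"
      by (simp add: b_eq left_diff_distrib)
    also have "\<dots> = (\<Sum>n. r n * x ^ n) - (\<Sum>n. r (Suc n) * x ^ n)"
      by (rule suminf_diff[OF s0 s1, symmetric])
    also have "(\<Sum>n. r n * x ^ n) = r 0 + (\<Sum>n. r (Suc n) * x ^ Suc n)"
      using suminf_split_head[OF s0] by simp
    also have "(\<Sum>n. r (Suc n) * x ^ Suc n) = x * (\<Sum>n. r (Suc n) * x ^ n)"
      using suminf_mult[OF s1, of x] by (simp add: ac_simps)
    finally show ?thesis by (simp add: r0 algebra_simps)
  qed
  show ?thesis
  proof (rule tendstoI)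
    fix e :: real assume e: "e > 0"
    obtain N where N: "\<And>n. n \<ge> N \<Longrightarrow> \<bar>r n\<bar> < e / 2"
      using LIMSEQ_D[OF r_lim, of "e / 2"] e by auto
    define C where "C = (\<Sum>n<N. \<bar>r (Suc n)\<bar>)"
    have C0: "C \<ge> 0" by (simp add: C_def sum_nonneg)
    have "\<forall>\<^sub>F x in at_left 1. x \<in> {max 0 (1 - e / (2 * (C + 1)))<..<1}"
      by (rule eventually_at_left_real) (use e C0 in \<open>auto simp: add_nonneg_pos\<close>)
    then show "\<forall>\<^sub>F x in at_left 1. dist (\<Sum>n. b n * x ^ n) (suminf b) < e"
    proof eventually_elim
      case (elim x)
      then have x: "0 \<le> x" "x < 1" and xe: "1 - x < e / (2 * (C + 1))" by auto
      have s1: "summable (\<lambda>n. r (Suc n) * x ^ n)" using sr[OF x, of 1] by simp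
      have s2: "summable (\<lambda>n. r (Suc (n + N)) * x ^ (n + N))"
        using summable_ignore_initial_segment[OF s1, of N] by simp
      have geo: "summable (\<lambda>n. e / 2 * x ^ n)" "(\<Sum>n. e / 2 * x ^ n) = e / 2 / (1 - x)"
      proof -
        have g: "summable (\<lambda>n. x ^ n)" using x by (intro summable_geometric) simp
        then show "summable (\<lambda>n. e / 2 * x ^ n)" by (rule summable_mult)
        have "(\<Sum>n. x ^ n) = 1 / (1 - x)" using x by (intro suminf_geometric) simp
        then show "(\<Sum>n. e / 2 * x ^ n) = e / 2 / (1 - x)" by (simp only: suminf_mult[OF g] times_divide_eq_right mult_1_right)
      qed
      have "\<bar>\<Sum>n. r (Suc (n + N)) * x ^ (n + N)\<bar> \<le> (\<Sum>n. e / 2 * x ^ n)"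
        unfolding real_norm_def[symmetric]
      proof (rule norm_suminf_le[OF _ geo(1)])
        fix n
        have "x ^ (n + N) \<le> x ^ n" using x by (intro power_decreasing) auto
        then show "norm (r (Suc (n + N)) * x ^ (n + N)) \<le> e / 2 * x ^ n"
          using N[of "Suc (n + N)"] x unfolding norm_mult by (intro mult_mono) auto
      qed
      moreover have "\<bar>\<Sum>n<N. r (Suc n) * x ^ n\<bar> \<le> C"
        unfolding C_def
      proof (rule order_trans[OF sum_abs sum_mono])
        fix n
        have "\<bar>r (Suc n)\<bar> * x ^ n \<le> \<bar>r (Suc n)\<bar> * 1" using x by (intro mult_left_mono power_le_one) auto
        then show "\<bar>r (Suc n) * x ^ n\<bar> \<le> \<bar>r (Suc n)\<bar>" using x by (simp add: abs_mult)
      qed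
      ultimately have "\<bar>\<Sum>n. r (Suc n) * x ^ n\<bar> \<le> C + e / 2 / (1 - x)"
        using suminf_split_initial_segment[OF s1, of N] geo(2) by linarith
      then have "(1 - x) * \<bar>\<Sum>n. r (Suc n) * x ^ n\<bar> \<le> (1 - x) * (C + e / 2 / (1 - x))"
        using x by (intro mult_left_mono) auto
      also have "\<dots> = (1 - x) * C + e / 2" using x by (simp add: field_simps)
      also have "\<dots> < e"
      proof -
        have "(1 - x) * C \<le> (1 - x) * (C + 1)" using x by (intro mult_left_mono) auto
        moreover have "(1 - x) * (C + 1) < e / 2" using xe C0 by (simp add: field_simps)
        ultimately show ?thesis by linarith
      qed
      finally show ?case using x by (simp add: formula[OF x] dist_real_def abs_mult)
    qed
  qed
qed

lemma funpow_diffs: "(diffs ^^ k) a n * fact n = fact (n + k) * (a (n + k) :: real)"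
proof (induction k arbitrary: n)
  case 0
  then show ?case by simp
next
  case (Suc k)
  have "(diffs ^^ Suc k) a n * fact n = (diffs ^^ k) a (Suc n) * fact (Suc n)"
    by (simp add: diffs_def)
  also have "\<dots> = fact (n + Suc k) * a (n + Suc k)" using Suc.IH[of "Suc n"] by simp
  finally show ?case .
qed

lemma funpow_time_deriv_power_series:
  assumes T: "T > 0" and \<epsilon>: "\<epsilon> > 0"
    and \<phi>: "\<And>t. t \<in> {0..T} \<Longrightarrow> t < \<epsilon> \<Longrightarrow> \<phi> t = (\<Sum>n. a n * t ^ n)"
    and conv: "\<And>t. \<bar>t\<bar> < \<epsilon> \<Longrightarrow> summable (\<lambda>n. a n * t ^ n)"
  shows "(time_deriv T ^^ k) \<phi> 0 = fact k * a k"
proof -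
  have sm: "summable (\<lambda>n. (diffs ^^ k) a n * t ^ n)" if "\<bar>t\<bar> < \<epsilon>" for k t
    using that
  proof (induction k arbitrary: t)
    case 0
    then show ?case by (simp add: conv)
  next
    case (Suc k)
    have "summable (\<lambda>n. diffs ((diffs ^^ k) a) n * t ^ n)"
      by (rule termdiff_converges[where K = \<epsilon>]) (use Suc in auto)
    then show ?case by simp
  qed
  have eq: "(time_deriv T ^^ k) \<phi> t = (\<Sum>n. (diffs ^^ k) a n * t ^ n)" if "t \<in> {0..T}" "t < \<epsilon>" for k t
    using that
  proof (induction k arbitrary: t)
    case 0
    then show ?case by (simp add: \<phi>)
  next
    case (Suc k)
    let ?x = "(t + \<epsilon>) / 2"
    have x: "\<bar>?x\<bar> < \<epsilon>" "norm t < norm ?x" using Suc.prems by auto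
    have "((\<lambda>s. \<Sum>n. (diffs ^^ k) a n * s ^ n) has_field_derivative (\<Sum>n. diffs ((diffs ^^ k) a) n * t ^ n)) (at t)"
      by (rule termdiffs_strong[OF sm[OF x(1)] x(2)])
    then have d: "((\<lambda>s. \<Sum>n. (diffs ^^ k) a n * s ^ n) has_field_derivative (\<Sum>n. diffs ((diffs ^^ k) a) n * t ^ n)) (at t within {0..T})"
      by (rule has_field_derivative_at_within)
    have "((time_deriv T ^^ k) \<phi> has_field_derivative (\<Sum>n. diffs ((diffs ^^ k) a) n * t ^ n)) (at t within {0..T})"
    proof (rule has_field_derivative_transform_within[OF d])
      show "\<epsilon> - t > 0" using Suc.prems by simp
      show "t \<in> {0..T}" using Suc.prems by simp
      show "(\<Sum>n. (diffs ^^ k) a n * s ^ n) = (time_deriv T ^^ k) \<phi> s" if "s \<in> {0..T}" "dist s t < \<epsilon> - t" for s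
        using Suc.IH[OF that(1)] that(2) by (simp add: dist_real_def)
    qed
    then have "time_deriv T ((time_deriv T ^^ k) \<phi>) t = (\<Sum>n. diffs ((diffs ^^ k) a) n * t ^ n)"
      by (rule time_deriv_eqI[OF T Suc.prems(1)])
    then show ?case by simp
  qed
  have "(time_deriv T ^^ k) \<phi> 0 = (diffs ^^ k) a 0" using eq[of 0 k] T \<epsilon> by simp
  then show ?thesis using funpow_diffs[of k a 0] by simp
qed

text \<open>Complexification of a real power series. Convergence is only assumed on the segment to one side of the
  centre, given by the sign \<open>\<sigma>\<close>, because a centre at an end of the time interval has points of the interval
  on one side only.\<close>

lemma powser_holomorphic_real_sum:
  fixes b :: "nat \<Rightarrow> real"
  assumes conv: "\<And>\<delta>'. 0 < \<delta>' \<Longrightarrow> \<delta>' < \<delta> \<Longrightarrow> summable (\<lambda>n. b n * (\<sigma> * \<delta>') ^ n)" and \<sigma>: "\<bar>\<sigma>\<bar> = 1"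
  shows "(\<lambda>z. \<Sum>n. of_real (b n) * (z - of_real s) ^ n) holomorphic_on ball (of_real s :: complex) \<delta>"
    and "\<And>u. \<bar>u - s\<bar> < \<delta> \<Longrightarrow> (\<Sum>n. of_real (b n) * (of_real u - of_real s) ^ n) = (of_real (\<Sum>n. b n * (u - s) ^ n) :: complex)"
proof -
  have sm: "summable (\<lambda>n. of_real (b n) * w ^ n :: complex)" if w: "norm w < \<delta>" for w
  proof -
    obtain \<delta>' where \<delta>': "norm w < \<delta>'" "\<delta>' < \<delta>" using dense[OF w] by blast
    then have pos: "0 < \<delta>'" using norm_ge_zero[of w] by linarith
    have "summable (\<lambda>n. of_real (b n * (\<sigma> * \<delta>') ^ n) :: complex)"
      using conv[OF pos \<delta>'(2)] by (simp only: summable_of_real_iff)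
    then have "summable (\<lambda>n. of_real (b n) * (of_real (\<sigma> * \<delta>')) ^ n :: complex)" by simp
    moreover have "norm (of_real (\<sigma> * \<delta>') :: complex) = \<delta>'" using \<sigma> pos by (simp add: norm_mult abs_mult)
    ultimately show ?thesis using powser_inside[of "\<lambda>n. of_real (b n)" "of_real (\<sigma> * \<delta>')" w] \<delta>'(1) by simp
  qed
  show "(\<lambda>z. \<Sum>n. of_real (b n) * (z - of_real s) ^ n) holomorphic_on ball (of_real s :: complex) \<delta>"
  proof (rule power_series_holomorphic)
    show "(\<lambda>n. of_real (b n) * (w - of_real s) ^ n) sums (\<Sum>n. of_real (b n) * (w - of_real s) ^ n)"
      if "w \<in> ball (of_real s :: complex) \<delta>" for w
      by (rule summable_sums, rule sm) (use that in \<open>simp add: dist_norm norm_minus_commute\<close>)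
  qed
  show "(\<Sum>n. of_real (b n) * (of_real u - of_real s) ^ n) = (of_real (\<Sum>n. b n * (u - s) ^ n) :: complex)"
    if u: "\<bar>u - s\<bar> < \<delta>" for u
  proof -
    have n: "norm (of_real (u - s) :: complex) < \<delta>" using u by (simp only: norm_of_real)
    have "summable (\<lambda>n. of_real (b n * (u - s) ^ n) :: complex)"
      using sm[OF n] by simp
    then have "summable (\<lambda>n. b n * (u - s) ^ n)" by (simp only: summable_of_real_iff)
    from suminf_of_real[OF this, symmetric] show ?thesis by simp
  qed
qed

text \<open>Let \<open>s\<close> be the infimum of the points below \<open>t\<close> where \<open>\<phi>\<close> and the power series differ. Near \<open>s\<close> both have
  holomorphic extensions, which agree to the left of \<open>s\<close> and hence in a full neighbourhood of \<open>s\<close>,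
  contradicting the choice of \<open>s\<close>.\<close>

lemma power_series_agree_imp_agree:
  fixes \<phi> :: "real \<Rightarrow> real"
  assumes an: "real_analytic_on \<phi> {0..T}" and \<epsilon>: "\<epsilon> > 0"
    and near: "\<And>t. t \<in> {0..T} \<Longrightarrow> t < \<epsilon> \<Longrightarrow> \<phi> t = (\<Sum>n. a n * t ^ n)"
    and t: "0 < t" "t \<le> T" and conv: "summable (\<lambda>n. a n * t ^ n)"
    and u: "u \<in> {0..<t}"
  shows "\<phi> u = (\<Sum>n. a n * u ^ n)"
proof (rule ccontr)
  define p where "p u = (\<Sum>n. a n * u ^ n)" for u
  assume "\<phi> u \<noteq> (\<Sum>n. a n * u ^ n)"
  define B where "B = {u \<in> {0..<t}. \<phi> u \<noteq> p u}"
  define s where "s = Inf B"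
  have uB: "u \<in> B" using u \<open>\<phi> u \<noteq> _\<close> by (simp add: B_def p_def)
  have bdd: "bdd_below B" by (rule bdd_belowI[of _ 0]) (auto simp: B_def)
  have "s \<ge> min \<epsilon> t"
    unfolding s_def
  proof (rule cInf_greatest)
    show "B \<noteq> {}" using uB by auto
    show "min \<epsilon> t \<le> x" if "x \<in> B" for x
      using that near[of x] t by (force simp: B_def p_def not_less)
  qed
  then have s0: "s > 0" using \<epsilon> t by auto
  have su: "s \<le> u" unfolding s_def by (rule cInf_lower[OF uB bdd])
  then have st: "s < t" using u by simp
  have below: "\<phi> x = p x" if "0 \<le> x" "x < s" for x
    using cInf_lower[OF _ bdd, of x] that st by (force simp: B_def s_def)
  have sT: "s \<in> {0..T}" using s0 st t by simp
  obtain r b where r: "r > 0" and b: "\<And>x. x \<in> {0..T} \<Longrightarrow> \<bar>x - s\<bar> < r \<Longrightarrow> (\<lambda>n. b n * (x - s) ^ n) sums \<phi> x"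
    using an sT unfolding real_analytic_on_def by blast
  \<comment> \<open>Small enough for the local series at \<open>s\<close> and for the disc around \<open>s\<close> to lie in the disc of radius \<open>t\<close>.\<close>
  define \<delta> where "\<delta> = min r (min s (t - s))"
  have \<delta>: "\<delta> > 0" "\<delta> \<le> r" "\<delta> \<le> s" "\<delta> \<le> t - s" using r s0 st by (auto simp: \<delta>_def)
  have cb: "summable (\<lambda>n. b n * (- 1 * \<delta>') ^ n)" if "0 < \<delta>'" "\<delta>' < \<delta>" for \<delta>'
    using sums_summable[OF b[of "s - \<delta>'"]] that \<delta> sT by simp
  have ca: "summable (\<lambda>n. a n * (1 * \<delta>') ^ n)" if "0 < \<delta>'" "\<delta>' < t" for \<delta>'
    using powser_inside[OF conv, of \<delta>'] that by simp
  define P where "P z = (\<Sum>n. of_real (a n) * (z - of_real 0) ^ n)" for z :: complex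
  define Q where "Q z = (\<Sum>n. of_real (b n) * (z - of_real s) ^ n)" for z :: complex
  have holP: "P holomorphic_on ball (of_real 0) t"
    unfolding P_def by (rule powser_holomorphic_real_sum(1)[OF ca]) simp_all
  have holQ: "Q holomorphic_on ball (of_real s) \<delta>"
    unfolding Q_def by (rule powser_holomorphic_real_sum(1)[OF cb]) simp_all
  have P: "P (of_real x) = of_real (p x)" if "\<bar>x\<bar> < t" for x
    using powser_holomorphic_real_sum(2)[OF ca, of t x 0] that by (simp add: P_def p_def)
  have Q: "Q (of_real x) = of_real (\<phi> x)" if "\<bar>x - s\<bar> < \<delta>" for x
  proof -
    have "x \<in> {0..T}" "\<bar>x - s\<bar> < r" using that \<delta> s0 st t by auto
    then have "(\<Sum>n. b n * (x - s) ^ n) = \<phi> x" using b sums_unique by metis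
    then show ?thesis using powser_holomorphic_real_sum(2)[OF cb, of \<delta> x s] that by (simp add: Q_def)
  qed
  have sub: "ball (of_real s :: complex) \<delta> \<subseteq> ball (of_real 0) t"
  proof
    fix z :: complex assume "z \<in> ball (of_real s) \<delta>"
    then have "norm (z - of_real s) < \<delta>" by (simp add: dist_norm norm_minus_commute)
    then have "norm z < \<delta> + s" using norm_triangle_ineq[of "z - of_real s" "of_real s"] s0 by simp
    then show "z \<in> ball (of_real 0) t" using \<delta> by (simp add: dist_norm)
  qed
  let ?U = "(of_real :: real \<Rightarrow> complex) ` {s - \<delta><..<s}"
  have "(of_real s :: complex) islimpt ?U"
  proof -
    have "s islimpt {s - \<delta><..<s}" using \<delta>(1) by (simp add: islimpt_greaterThanLessThan2)
    then show ?thesis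
      by (rule islimpt_isCont_image) (auto simp: eventually_at_filter)
  qed
  moreover have "P z - Q z = 0" if z: "z \<in> ?U" for z
  proof -
    obtain x where x: "z = of_real x" "s - \<delta> < x" "x < s" using z by auto
    have "P z = of_real (p x)" unfolding x(1) by (rule P) (use x \<delta> st in auto)
    moreover have "Q z = of_real (\<phi> x)" unfolding x(1) by (rule Q) (use x in auto)
    moreover have "\<phi> x = p x" by (rule below) (use x \<delta> in auto)
    ultimately show ?thesis by simp
  qed
  moreover have "(\<lambda>z. P z - Q z) holomorphic_on ball (of_real s) \<delta>"
    by (intro holomorphic_on_diff holQ holomorphic_on_subset[OF holP sub])
  moreover have "?U \<subseteq> ball (of_real s) \<delta>"
    using \<delta> by (auto simp: dist_of_real dist_real_def)
  ultimately have PQ: "P w - Q w = 0" if "w \<in> ball (of_real s) \<delta>" for w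
    using analytic_continuation[of "\<lambda>z. P z - Q z" "ball (of_real s) \<delta>" ?U "of_real s" w] that \<delta>(1) by simp
  have agree: "\<phi> x = p x" if "\<bar>x - s\<bar> < \<delta>" for x
  proof -
    have "of_real (p x) - of_real (\<phi> x) = (0 :: complex)"
      using PQ[of "of_real x"] P[of x] Q[OF that] that \<delta> s0 by (simp add: dist_of_real dist_real_def abs_minus_commute)
    then show ?thesis by (simp flip: of_real_diff)
  qed
  have "s + \<delta> \<le> s"
    unfolding s_def
  proof (rule cInf_greatest)
    show "B \<noteq> {}" using uB by auto
    fix x assume x: "x \<in> B"
    then have "\<phi> x \<noteq> p x" "s \<le> x" using cInf_lower[OF x bdd] by (auto simp: B_def s_def)
    then show "Inf B + \<delta> \<le> x" using agree[of x] by (force simp: s_def)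
  qed
  then show False using \<delta>(1) by simp
qed

text \<open>Inside the radius of convergence this is analytic continuation from 0. If the series converges at \<open>t\<close>
  itself, possibly on the boundary of the disc of convergence, both sides are continuous from the left
  at \<open>t\<close>, the series by Abel's theorem.\<close>

lemma real_analytic_Taylor_series:
  fixes \<phi> :: "real \<Rightarrow> real"
  assumes T: "T > 0" and an: "real_analytic_on \<phi> {0..T}" and c: "\<And>k. c k = (time_deriv T ^^ k) \<phi> 0"
  shows "conv_radius (\<lambda>k. c k / fact k) > 0"
    and "\<And>t. t \<in> {0..T} \<Longrightarrow> summable (\<lambda>k. c k / fact k * t ^ k) \<Longrightarrow> \<phi> t = (\<Sum>k. c k / fact k * t ^ k)"
proof -
  have zT: "0 \<in> {0..T}" using T by simp
  obtain r a where r: "r > 0" and a: "\<And>t. t \<in> {0..T} \<Longrightarrow> \<bar>t - 0\<bar> < r \<Longrightarrow> (\<lambda>n. a n * (t - 0) ^ n) sums \<phi> t"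
    using an zT unfolding real_analytic_on_def by blast
  define \<epsilon> where "\<epsilon> = min r T"
  have \<epsilon>: "\<epsilon> > 0" using r T by (simp add: \<epsilon>_def)
  have sums: "(\<lambda>n. a n * t ^ n) sums \<phi> t" if "t \<in> {0..T}" "t < \<epsilon>" for t
    using a[of t] that by (simp add: \<epsilon>_def)
  have near: "\<phi> t = (\<Sum>n. a n * t ^ n)" if "t \<in> {0..T}" "t < \<epsilon>" for t
    using sums[OF that] by (rule sums_unique)
  have conv: "summable (\<lambda>n. a n * t ^ n)" if t: "\<bar>t\<bar> < \<epsilon>" for t
  proof -
    obtain x where x: "\<bar>t\<bar> < x" "x < \<epsilon>" using dense[OF t] by blast
    then have "x \<in> {0..T}" by (auto simp: \<epsilon>_def)
    from sums_summable[OF sums[OF this x(2)]] show ?thesis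
      by (rule powser_inside) (use x in auto)
  qed
  have ca: "c k / fact k = a k" for k
    using funpow_time_deriv_power_series[OF T \<epsilon> near conv, of k] by (simp add: c)
  have "conv_radius a \<ge> norm (\<epsilon> / 2)" by (rule conv_radius_geI[OF conv]) (use \<epsilon> in simp)
  then show "conv_radius (\<lambda>k. c k / fact k) > 0"
    using \<epsilon> by (simp add: ca) (metis ereal_less(2) half_gt_zero order_less_le_trans)
  fix t assume t: "t \<in> {0..T}" and "summable (\<lambda>k. c k / fact k * t ^ k)"
  then have sm: "summable (\<lambda>n. a n * t ^ n)" by (simp add: ca)
  show "\<phi> t = (\<Sum>k. c k / fact k * t ^ k)"
  proof (cases "t = 0")
    case True
    then show ?thesis using near[OF zT \<epsilon>] by (simp add: ca)
  next
    case False
    then have t0: "0 < t" "t \<le> T" using t by auto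
    have "((\<lambda>x. \<Sum>n. (a n * t ^ n) * x ^ n) \<longlongrightarrow> (\<Sum>n. a n * t ^ n)) (at_left 1)"
      by (rule Abel_limit[OF sm])
    moreover have "\<forall>\<^sub>F x in at_left 1. (\<Sum>n. (a n * t ^ n) * x ^ n) = \<phi> (t * x)"
    proof -
      have "\<forall>\<^sub>F x in at_left (1::real). x \<in> {0<..<1}" by (rule eventually_at_left_real) simp
      then show ?thesis
      proof eventually_elim
        case (elim x)
        have "t * x \<in> {0..<t}" using elim t0 by simp
        from power_series_agree_imp_agree[OF an \<epsilon> near t0 sm this]
        show ?case by (simp add: power_mult_distrib mult.assoc)
      qed
    qed
    ultimately have lim1: "((\<lambda>x. \<phi> (t * x)) \<longlongrightarrow> (\<Sum>n. a n * t ^ n)) (at_left 1)"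
      by (rule Lim_transform_eventually)
    obtain r' b where r': "r' > 0" and b: "\<And>x. x \<in> {0..T} \<Longrightarrow> \<bar>x - t\<bar> < r' \<Longrightarrow> (\<lambda>n. b n * (x - t) ^ n) sums \<phi> x"
      using an t unfolding real_analytic_on_def by blast
    define h where "h = min r' t / 2"
    have h: "h > 0" "h < r'" "h < t" using r' t0 by (auto simp: h_def)
    have "summable (\<lambda>n. b n * (- h) ^ n)"
      using sums_summable[OF b[of "t - h"]] h t0 by simp
    then have "isCont (\<lambda>y. \<Sum>n. b n * y ^ n) 0"
      by (rule isCont_powser) (use h in simp)
    then have cont: "((\<lambda>y. \<Sum>n. b n * y ^ n) \<longlongrightarrow> (\<Sum>n. b n * 0 ^ n)) (at 0)"
      by (simp add: isCont_def)
    have "((\<lambda>x. t * x - t) \<longlongrightarrow> t * 1 - t) (at_left 1)" by (intro tendsto_intros)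
    then have "filterlim (\<lambda>x. t * x - t) (at 0) (at_left 1)"
      using t0 by (intro filterlim_atI) (auto simp: eventually_at_filter)
    note lim = filterlim_compose[OF cont this]
    have "(\<Sum>n. b n * 0 ^ n) = \<phi> t" using sums_unique[OF b[OF t]] r' by simp
    with lim have "((\<lambda>x. \<Sum>n. b n * (t * x - t) ^ n) \<longlongrightarrow> \<phi> t) (at_left 1)" by simp
    moreover have "\<forall>\<^sub>F x in at_left 1. (\<Sum>n. b n * (t * x - t) ^ n) = \<phi> (t * x)"
    proof -
      have "\<forall>\<^sub>F x in at_left (1::real). x \<in> {max 0 (1 - r' / t)<..<1}"
        by (rule eventually_at_left_real) (use r' t0 in simp)
      then show ?thesis
      proof eventually_elim
        case (elim x)
        have "0 < x" "x < 1" "t * (1 - r' / t) < t * x" using elim t0 by auto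
        then have x: "0 < x" "x < 1" "t - r' < t * x" using t0 by (simp_all add: right_diff_distrib)
        have le: "t * x \<le> t" "0 \<le> t * x" using x t0 by (simp_all add: mult_left_le)
        have "t * x \<le> T" using le t0 by linarith
        then have "t * x \<in> {0..T}" using le by simp
        moreover have "\<bar>t * x - t\<bar> < r'" using le x r' by linarith
        ultimately have "(\<lambda>n. b n * (t * x - t) ^ n) sums \<phi> (t * x)" by (rule b)
        then show ?case by (rule sums_unique[symmetric])
      qed
    qed
    ultimately have lim2: "((\<lambda>x. \<phi> (t * x)) \<longlongrightarrow> \<phi> t) (at_left 1)"
      by (rule Lim_transform_eventually)
    have "\<phi> t = (\<Sum>n. a n * t ^ n)"
      using tendsto_unique[OF trivial_limit_at_left_real lim2 lim1] .
    then show ?thesis by (simp add: ca)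
  qed
qed

lemma real_analytic_on_diff:
  assumes "real_analytic_on f S" "real_analytic_on g S"
  shows "real_analytic_on (\<lambda>t. f t - g t) S"
  unfolding real_analytic_on_def
proof
  fix t0 assume "t0 \<in> S"
  then obtain r1 a1 r2 a2 where "r1 > 0" "r2 > 0"
    "\<forall>t\<in>S. \<bar>t - t0\<bar> < r1 \<longrightarrow> (\<lambda>n. a1 n * (t - t0) ^ n) sums f t"
    "\<forall>t\<in>S. \<bar>t - t0\<bar> < r2 \<longrightarrow> (\<lambda>n. a2 n * (t - t0) ^ n) sums g t"
    using assms unfolding real_analytic_on_def by metis
  then show "\<exists>r>0. \<exists>a. \<forall>t\<in>S. \<bar>t - t0\<bar> < r \<longrightarrow> (\<lambda>n. a n * (t - t0) ^ n) sums (f t - g t)"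
    by (intro exI[of _ "min r1 r2"] conjI exI[of _ "\<lambda>n. a1 n - a2 n"])
      (auto simp: left_diff_distrib intro!: sums_diff)
qed

section \<open>Uniqueness of the exterior field\<close>

text \<open>A solution of the Vlasov--Poisson system as a transport solution. The constants may be enlarged, so that
  two solutions can be given common ones.\<close>

lemma VP_solution_transport:
  fixes Vx :: "real \<Rightarrow> real ^ 'n \<Rightarrow> real"
  assumes T: "T > 0" and Vx: "Cinf_torus T Vx" and sol: "regular_VP_solution T (\<lambda>t. grad (Vx t)) f0 f"
  obtains V K A where "K \<ge> 0" "A \<ge> 0" "f 0 = f0"
    "\<And>t. t \<in> {0..T} \<Longrightarrow> torus_periodic (V t)" "\<And>t. t \<in> {0..T} \<Longrightarrow> Ck_on 2 UNIV (V t)"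
    "\<And>t x. t \<in> {0..T} \<Longrightarrow> laplace (V t) x = 1 - spatial_density (f t) x"
    "\<And>t x y. t \<in> {0..T} \<Longrightarrow>
      norm ((grad (V t) x + grad (Vx t) x) - (grad (V t) y + grad (Vx t) y)) \<le> K * norm (x - y)"
    "\<And>K' A'. K \<le> K' \<Longrightarrow> A \<le> A' \<Longrightarrow> transport_solution T K' A' (\<lambda>t x. grad (V t) x + grad (Vx t) x) f"
proof -
  have f: "Cinf_phase T f" and mb: "moment_bounds T f" and vp: "VP_solution T (\<lambda>t. grad (Vx t)) f0 f"
    using sol by (simp_all add: regular_VP_solution_def)
  obtain V :: "real \<Rightarrow> real ^ 'n \<Rightarrow> real" where V: "\<forall>t\<in>{0..T}. torus_periodic (V t) \<and> Ck_on 2 UNIV (V t)"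
    and vlasov: "\<forall>t\<in>{0..T}. \<forall>x v. time_deriv T (\<lambda>s. f s x v) t + v \<bullet> grad (\<lambda>y. f t y v) x
             + grad (V t) x \<bullet> grad (f t x) v + grad (Vx t) x \<bullet> grad (f t x) v = 0"
    and poisson: "\<forall>t\<in>{0..T}. \<forall>x. - laplace (V t) x = spatial_density (f t) x - 1"
    and init: "f 0 = f0"
    using vp unfolding VP_solution_def by blast
  obtain A M where A: "A \<ge> 0" and M: "M \<ge> 0"
    and moment: "\<And>t x. t \<in> {0..T} \<Longrightarrow> (\<integral>\<^sup>+ v. ennreal ((1 + norm v) * \<bar>f t x v\<bar>) \<partial>lborel) \<le> ennreal A"
    and Lip: "\<And>t x y. t \<in> {0..T} \<Longrightarrow> \<bar>spatial_density (f t) x - spatial_density (f t) y\<bar> \<le> M * norm (x - y)"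
      "\<And>t x y h. t \<in> {0..T} \<Longrightarrow> \<bar>(spatial_density (f t) (x + h) - spatial_density (f t) x) -
        (spatial_density (f t) (y + h) - spatial_density (f t) y)\<bar> \<le> M * norm h * norm (x - y)"
    by (rule density_regularity[OF f mb]) (rule that; assumption)
  obtain Kx where Kx: "Kx \<ge> 0" "\<And>t x. t \<in> {0..T} \<Longrightarrow> norm (grad (Vx t) x) \<le> Kx"
    "\<And>t x y. t \<in> {0..T} \<Longrightarrow> norm (grad (Vx t) x - grad (Vx t) y) \<le> Kx * norm (x - y)"
    by (rule Cinf_torus_grad_bounds[OF Vx]) (rule that; assumption)
  define K0 where "K0 = elliptic_const TYPE('n) * M"
  have K0: "K0 \<ge> 0" using elliptic_const_nonneg[where 'n = 'n] M by (simp add: K0_def)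
  have Vb: "norm (grad (V t) x) \<le> K0" "norm (grad (V t) x - grad (V t) y) \<le> K0 * norm (x - y)"
    if t: "t \<in> {0..T}" for t x y
    using Poisson_field_bounds[of "V t" "spatial_density (f t)" M x] Poisson_field_bounds(2)[of "V t" "spatial_density (f t)" M x y]
      V poisson t M Lip[OF t] by (auto simp: K0_def)
  define K where "K = K0 + Kx"
  define F where "F = (\<lambda>t x. grad (V t) x + grad (Vx t) x)"
  have V2: "Ck_on (Suc (Suc 0)) UNIV (V t)" if "t \<in> {0..T}" for t
    using V that by (simp add: numeral_2_eq_2)
  show thesis
  proof (rule that[of K A V])
    show "K \<ge> 0" "A \<ge> 0" "f 0 = f0" using K0 Kx A init by (simp_all add: K_def)
    show "torus_periodic (V t)" "Ck_on 2 UNIV (V t)" if "t \<in> {0..T}" for t using V that by auto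
    show "laplace (V t) x = 1 - spatial_density (f t) x" if t: "t \<in> {0..T}" for t x
    proof -
      have "- laplace (V t) x = spatial_density (f t) x - 1" using poisson t by blast
      then show ?thesis by simp
    qed
    show "norm ((grad (V t) x + grad (Vx t) x) - (grad (V t) y + grad (Vx t) y)) \<le> K * norm (x - y)"
      if t: "t \<in> {0..T}" for t x y
      using norm_triangle_mono[OF Vb(2)[OF t, of x y] Kx(3)[OF t, of x y]]
      by (simp add: K_def algebra_simps)
    fix K' A' assume K': "K \<le> K'" and A': "A \<le> A'"
    show "transport_solution T K' A' (\<lambda>t x. grad (V t) x + grad (Vx t) x) f"
    proof
      show "T > 0" by (rule T)
      show "Cinf_phase T f" by (rule f)
      show "A' \<ge> 0" using A A' by simp
      fix t assume t: "t \<in> {0..T}"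
      show "continuous_on UNIV (\<lambda>x. grad (V t) x + grad (Vx t) x)"
        by (intro continuous_on_add continuous_on_grad[OF V2[OF t]]
            continuous_on_grad[OF Cinf_torus_slice[OF Vx t, of "Suc 0"]])
      show "torus_periodic (\<lambda>x. grad (V t) x + grad (Vx t) x)"
        using torus_periodic_grad[of "V t"] torus_periodic_grad[OF Cinf_torus_periodic[OF Vx t]] V t
        by (simp add: torus_periodic_def)
      show "norm (grad (V t) x + grad (Vx t) x) \<le> K'" for x
        using norm_triangle_mono[OF Vb(1)[OF t, of x] Kx(2)[OF t, of x]] K' by (simp add: K_def)
      show "time_deriv T (\<lambda>s. f s x v) t + v \<bullet> grad (\<lambda>y. f t y v) x
          + (grad (V t) x + grad (Vx t) x) \<bullet> grad (f t x) v = 0" for x v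
      proof -
        have "time_deriv T (\<lambda>s. f s x v) t + v \<bullet> grad (\<lambda>y. f t y v) x
             + grad (V t) x \<bullet> grad (f t x) v + grad (Vx t) x \<bullet> grad (f t x) v = 0" using vlasov t by blast
        then show ?thesis by (simp add: inner_add_left)
      qed
      show "(\<integral>\<^sup>+ v. ennreal ((1 + norm v) * \<bar>f t x v\<bar>) \<partial>lborel) \<le> ennreal A'" for x
        using moment[OF t, of x] A' by (meson ennreal_leI order_trans)
    qed
  qed
qed

text \<open>Strong induction on the order of the time derivative, the step being the comparison of densities with
  \<open>w\<close> the derivative of order \<open>k\<close>.\<close>

lemma time_derivatives_of_potential_difference_constant:
  fixes V1 V2 :: "real \<Rightarrow> real ^ 'n \<Rightarrow> real"
  assumes T: "T > 0" and f0: "initial_datum f0"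
    and nodal: "negligible {x \<in> torus_cell. spatial_density f0 x = 0}"
    and V1: "Cinf_torus T V1" and V2: "Cinf_torus T V2"
    and sol1: "regular_VP_solution T (\<lambda>t. grad (V1 t)) f0 f1"
    and sol2: "regular_VP_solution T (\<lambda>t. grad (V2 t)) f0 f2"
    and dens: "\<And>t x. t \<in> {0..<T} \<Longrightarrow> spatial_density (f1 t) x = spatial_density (f2 t) x"
  shows "(time_deriv T ^^ k) (\<lambda>t. V1 t x - V2 t x) 0 = (time_deriv T ^^ k) (\<lambda>t. V1 t y - V2 t y) 0"
proof -
  define U where "U t x = V1 t x - V2 t x" for t x
  have U: "Cinf_torus T U" unfolding U_def[abs_def] by (rule Cinf_torus_diff[OF V1 V2])
  have zT: "0 \<in> {0..T}" using T by simp
  define w where "w k x = (time_deriv T ^^ k) (\<lambda>t. U t x) 0" for k x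
  have wC: "Ck_on m UNIV (w k)" and wp: "torus_periodic (w k)" for m k
    using Cinf_torus_slice[OF Cinf_torus_funpow_time_deriv[OF T U] zT]
      Cinf_torus_periodic[OF Cinf_torus_funpow_time_deriv[OF T U] zT] by (simp_all add: w_def[abs_def])
  obtain W1 K1 A1 where 1: "K1 \<ge> 0" "A1 \<ge> 0" "f1 0 = f0"
    "\<And>t. t \<in> {0..T} \<Longrightarrow> torus_periodic (W1 t)" "\<And>t. t \<in> {0..T} \<Longrightarrow> Ck_on 2 UNIV (W1 t)"
    "\<And>t x. t \<in> {0..T} \<Longrightarrow> laplace (W1 t) x = 1 - spatial_density (f1 t) x"
    "\<And>t x y. t \<in> {0..T} \<Longrightarrow>
      norm ((grad (W1 t) x + grad (V1 t) x) - (grad (W1 t) y + grad (V1 t) y)) \<le> K1 * norm (x - y)"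
    "\<And>K' A'. K1 \<le> K' \<Longrightarrow> A1 \<le> A' \<Longrightarrow> transport_solution T K' A' (\<lambda>t x. grad (W1 t) x + grad (V1 t) x) f1"
    by (rule VP_solution_transport[OF T V1 sol1]) (rule that; assumption)
  obtain W2 K2 A2 where 2: "K2 \<ge> 0" "A2 \<ge> 0" "f2 0 = f0"
    "\<And>t. t \<in> {0..T} \<Longrightarrow> torus_periodic (W2 t)" "\<And>t. t \<in> {0..T} \<Longrightarrow> Ck_on 2 UNIV (W2 t)"
    "\<And>t x. t \<in> {0..T} \<Longrightarrow> laplace (W2 t) x = 1 - spatial_density (f2 t) x"
    "\<And>K' A'. K2 \<le> K' \<Longrightarrow> A2 \<le> A' \<Longrightarrow> transport_solution T K' A' (\<lambda>t x. grad (W2 t) x + grad (V2 t) x) f2"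
    by (rule VP_solution_transport[OF T V2 sol2]) (rule that; assumption)
  define K where "K = K1 + K2"
  define A where "A = A1 + A2"
  have K: "K1 \<le> K" "K2 \<le> K" "A1 \<le> A" "A2 \<le> A" using 1(1,2) 2(1,2) by (simp_all add: K_def A_def)
  have fieldeq: "(grad (W1 t) x + grad (V1 t) x) - (grad (W2 t) x + grad (V2 t) x) = grad (U t) x" if t: "t \<in> {0..<T}" for t x
  proof -
    have tT: "t \<in> {0..T}" using t by simp
    have "grad (W1 t) x = grad (W2 t) x"
      by (rule Poisson_field_unique) (use 1(4-6)[OF tT] 2(4-6)[OF tT] dens[OF t] in auto)
    moreover have "grad (U t) x = grad (V1 t) x - grad (V2 t) x"
      unfolding U_def[abs_def]
      by (rule grad_diff[OF Cinf_torus_slice[OF V1 tT, of "Suc 0"] Cinf_torus_slice[OF V2 tT, of "Suc 0"]])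
    ultimately show ?thesis by simp
  qed
  have vanish: "grad (w k) x = 0" for k x
  proof (induction k arbitrary: x rule: less_induct)
    case (less k)
    obtain B where B: "B \<ge> 0" "\<And>s x. s \<in> {0..T} \<Longrightarrow>
        norm (grad (U s) x - (s ^ k / fact k) *\<^sub>R grad (w k) x) \<le> B * s ^ Suc k"
      using grad_time_Taylor[OF T U, of k] less.IH unfolding w_def[abs_def] by blast
    show ?case
    proof (rule grad_eq_0_if_equal_densities[OF 1(8)[OF K(1,3)] 2(7)[OF K(2,4)] 1(3) 2(3) _ nodal dens])
      show "f0 x v \<ge> 0" for x v using f0 by (simp add: initial_datum_def)
      show "norm ((grad (W1 s) x + grad (V1 s) x) - (grad (W1 s) y + grad (V1 s) y)) \<le> K * norm (x - y)"
        if "s \<in> {0..<T}" for s x y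
      proof -
        have "K1 * norm (x - y) \<le> K * norm (x - y)" using K(1) by (rule mult_right_mono) simp
        then show ?thesis using 1(7)[of s x y] that by simp
      qed
      show "norm ((grad (W1 s) x + grad (V1 s) x) - (grad (W2 s) x + grad (V2 s) x) - (s ^ k / fact k) *\<^sub>R grad (w k) x)
          \<le> B * s ^ Suc k" if "s \<in> {0..<T}" for s x
        unfolding fieldeq[OF that] by (rule B(2)) (use that in simp)
    qed (use B(1) wC wp in auto)
  qed
  have "\<bar>w k x - w k y\<bar> \<le> 0 * norm (x - y)"
    by (rule grad_bound_imp_Lipschitz[OF wC[of "Suc 0"]]) (simp add: vanish)
  then show ?thesis by (simp add: w_def U_def)
qed

text \<open>The difference of the values at \<open>x\<close> and at \<open>0\<close> is analytic in time with vanishing Taylor series at 0.\<close>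

lemma potential_difference_depends_only_on_time:
  fixes V1 V2 :: "real \<Rightarrow> real ^ 'n \<Rightarrow> real"
  assumes T: "T > 0"
    and const: "\<And>k x. (time_deriv T ^^ k) (\<lambda>t. V1 t x - V2 t x) 0 = c k"
    and an: "\<And>x. real_analytic_on (\<lambda>t. V1 t x - V2 t x) {0..T}"
    and t: "t \<in> {0..T}"
  shows "V1 t x - V2 t x = V1 t 0 - V2 t 0"
proof -
  let ?\<phi> = "\<lambda>x t. V1 t x - V2 t x"
  have series: "?\<phi> x s = (\<Sum>k. c k / fact k * s ^ k)"
    if "s \<in> {0..T}" "summable (\<lambda>k. c k / fact k * s ^ k)" for s x
    using real_analytic_Taylor_series(2)[OF T an const[symmetric] that] .
  have "conv_radius (\<lambda>k. c k / fact k) > 0"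
    by (rule real_analytic_Taylor_series(1)[OF T an const[symmetric]])
  then obtain \<epsilon> where \<epsilon>: "\<epsilon> > 0" "ereal \<epsilon> < conv_radius (\<lambda>k. c k / fact k)"
    by (metis ereal_dense2 ereal_less(2))
  have near: "?\<phi> x s - ?\<phi> 0 s = (\<Sum>n. 0 * s ^ n)" if s: "s \<in> {0..T}" "s < \<epsilon>" for s
  proof -
    have "ereal (norm s) < conv_radius (\<lambda>k. c k / fact k)"
      using s \<epsilon>(2) by (metis abs_of_nonneg atLeastAtMost_iff ereal_less_eq(3) less_imp_le order_le_less_trans real_norm_def)
    then have "summable (\<lambda>k. c k / fact k * s ^ k)" by (rule summable_in_conv_radius)
    then show ?thesis using series[OF s(1)] by simp
  qed
  have D0: "0 = (time_deriv T ^^ k) (\<lambda>t. ?\<phi> x t - ?\<phi> 0 t) 0" for k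
    using funpow_time_deriv_power_series[OF T \<epsilon>(1), of "\<lambda>t. ?\<phi> x t - ?\<phi> 0 t" "\<lambda>_. 0" k] near by simp
  have "?\<phi> x t - ?\<phi> 0 t = (\<Sum>k. 0 / fact k * t ^ k)"
    by (rule real_analytic_Taylor_series(2)[OF T real_analytic_on_diff[OF an an] D0 t]) simp
  then show ?thesis by simp
qed

theorem theorem4:
  fixes T :: real
    and f0 :: "real ^ 'n \<Rightarrow> real ^ 'n \<Rightarrow> real"
  assumes "T > 0"
    and "initial_datum f0"
    and "negligible {x \<in> torus_cell. spatial_density f0 x = 0}"
  shows
    "(\<forall>V1 V2 :: real \<Rightarrow> real ^ 'n \<Rightarrow> real.
     \<forall>f1 f2 :: real \<Rightarrow> real ^ 'n \<Rightarrow> real ^ 'n \<Rightarrow> real.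
       Cinf_torus T V1 \<and> Cinf_torus T V2 \<and>
       regular_VP_solution T (\<lambda>t. grad (V1 t)) f0 f1 \<and>
       regular_VP_solution T (\<lambda>t. grad (V2 t)) f0 f2 \<and>
       (\<forall>t\<in>{0..<T}. \<forall>x. spatial_density (f1 t) x = spatial_density (f2 t) x) \<longrightarrow>
       (\<exists>c :: nat \<Rightarrow> real.
          (\<forall>k x. (time_deriv T ^^ k) (\<lambda>t. V1 t x - V2 t x) 0 = c k) \<and>
          ((\<forall>x. real_analytic_on (\<lambda>t. V1 t x - V2 t x) {0..T}) \<longrightarrow>
             (\<exists>C :: real \<Rightarrow> real.
                (\<forall>t\<in>{0..T}. \<forall>x. V1 t x - V2 t x = C t) \<and>
                conv_radius (\<lambda>k. c k / fact k) > 0 \<and>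
                (\<forall>t\<in>{0..T}. summable (\<lambda>k. c k / fact k * t ^ k) \<longrightarrow>
                   C t = (\<Sum>k. c k / fact k * t ^ k))))))
     \<and>
     (\<forall>sol :: (real \<Rightarrow> real ^ 'n \<Rightarrow> real ^ 'n) \<Rightarrow> real \<Rightarrow> real ^ 'n \<Rightarrow> real ^ 'n \<Rightarrow> real.
       let D = {E \<in> analytic_fields T. \<exists>f. regular_VP_solution T E f0 f} in
       (\<forall>E\<in>D. regular_VP_solution T E f0 (sol E)) \<longrightarrow>
       inj_on (\<lambda>E. (restrict (\<lambda>t. spatial_density (sol E t)) {0..T}, sol E 0)) D)"
proof -
  note T = assms(1)
  have part1: "\<exists>c :: nat \<Rightarrow> real.
      (\<forall>k x. (time_deriv T ^^ k) (\<lambda>t. V1 t x - V2 t x) 0 = c k) \<and>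
      ((\<forall>x. real_analytic_on (\<lambda>t. V1 t x - V2 t x) {0..T}) \<longrightarrow>
         (\<exists>C :: real \<Rightarrow> real.
            (\<forall>t\<in>{0..T}. \<forall>x. V1 t x - V2 t x = C t) \<and>
            conv_radius (\<lambda>k. c k / fact k) > 0 \<and>
            (\<forall>t\<in>{0..T}. summable (\<lambda>k. c k / fact k * t ^ k) \<longrightarrow>
               C t = (\<Sum>k. c k / fact k * t ^ k))))"
    if V1: "Cinf_torus T V1" and V2: "Cinf_torus T V2"
      and sol1: "regular_VP_solution T (\<lambda>t. grad (V1 t)) f0 f1"
      and sol2: "regular_VP_solution T (\<lambda>t. grad (V2 t)) f0 f2"
      and dens: "\<forall>t\<in>{0..<T}. \<forall>x. spatial_density (f1 t) x = spatial_density (f2 t) x"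
    for V1 V2 :: "real \<Rightarrow> real ^ 'n \<Rightarrow> real" and f1 f2 :: "real \<Rightarrow> real ^ 'n \<Rightarrow> real ^ 'n \<Rightarrow> real"
  proof -
    define c where "c k = (time_deriv T ^^ k) (\<lambda>t. V1 t 0 - V2 t 0) 0" for k
    have c: "(time_deriv T ^^ k) (\<lambda>t. V1 t x - V2 t x) 0 = c k" for k x
      unfolding c_def
      by (rule time_derivatives_of_potential_difference_constant[OF T assms(2,3) V1 V2 sol1 sol2])
        (use dens in blast)
    show ?thesis
    proof (intro exI[of _ c] conjI allI impI)
      show "(time_deriv T ^^ k) (\<lambda>t. V1 t x - V2 t x) 0 = c k" for k x by (rule c)
      assume "\<forall>x. real_analytic_on (\<lambda>t. V1 t x - V2 t x) {0..T}"
      then have an: "real_analytic_on (\<lambda>t. V1 t x - V2 t x) {0..T}" for x by blast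
      show "\<exists>C. (\<forall>t\<in>{0..T}. \<forall>x. V1 t x - V2 t x = C t) \<and>
            conv_radius (\<lambda>k. c k / fact k) > 0 \<and>
            (\<forall>t\<in>{0..T}. summable (\<lambda>k. c k / fact k * t ^ k) \<longrightarrow>
               C t = (\<Sum>k. c k / fact k * t ^ k))"
      proof (intro exI[of _ "\<lambda>t. V1 t 0 - V2 t 0"] conjI ballI allI impI)
        show "V1 t x - V2 t x = V1 t 0 - V2 t 0" if "t \<in> {0..T}" for t x
          by (rule potential_difference_depends_only_on_time[OF T c an that])
        show "conv_radius (\<lambda>k. c k / fact k) > 0"
          by (rule real_analytic_Taylor_series(1)[OF T an[of 0] c[symmetric]])
        show "V1 t 0 - V2 t 0 = (\<Sum>k. c k / fact k * t ^ k)"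
          if "t \<in> {0..T}" "summable (\<lambda>k. c k / fact k * t ^ k)" for t
          by (rule real_analytic_Taylor_series(2)[OF T an[of 0] c[symmetric] that])
      qed
    qed
  qed
  \<comment> \<open>Elements of \<open>analytic_fields\<close> are gradients cut off outside \<open>[0, T]\<close>; this passes to the gradients.\<close>
  have cong: "regular_VP_solution T E f0 f \<longleftrightarrow> regular_VP_solution T E' f0 f"
    if "\<And>t. t \<in> {0..T} \<Longrightarrow> E t = E' t" for E E' :: "real \<Rightarrow> real ^ 'n \<Rightarrow> real ^ 'n" and f
    using that by (simp add: regular_VP_solution_def VP_solution_def)
  have part2: "E1 = E2"
    if E: "E1 \<in> analytic_fields T" "E2 \<in> analytic_fields T"
      and sol: "regular_VP_solution T E1 f0 g1" "regular_VP_solution T E2 f0 g2"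
      and dens: "restrict (\<lambda>t. spatial_density (g1 t)) {0..T} = restrict (\<lambda>t. spatial_density (g2 t)) {0..T}"
    for E1 E2 :: "real \<Rightarrow> real ^ 'n \<Rightarrow> real ^ 'n" and g1 g2
  proof -
    obtain V1 where V1: "E1 = restrict (\<lambda>t. grad (V1 t)) {0..T}" "Cinf_torus T V1"
      "\<And>x. real_analytic_on (\<lambda>t. V1 t x) {0..T}" using E(1) unfolding analytic_fields_def by blast
    obtain V2 where V2: "E2 = restrict (\<lambda>t. grad (V2 t)) {0..T}" "Cinf_torus T V2"
      "\<And>x. real_analytic_on (\<lambda>t. V2 t x) {0..T}" using E(2) unfolding analytic_fields_def by blast
    have s1: "regular_VP_solution T (\<lambda>t. grad (V1 t)) f0 g1"
      using sol(1) cong[of E1 "\<lambda>t. grad (V1 t)"] by (simp add: V1(1))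
    have s2: "regular_VP_solution T (\<lambda>t. grad (V2 t)) f0 g2"
      using sol(2) cong[of E2 "\<lambda>t. grad (V2 t)"] by (simp add: V2(1))
    have "spatial_density (g1 t) x = spatial_density (g2 t) x" if "t \<in> {0..<T}" for t x
      using fun_cong[OF fun_cong[OF dens, of t], of x] that by simp
    then have const: "(time_deriv T ^^ k) (\<lambda>t. V1 t x - V2 t x) 0 = (time_deriv T ^^ k) (\<lambda>t. V1 t 0 - V2 t 0) 0" for k x
      by (rule time_derivatives_of_potential_difference_constant[OF T assms(2,3) V1(2) V2(2) s1 s2])
    have C: "V1 t x - V2 t x = V1 t 0 - V2 t 0" if "t \<in> {0..T}" for t x
      by (rule potential_difference_depends_only_on_time[OF T const real_analytic_on_diff[OF V1(3) V2(3)] that])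
    have "grad (V1 t) x = grad (V2 t) x" if t: "t \<in> {0..T}" for t x
    proof -
      have "grad (\<lambda>x. V1 t x - V2 t x) x = grad (V1 t) x - grad (V2 t) x"
        by (rule grad_diff[OF Cinf_torus_slice[OF V1(2) t, of "Suc 0"] Cinf_torus_slice[OF V2(2) t, of "Suc 0"]])
      moreover have "(\<lambda>x. V1 t x - V2 t x) = (\<lambda>x. V1 t 0 - V2 t 0)" using C[OF t] by (rule ext)
      moreover have "grad (\<lambda>x :: real ^ 'n. V1 t 0 - V2 t 0) x = 0"
        by (simp add: grad_def partial_deriv_def vec_eq_iff)
      ultimately show ?thesis by simp
    qed
    then have "grad (V1 t) = grad (V2 t)" if "t \<in> {0..T}" for t using that by (intro ext)
    then show ?thesis unfolding V1(1) V2(1) by (intro restrict_ext)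
  qed
  show ?thesis
    unfolding Let_def
  proof (intro conjI allI impI inj_onI, goal_cases)
    case (1 V1 V2 f1 f2)
    then show ?case by (elim conjE) (rule part1)
  next
    case (2 sol E1 E2)
    show "E1 = E2"
      by (rule part2[of E1 E2 "sol E1" "sol E2"]) (use 2 in auto)
  qed
qed

end
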